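(* Under assumptions (A1), (A2), (A3) of the context, let $(\zeta_n,n\ge0)$ be the random walk in time random environment started at $0$ and conditioned to stay non-negative, and let $\nu:=\inf\{m\ge1:\zeta_{m+n}\ge\zeta_m\ \text{for all }n\ge0\}$. Define $\tilde{\mathbb{P}}(\cdot):=\int_\Omega\frac{U(\xi,0)}{U(0)}\mathbb{P}_\xi(\cdot)\,d\mathbf{P}$, where $U(0):=\mathbf{E}[U(\xi,0)]$, and let $\tilde{\mathbb{E}}$ be the corresponding expectation. Let $\Gamma_1:=\inf\{n\ge1:S_n\ge0\}$ be the first weak ascending ladder epoch of $(S_n)$ under $\mu^\infty$ (started at $S_0=0$). Then: (1) $\tilde{\mathbb{P}}(\zeta_\nu\in dx)=\mu^\infty(S_{\Gamma_1}\in dx)$. (2) For any measurable function $f$ (for which the expectations are well defined), $$\tilde{\mathbb{E}}[f(\nu,\zeta_1,\ldots,\zeta_\nu)]=\mathbb{E}_{\mu^\infty}\left[f(\Gamma_1,\,S_{\Gamma_1}-S_{\Gamma_1-1},\,S_{\Gamma_1}-S_{\Gamma_1-2},\,\ldots,\,S_{\Gamma_1}-S_0)\right],$$ the last entry being $S_{\Gamma_1}$.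
   Context: Environment: $\xi=(\xi_n)_{n\ge1}$ is a sequence of i.i.d. random variables on a probability space $(\Omega,\mathscr{A},\mathbf{P})$ (expectation $\mathbf{E}$). Each realization of $\xi_n$ determines a law $\mathcal{L}_n=\mathcal{L}(\xi_n)$ of a point process on $\mathbb{R}$; $L_n$ denotes a point process with law $\mathcal{L}_n$. $\mathbb{P}_\xi,\mathbb{E}_\xi$ denote quenched probability and expectation given $\xi$; the annealed probability is $\mathbb{P}(\cdot)=\int_\Omega\mathbb{P}_\xi(\cdot)\,d\mathbf{P}$, with expectation $\mathbb{E}$. The shift is $\theta\xi:=(\xi_2,\xi_3,\ldots)$, $\theta^n\xi:=\theta(\theta^{n-1}\xi)$, $\theta^0\xi:=\xi$. Assumptions (here $\sum_{x\in L_1}$ is the sum over the atoms of $L_1$, the displacements of the first generation of the associated branching random walk): (A1) $\mathbb{P}_\xi(\sum_{x\in L_1}1\ge1)=1$ $\mathbf{P}$-a.s.; $\mathbf{P}[\mathbb{P}_\xi(\sum_{x\in L_1}1>1)>0]>0$; $\mathbb{E}_\xi[\sum_{x\in L_1}\mathbf{1}_{\{x>0\}}e^{-x}]>0$ $\mathbf{P}$-a.s. (A2) $\log\mathbb{E}_\xi[\sum_{x\in L_1}e^{-x}]=\mathbb{E}_\xi[\sum_{x\in L_1}xe^{-x}]=0$ $\mathbf{P}$-a.s. (A3) there is $\delta>0$ with $\mathbb{E}[\sum_{x\in L_1}|x|^{2+\delta}e^{-x}]<\infty$. Associated random walk: $\mu_n(B):=\mathbb{E}_\xi[\sum_{x\in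 L_n}\mathbf{1}_{\{x\in B\}}e^{-x}]$ is a (random, $\xi$-dependent) probability measure on $\mathbb{R}$. Given $\xi$, $(X_n)_{n\ge1}$ are independent with $X_n\sim\mu_n$, and $S_n:=S_0+\sum_{i=1}^nX_i$; $\mathbb{P}_{\xi,a}$ denotes the quenched law with $S_0=a$, and $\mathbb{P}_\xi:=\mathbb{P}_{\xi,0}$. $\mu^\infty:=\prod_{n\ge1}\mathbf{E}(\mu_n)$ is the annealed law, under which $(S_n)$ is an ordinary random walk with i.i.d. steps of law $\mathbf{E}(\mu_1)$ started at $0$; $\mathbb{E}_{\mu^\infty}$ is its expectation. Quenched harmonic function: for $y\ge0$, $\tau_y:=\inf\{n\ge1:y+S_n<0\}$ and $U(\xi,y):=\lim_{n\to\infty}\mathbb{E}_\xi[(y+S_n)\mathbf{1}_{\{\tau_y>n\}}]=-\mathbb{E}_\xi(S_{\tau_y})$. It is known that for almost all $\xi$ the limit exists, is finite and positive, and $U(\xi,y)=\mathbb{E}_\xi[U(\theta\xi,y+S_1)\mathbf{1}_{\{\tau_y>1\}}]$. Moreover $U(0)=\mathbf{E}[U(\xi,0)]<\infty$. Conditioned walk: $(\zeta_n,n\ge0)$ is, under $\mathbb{P}_\xi$, the time-inhomogeneous Markov chain on $[0,\infty)$ with $\zeta_0=0$ and $$\mathbb{P}_\xi(\zeta_j\in dy\mid\zeta_{j-1}=x)=\frac{U(\theta^j\xi,y)\mathbf{1}_{\{y\ge0\}}}{U(\theta^{j-1}\xi,x)}\,\mathbb{P}_{\theta^{j-1}\xi,x}(S_1\in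 dy),\quad j\ge1.$$ *)

theory Defs
  imports "HOL-Probability.Probability"
begin

text \<open>
  A point configuration is represented by its counting measure: a Borel measure with values in
  the natural numbers or infinity that is finite on bounded sets. Atoms are counted with
  multiplicity, and infinitely many atoms are allowed. The sigma-algebra is the one generated by
  the evaluations \<open>N \<mapsto> N B\<close>, as in \<^const>\<open>subprob_algebra\<close>.
\<close>

definition point_configurations :: "real measure set" where
  "point_configurations =
     {N. sets N = sets borel \<and>
         (\<forall>B\<in>sets borel. emeasure N B \<in> insert \<infinity> (range of_nat)) \<and>
         (\<forall>B\<in>sets borel. bounded B \<longrightarrow> emeasure N B < \<infinity>)}"

definition configuration_space :: "real measure measure" where
  "configuration_space =
     (SUP B\<in>sets borel. vimage_algebra point_configurations (\<lambda>N. emeasure N B) borel)"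

text \<open>
  In this representation the sum of \<open>g x\<close> over the atoms \<open>x\<close> of \<open>N\<close> is the integral of \<open>g\<close> with
  respect to \<open>N\<close>; \<open>expected_atom_sum \<Lambda> g\<close> is its expectation when \<open>N\<close> has law \<open>\<Lambda>\<close>.
\<close>

definition atom_sum :: "real measure \<Rightarrow> (real \<Rightarrow> ennreal) \<Rightarrow> ennreal" where
  "atom_sum N g = (\<integral>\<^sup>+x. g x \<partial>N)"

definition expected_atom_sum :: "real measure measure \<Rightarrow> (real \<Rightarrow> ennreal) \<Rightarrow> ennreal" where
  "expected_atom_sum \<Lambda> g = (\<integral>\<^sup>+N. atom_sum N g \<partial>\<Lambda>)"

text \<open>Here \<open>\<Lambda> \<omega>\<close> is the random law of the point process \<open>L\<^sub>1\<close>.\<close>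

definition assumption_A1 :: "'w measure \<Rightarrow> ('w \<Rightarrow> real measure measure) \<Rightarrow> bool" where
  "assumption_A1 M \<Lambda> \<longleftrightarrow>
     (AE \<omega> in M. emeasure (\<Lambda> \<omega>) {N \<in> space (\<Lambda> \<omega>). atom_sum N (\<lambda>x. 1) \<ge> 1} = 1) \<and>
     emeasure M {\<omega> \<in> space M.
       emeasure (\<Lambda> \<omega>) {N \<in> space (\<Lambda> \<omega>). atom_sum N (\<lambda>x. 1) > 1} > 0} > 0 \<and>
     (AE \<omega> in M. expected_atom_sum (\<Lambda> \<omega>)
        (\<lambda>x. indicator {0<..} x * ennreal (exp (- x))) > 0)"

text \<open>
  The signed expectation in the last clause is a Bochner integral, which is 0 by convention when
  the integrand is not integrable; hence the explicit integrability clause.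
\<close>

definition assumption_A2 :: "'w measure \<Rightarrow> ('w \<Rightarrow> real measure measure) \<Rightarrow> bool" where
  "assumption_A2 M \<Lambda> \<longleftrightarrow>
     (AE \<omega> in M.
        expected_atom_sum (\<Lambda> \<omega>) (\<lambda>x. ennreal (exp (- x))) = 1 \<and>
        expected_atom_sum (\<Lambda> \<omega>) (\<lambda>x. ennreal (\<bar>x\<bar> * exp (- x))) < \<infinity> \<and>
        (\<integral>N. (\<integral>x. x * exp (- x) \<partial>N) \<partial>(\<Lambda> \<omega>)) = 0)"

definition assumption_A3 :: "'w measure \<Rightarrow> ('w \<Rightarrow> real measure measure) \<Rightarrow> bool" where
  "assumption_A3 M \<Lambda> \<longleftrightarrow>
     (\<exists>\<delta>>0. (\<integral>\<^sup>+\<omega>. expected_atom_sum (\<Lambda> \<omega>)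
                 (\<lambda>x. ennreal (\<bar>x\<bar> powr (2 + \<delta>) * exp (- x))) \<partial>M) < \<infinity>)"

definition step_law :: "real measure measure \<Rightarrow> real measure" where
  "step_law \<Lambda> = measure_of UNIV (sets borel)
     (\<lambda>B. expected_atom_sum \<Lambda> (\<lambda>x. indicator B x * ennreal (exp (- x))))"

definition mean_step_law :: "'w measure \<Rightarrow> ('w \<Rightarrow> real measure measure) \<Rightarrow> real measure" where
  "mean_step_law M \<Lambda> = measure_of UNIV (sets borel)
     (\<lambda>B. \<integral>\<^sup>+\<omega>. emeasure (step_law (\<Lambda> \<omega>)) B \<partial>M)"

abbreviation path_space :: "(nat \<Rightarrow> real) measure" where
  "path_space \<equiv> PiM UNIV (\<lambda>_. borel)"

text \<open>Law of the path \<open>(S\<^sub>n)\<close>, \<open>n \<ge> 0\<close>, with \<open>S\<^sub>0 = a\<close> and independent steps \<open>X\<^sub>n\<close> of law \<open>\<kappa> n\<close>, \<open>n \<ge> 1\<close>.\<close>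

definition random_walk_law :: "(nat \<Rightarrow> real measure) \<Rightarrow> real \<Rightarrow> (nat \<Rightarrow> real) measure" where
  "random_walk_law \<kappa> a =
     distr (PiM {1..} \<kappa>) path_space (\<lambda>X n. a + (\<Sum>i=1..n. X i))"

text \<open>
  An environment is a sequence \<open>e\<close> of which only the entries \<open>e n\<close> with \<open>n \<ge> 1\<close> are relevant, and
  \<open>L\<close> maps an entry to the point process law it determines. The law \<open>quenched_walk L e a\<close> is that of
  \<open>S\<close> in the environment \<open>e\<close> with \<open>S\<^sub>0 = a\<close>.
\<close>

definition quenched_walk ::
    "('e \<Rightarrow> real measure measure) \<Rightarrow> (nat \<Rightarrow> 'e) \<Rightarrow> real \<Rightarrow> (nat \<Rightarrow> real) measure" where
  "quenched_walk L e a = random_walk_law (\<lambda>n. step_law (L (e n))) a"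

definition annealed_walk ::
    "'w measure \<Rightarrow> (nat \<Rightarrow> 'w \<Rightarrow> 'e) \<Rightarrow> ('e \<Rightarrow> real measure measure) \<Rightarrow> (nat \<Rightarrow> real) measure" where
  "annealed_walk M \<xi> L = random_walk_law (\<lambda>n. mean_step_law M (\<lambda>\<omega>. L (\<xi> n \<omega>))) 0"

definition env_shift :: "(nat \<Rightarrow> 'e) \<Rightarrow> nat \<Rightarrow> 'e" where
  "env_shift e = (\<lambda>n. e (Suc n))"

definition exit_time :: "real \<Rightarrow> (nat \<Rightarrow> real) \<Rightarrow> enat" where
  "exit_time y S = Inf (enat ` {n. n \<ge> 1 \<and> y + S n < 0})"

definition harmonic_U :: "('e \<Rightarrow> real measure measure) \<Rightarrow> (nat \<Rightarrow> 'e) \<Rightarrow> real \<Rightarrow> real" where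
  "harmonic_U L e y =
     lim (\<lambda>n. \<integral>S. (y + S n) * indicator {S. exit_time y S > enat n} S \<partial>(quenched_walk L e 0))"

definition conditioned_kernel ::
    "('e \<Rightarrow> real measure measure) \<Rightarrow> (nat \<Rightarrow> 'e) \<Rightarrow> nat \<Rightarrow> real \<Rightarrow> real measure" where
  "conditioned_kernel L e j x =
     density (distr (quenched_walk L ((env_shift ^^ (j - 1)) e) x) borel (\<lambda>S. S 1))
       (\<lambda>y. ennreal (harmonic_U L ((env_shift ^^ j) e) y * indicator {0..} y /
                     harmonic_U L ((env_shift ^^ (j - 1)) e) x))"

text \<open>
  \<open>Q\<close> is the law of a time-inhomogeneous Markov chain started at \<open>x\<^sub>0\<close> with transition law \<open>K j x\<close>
  from time \<open>j - 1\<close> to time \<open>j\<close>: conditionally on the history before time \<open>j\<close>, the state at time \<open>j\<close>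
  has law \<open>K j\<close> evaluated at the state at time \<open>j - 1\<close>.
\<close>

definition markov_chain_law ::
    "(nat \<Rightarrow> real \<Rightarrow> real measure) \<Rightarrow> real \<Rightarrow> (nat \<Rightarrow> real) measure \<Rightarrow> bool" where
  "markov_chain_law K x\<^sub>0 Q \<longleftrightarrow>
     prob_space Q \<and> sets Q = sets path_space \<and> (AE z in Q. z 0 = x\<^sub>0) \<and>
     (\<forall>j\<ge>1. \<forall>C\<in>sets (PiM {..<j} (\<lambda>_. borel)). \<forall>B\<in>sets borel.
        emeasure Q {z \<in> space Q. restrict z {..<j} \<in> C \<and> z j \<in> B} =
        (\<integral>\<^sup>+z. indicator C (restrict z {..<j}) * emeasure (K j (z (j - 1))) B \<partial>Q))"

text \<open>
  The constant \<open>U(0)\<close>. Since \<open>U\<close> is positive almost surely, its mean is taken as a nonnegative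
  integral, which is insensitive to the values of \<open>harmonic_U\<close> on the null set of environments
  where the limit defining it fails to exist.
\<close>

definition mean_U ::
    "'w measure \<Rightarrow> (nat \<Rightarrow> 'w \<Rightarrow> 'e) \<Rightarrow> ('e \<Rightarrow> real measure measure) \<Rightarrow> ennreal" where
  "mean_U M \<xi> L = (\<integral>\<^sup>+\<omega>. ennreal (harmonic_U L (\<lambda>n. \<xi> n \<omega>) 0) \<partial>M)"

text \<open>
  Law of \<open>(\<zeta>\<^sub>n)\<close> under the tilted annealed probability, given the quenched law \<open>Q e\<close> of \<open>(\<zeta>\<^sub>n)\<close> in
  each environment \<open>e\<close>.
\<close>

definition tilted_law ::
    "'w measure \<Rightarrow> (nat \<Rightarrow> 'w \<Rightarrow> 'e) \<Rightarrow> ('e \<Rightarrow> real measure measure) \<Rightarrow>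
     ((nat \<Rightarrow> 'e) \<Rightarrow> (nat \<Rightarrow> real) measure) \<Rightarrow> (nat \<Rightarrow> real) measure" where
  "tilted_law M \<xi> L Q = measure_of (space path_space) (sets path_space)
     (\<lambda>A. \<integral>\<^sup>+\<omega>. ennreal (harmonic_U L (\<lambda>n. \<xi> n \<omega>) 0) / mean_U M \<xi> L *
                 emeasure (Q (\<lambda>n. \<xi> n \<omega>)) A \<partial>M)"

definition future_min_time :: "(nat \<Rightarrow> real) \<Rightarrow> enat" where
  "future_min_time z = Inf (enat ` {m. m \<ge> 1 \<and> (\<forall>n. z (m + n) \<ge> z m)})"

definition weak_ladder_epoch :: "(nat \<Rightarrow> real) \<Rightarrow> enat" where
  "weak_ladder_epoch S = Inf (enat ` {n. n \<ge> 1 \<and> S n \<ge> 0})"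

end

theory Submission
  imports Defs
begin

text \<open>
  The tilted law turns a conditioned walk in a random environment into a conditioned walk with i.i.d.
  steps. In a fixed environment \<open>\<xi>\<close> the density of \<open>\<zeta>\<^sub>1, \<dots>, \<zeta>\<^sub>m\<close> with respect to the quenched walk is
  \<open>U(\<theta>\<^sup>m\<xi>, S\<^sub>m) / U(\<xi>, 0)\<close> on the event that the walk stays nonnegative, since the transition weights
  telescope (\<open>chain_law\<close>). The tilt removes the denominator. The shifted environment \<open>\<theta>\<^sup>m\<xi>\<close> is
  independent of the first \<open>m\<close> steps, so averaging over \<open>\<xi>\<close> replaces the quenched steps by annealed
  ones and \<open>U(\<theta>\<^sup>m\<xi>, \<cdot>)\<close> by its mean \<open>h\<close> (\<open>nn_integral_killed_paths\<close>). Hence under the tilted law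
  \<open>\<zeta>\<close> is the Doob transform, by \<open>h\<close>, of the annealed walk killed below zero, and \<open>h\<close> is harmonic for
  that walk.

  For the transformed walk the event \<open>\<nu> = k\<close> says that the path has a strict minimum over \<open>{1..k}\<close> at
  time \<open>k\<close> and never goes below this value afterwards. Given \<open>S\<^sub>k = s\<close>, the second requirement has the
  probability \<open>h 0 / h s\<close>: the expectation \<open>E (h (s + S\<^sub>m); S \<ge> 0 up to m)\<close> tends to \<open>h 0\<close>, because
  \<open>h (s + t) \<le> h t + h s + s\<close> and because the survival probability tends to zero
  (\<open>h_subadditive\<close>, \<open>stays_decay\<close>, \<open>emeasure_kept_minimum\<close>). The density \<open>h s / h 0\<close> cancels, so \<open>\<nu> = k\<close> together with the path up to
  time \<open>k\<close> has the probability, under the free annealed walk, that time \<open>k\<close> is a strict minimum at a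
  nonnegative height. Reversing the \<open>k\<close> steps makes this the event \<open>\<Gamma>\<^sub>1 = k\<close>, with the path read
  backwards from its end point (\<open>final_minimum_reversal\<close>).

  The facts about \<open>U\<close> that this uses, finiteness and harmonicity, are proved as well. Monotone limits
  give harmonicity and \<open>h y = E U(\<xi>, y)\<close>, so everything rests on \<open>h < \<infinity>\<close>. The value \<open>h 0\<close> is the
  expected undershoot at the first passage below zero. It is finite by duality: the expected number of
  visits to a cell before killing is bounded uniformly over the cells (\<open>occupation_bound\<close>), and the
  undershoots from successive cells are summable under a second moment (\<open>suminf_undershoot\<close>).
\<close>

section \<open>Independent coordinates and partial sums\<close>

text \<open>
  Conditioning on the first coordinate. The factors may differ, because the steps of the quenched
  walk are independent with laws that change from step to step.
\<close>

lemma nn_integral_PiM_first: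
  fixes M :: "nat \<Rightarrow> 'a measure"
  assumes M: "\<And>i. prob_space (M i)" and F [measurable]: "F \<in> borel_measurable (PiM UNIV M)"
  shows "(\<integral>\<^sup>+X. F X \<partial>PiM UNIV M) =
    (\<integral>\<^sup>+x. \<integral>\<^sup>+X. F (case_nat x X) \<partial>PiM UNIV (\<lambda>i. M (Suc i)) \<partial>M 0)"
proof -
  interpret M0: prob_space "M 0" by (rule M)
  interpret R: prob_space "PiM {Suc 0..} M" by (intro prob_space_PiM M)
  interpret RS: prob_space "PiM UNIV (\<lambda>i. M (Suc i))" by (intro prob_space_PiM M)
  have ins: "insert 0 {Suc 0..} = (UNIV :: nat set)" by auto
  have shift: "distr (PiM {Suc 0..} M) (PiM UNIV (\<lambda>i. M (Suc i))) (\<lambda>\<omega> n. \<omega> (Suc n)) =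
      PiM UNIV (\<lambda>i. M (Suc i))"
    using distr_PiM_reindex[of "{Suc 0..}" M Suc UNIV] M by (simp add: restrict_UNIV)
  have cn: "X(0 := x) = case_nat x (\<lambda>n. X (Suc n))" for X :: "nat \<Rightarrow> 'a" and x
    by (auto simp: fun_eq_iff split: nat.split)
  have upd [measurable]: "(\<lambda>(x, X). X(0 := x)) \<in> M 0 \<Otimes>\<^sub>M PiM {Suc 0..} M \<rightarrow>\<^sub>M PiM UNIV M"
    using measurable_compose[OF measurable_pair_swap'
        measurable_add_dim[of 0 "{Suc 0..}" M, unfolded ins]] by (simp add: split_beta')
  have sh [measurable]: "(\<lambda>\<omega> n. \<omega> (Suc n)) \<in> PiM {Suc 0..} M \<rightarrow>\<^sub>M PiM UNIV (\<lambda>i. M (Suc i))"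
    by (rule measurable_PiM_single') (auto simp: space_PiM PiE_iff)
  have cnm [measurable]: "(\<lambda>X. case_nat x X) \<in> PiM UNIV (\<lambda>i. M (Suc i)) \<rightarrow>\<^sub>M PiM UNIV M" if "x \<in> space (M 0)" for x
  proof (rule measurable_PiM_single')
    show "(\<lambda>X. case_nat x X i) \<in> PiM UNIV (\<lambda>i. M (Suc i)) \<rightarrow>\<^sub>M M i" for i
      using that by (cases i) auto
  qed (use that in \<open>auto simp: space_PiM PiE_iff split: nat.split\<close>)
  have "(\<integral>\<^sup>+X. F X \<partial>PiM UNIV M) =
     (\<integral>\<^sup>+p. F ((\<lambda>(x, X). X(0 := x)) p) \<partial>(M 0 \<Otimes>\<^sub>M PiM {Suc 0..} M))"
    by (subst distr_pair_PiM_eq_PiM[of "{Suc 0..}" M 0, unfolded ins, OF M M, symmetric],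
        subst nn_integral_distr) auto
  also have "\<dots> = (\<integral>\<^sup>+x. \<integral>\<^sup>+X. F (X(0 := x)) \<partial>PiM {Suc 0..} M \<partial>M 0)"
    by (subst R.nn_integral_fst[symmetric]) auto
  also have "\<dots> = (\<integral>\<^sup>+x. \<integral>\<^sup>+X. F (case_nat x X) \<partial>PiM UNIV (\<lambda>i. M (Suc i)) \<partial>M 0)"
  proof (rule nn_integral_cong)
    fix x assume "x \<in> space (M 0)"
    then show "(\<integral>\<^sup>+X. F (X(0 := x)) \<partial>PiM {Suc 0..} M) =
        (\<integral>\<^sup>+X. F (case_nat x X) \<partial>PiM UNIV (\<lambda>i. M (Suc i)))"
      by (subst shift[symmetric], subst nn_integral_distr) (auto simp: cn)
  qed
  finally show ?thesis .
qed

lemma nn_integral_PiM_split: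
  fixes \<rho> :: "'a measure"
  assumes "prob_space \<rho>" and F [measurable]: "F \<in> borel_measurable (PiM (UNIV :: nat set) (\<lambda>_. \<rho>))"
  shows "(\<integral>\<^sup>+X. F X \<partial>PiM UNIV (\<lambda>_. \<rho>)) =
    (\<integral>\<^sup>+X. \<integral>\<^sup>+Y. F (comb_seq k X Y) \<partial>PiM UNIV (\<lambda>_. \<rho>) \<partial>PiM UNIV (\<lambda>_. \<rho>))"
proof -
  interpret prob_space \<rho> by fact
  interpret sequence_space \<rho> ..
  have "(\<integral>\<^sup>+X. F X \<partial>S) = (\<integral>\<^sup>+p. F ((\<lambda>(X, Y). comb_seq k X Y) p) \<partial>(S \<Otimes>\<^sub>M S))"
    by (subst PiM_comb_seq[symmetric, of k], subst nn_integral_distr) auto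
  also have "\<dots> = (\<integral>\<^sup>+X. \<integral>\<^sup>+Y. F (comb_seq k X Y) \<partial>S \<partial>S)"
    by (subst P.nn_integral_fst[symmetric]) auto
  finally show ?thesis .
qed

lemma pred_le_measurable [measurable (raw)]:
  fixes f :: "'a \<Rightarrow> real"
  assumes [measurable]: "f \<in> borel_measurable M" "g \<in> borel_measurable M"
  shows "Measurable.pred M (\<lambda>w. f w \<le> g w)"
  unfolding not_less[symmetric] by measurable

lemma space_path_space [simp]: "space path_space = UNIV" by (simp add: space_PiM)

lemma UNIV_path_space [simp]: "UNIV \<in> sets path_space"
  using sets.top[of path_space] unfolding space_path_space .

definition psum :: "(nat \<Rightarrow> real) \<Rightarrow> nat \<Rightarrow> real" where
  "psum X n = (\<Sum>i<n. X i)"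

section \<open>Centred walks killed below zero\<close>

text \<open>
  Moments are stated with nonnegative integrals throughout: they average over random environments
  without any integrability side condition.
\<close>

definition real_law :: "real measure \<Rightarrow> bool" where
  "real_law \<mu> \<longleftrightarrow> prob_space \<mu> \<and> sets \<mu> = sets borel"

definition centred :: "real measure \<Rightarrow> bool" where
  "centred \<mu> \<longleftrightarrow> real_law \<mu> \<and> (\<integral>\<^sup>+x. ennreal x \<partial>\<mu>) = (\<integral>\<^sup>+x. ennreal (- x) \<partial>\<mu>) \<and>
     (\<integral>\<^sup>+x. ennreal x \<partial>\<mu>) < \<infinity>"

text \<open>
  The expectation of \<open>y + S\<^sub>n\<close> on the event that the walk \<open>y + S\<close> with step laws
  \<open>\<kappa> 0, \<kappa> 1, \<dots>\<close> has not gone below zero up to time \<open>n\<close>, defined through the first step.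
  One definition serves both walks: \<open>\<kappa> i\<close> depends on the environment for the quenched walk and is
  constant for the annealed one.
\<close>

fun killed_mean :: "(nat \<Rightarrow> real measure) \<Rightarrow> nat \<Rightarrow> real \<Rightarrow> ennreal" where
  "killed_mean \<kappa> 0 y = ennreal y"
| "killed_mean \<kappa> (Suc n) y =
    (\<integral>\<^sup>+x. indicator {0..} (y + x) * killed_mean (\<lambda>i. \<kappa> (Suc i)) n (y + x) \<partial>\<kappa> 0)"

text \<open>
  For centred steps the expectations increase with \<open>n\<close>, so the supremum is the limit that
  defines \<open>U\<close>.
\<close>

definition harmonic :: "(nat \<Rightarrow> real measure) \<Rightarrow> real \<Rightarrow> ennreal" where
  "harmonic \<kappa> y = (SUP n. killed_mean \<kappa> n y)"

lemma psum_0 [simp]: "psum X 0 = 0" by (simp add: psum_def)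
lemma psum_Suc: "psum X (Suc n) = psum X n + X n" by (simp add: psum_def)

lemma psum_case_nat: "psum (case_nat x X) (Suc n) = x + psum X n"
  by (induction n) (simp_all add: psum_Suc)

lemma psum_comb_seq_le: "n \<le> k \<Longrightarrow> psum (comb_seq k X Y) n = psum X n"
  unfolding psum_def by (intro sum.cong) (auto simp: comb_seq_def)

lemma psum_comb_seq_add: "psum (comb_seq k X Y) (k + n) = psum X k + psum Y n"
proof (induction n)
  case 0 then show ?case using psum_comb_seq_le[of k k X Y] by simp
next
  case (Suc n)
  have "comb_seq k X Y (k + n) = Y n" by (simp add: comb_seq_def)
  then show ?case using Suc by (simp add: psum_Suc)
qed

lemma measurable_psum_component [measurable]: "(\<lambda>X. psum X n) \<in> borel_measurable path_space"
  unfolding psum_def by measurable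

lemma measurable_psum [measurable]: "psum \<in> path_space \<rightarrow>\<^sub>M path_space"
  by (rule measurable_PiM_single') (auto simp: space_PiM)

lemma real_lawD:
  assumes "real_law \<mu>" shows "prob_space \<mu>" "sets \<mu> = sets borel" "space \<mu> = UNIV"
  using assms sets_eq_imp_space_eq[of \<mu> borel] by (auto simp: real_law_def)

lemma centredD:
  assumes "centred \<mu>" shows "real_law \<mu>" "prob_space \<mu>" "sets \<mu> = sets borel" "space \<mu> = UNIV"
  using assms real_lawD by (auto simp: centred_def)

lemma sets_PiM_real_law: "(\<And>i. real_law (\<kappa> i)) \<Longrightarrow> sets (PiM UNIV \<kappa>) = sets path_space"
  by (intro sets_PiM_cong) (auto dest: real_lawD)

lemma measurable_killed_mean:
  assumes "\<And>i. real_law (\<kappa> i)"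
  shows "killed_mean \<kappa> n \<in> borel_measurable borel"
  using assms
proof (induction n arbitrary: \<kappa>)
  case 0 then show ?case by simp
next
  case (Suc n)
  have [measurable]: "killed_mean (\<lambda>i. \<kappa> (Suc i)) n \<in> borel_measurable borel" by (intro Suc)
  interpret prob_space "\<kappa> 0" using Suc.prems real_lawD by auto
  note [measurable_cong] = real_lawD(2)[OF Suc.prems[of 0]]
  show ?case unfolding killed_mean.simps by measurable
qed

lemma measurable_harmonic:
  assumes "\<And>i. real_law (\<kappa> i)"
  shows "harmonic \<kappa> \<in> borel_measurable borel"
proof -
  note [measurable] = measurable_killed_mean[OF assms]
  show ?thesis unfolding harmonic_def[abs_def] by measurable
qed

lemma killed_mean_mono:
  assumes "y \<le> z"
  shows "killed_mean \<kappa> n y \<le> killed_mean \<kappa> n z"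
  using assms
proof (induction n arbitrary: \<kappa> y z)
  case 0 then show ?case by (simp add: ennreal_leI)
next
  case (Suc n)
  show ?case unfolding killed_mean.simps
    using Suc.prems by (intro nn_integral_mono mult_mono Suc.IH) (auto split: split_indicator)
qed

text \<open>
  The identity \<open>E (y + X) = y\<close>, split into positive and negative parts. The second summand is
  the expected overshoot below zero, which is what makes \<^const>\<open>killed_mean\<close> grow with the number of
  steps.
\<close>

lemma nn_integral_pos_part_shift:
  assumes "centred \<mu>" and "0 \<le> y"
  shows "(\<integral>\<^sup>+x. ennreal (y + x) \<partial>\<mu>) = ennreal y + (\<integral>\<^sup>+x. ennreal (- (y + x)) \<partial>\<mu>)"
proof -
  interpret prob_space \<mu> using assms centredD by auto
  note [measurable_cong] = centredD(3)[OF assms(1)]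
  define I where "I = (\<integral>\<^sup>+x. ennreal x \<partial>\<mu>)"
  have I: "I < \<infinity>" "(\<integral>\<^sup>+x. ennreal (- x) \<partial>\<mu>) = I" using assms by (auto simp: centred_def I_def)
  \<comment> \<open>\<open>a\<^sup>+ - a\<^sup>- = a\<close> for \<open>a = x\<close> and \<open>a = y + x\<close>, written without subtraction\<close>
  have pt: "ennreal (y + x) + ennreal (- x) = ennreal y + ennreal (- (y + x)) + ennreal x" for x
    using \<open>0 \<le> y\<close> by (cases "0 \<le> x"; cases "0 \<le> y + x")
      (auto simp: ennreal_neg ennreal_plus[symmetric] simp del: ennreal_plus)
  have "(\<integral>\<^sup>+x. ennreal (y + x) \<partial>\<mu>) + I = (\<integral>\<^sup>+x. ennreal (y + x) + ennreal (- x) \<partial>\<mu>)"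
    by (subst nn_integral_add) (auto simp: I)
  also have "\<dots> = ennreal y + (\<integral>\<^sup>+x. ennreal (- (y + x)) \<partial>\<mu>) + I"
    unfolding pt by (subst nn_integral_add, measurable, subst nn_integral_add, measurable)
      (auto simp: I_def emeasure_space_1)
  finally show ?thesis
    using I(1) by (metis add.commute ennreal_add_left_cancel infinity_ennreal_def less_irrefl)
qed

lemma killed_mean_incseq:
  assumes "\<And>i. centred (\<kappa> i)" "0 \<le> y"
  shows "killed_mean \<kappa> n y \<le> killed_mean \<kappa> (Suc n) y"
  using assms
proof (induction n arbitrary: \<kappa> y)
  case 0
  have "ennreal y \<le> (\<integral>\<^sup>+x. ennreal (y + x) \<partial>\<kappa> 0)"
    using nn_integral_pos_part_shift[of "\<kappa> 0" y] 0 by (simp add: add_increasing2)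
  also have "\<dots> = (\<integral>\<^sup>+x. indicator {0..} (y + x) * ennreal (y + x) \<partial>\<kappa> 0)"
    by (intro nn_integral_cong) (auto split: split_indicator simp: ennreal_neg)
  finally show ?case by simp
next
  case (Suc n)
  show ?case
    by (subst (1 2) killed_mean.simps, intro nn_integral_mono)
      (use Suc.prems in \<open>auto split: split_indicator intro!: Suc.IH simp del: killed_mean.simps\<close>)
qed

lemma incseq_killed_mean:
  assumes "\<And>i. centred (\<kappa> i)" "0 \<le> y"
  shows "incseq (\<lambda>n. killed_mean \<kappa> n y)"
  using killed_mean_incseq[of \<kappa> y, OF assms] by (rule incseq_SucI)

lemma harmonic_mono: "y \<le> z \<Longrightarrow> harmonic \<kappa> y \<le> harmonic \<kappa> z"
  unfolding harmonic_def by (intro SUP_mono) (auto intro: killed_mean_mono)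

lemma harmonic_ge: "ennreal y \<le> harmonic \<kappa> y"
  unfolding harmonic_def by (rule SUP_upper2[of 0]) auto

text \<open>
  Harmonicity is the recursion of \<^const>\<open>killed_mean\<close> in the limit, by monotone convergence.
\<close>

lemma harmonic_step:
  assumes "\<And>i. centred (\<kappa> i)" "0 \<le> y"
  shows "harmonic \<kappa> y = (\<integral>\<^sup>+x. indicator {0..} (y + x) * harmonic (\<lambda>i. \<kappa> (Suc i)) (y + x) \<partial>\<kappa> 0)"
proof -
  note [measurable_cong] = centredD(3)[OF assms(1)[of 0]]
  have [measurable]: "killed_mean (\<lambda>i. \<kappa> (Suc i)) n \<in> borel_measurable borel" for n
    using centredD assms by (intro measurable_killed_mean) auto
  have "harmonic \<kappa> y = (SUP n. killed_mean \<kappa> (Suc n) y)"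
    unfolding harmonic_def using killed_mean_incseq[of \<kappa> y, OF assms]
    by (intro antisym SUP_mono) (blast, blast)
  also have "\<dots> = (\<integral>\<^sup>+x. (SUP n. indicator {0..} (y + x) * killed_mean (\<lambda>i. \<kappa> (Suc i)) n (y + x)) \<partial>\<kappa> 0)"
    unfolding killed_mean.simps
  proof (rule nn_integral_monotone_convergence_SUP[symmetric])
    show "incseq (\<lambda>n x. indicator {0..} (y + x) * killed_mean (\<lambda>i. \<kappa> (Suc i)) n (y + x))"
      using incseq_killed_mean[of "\<lambda>i. \<kappa> (Suc i)"] assms
      by (auto simp: incseq_def le_fun_def split: split_indicator)
  qed measurable
  finally show ?thesis unfolding harmonic_def by (simp add: SUP_mult_left_ennreal)
qed

lemma harmonic_pos:
  assumes "real_law (\<kappa> 0)" "0 < emeasure (\<kappa> 0) {0<..}" "0 \<le> y"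
  shows "0 < harmonic \<kappa> y"
proof -
  note [measurable_cong] = real_lawD(2)[OF assms(1)]
  have "killed_mean \<kappa> 1 0 \<noteq> 0"
  proof
    assume "killed_mean \<kappa> 1 0 = 0"
    then have "AE x in \<kappa> 0. indicator {0..} x * ennreal x = 0"
      by (simp add: nn_integral_0_iff_AE)
    then have "AE x in \<kappa> 0. x \<notin> {0<..}" by eventually_elim (auto split: split_indicator_asm)
    then have "emeasure (\<kappa> 0) {0<..} = 0"
      by (subst (asm) AE_iff_null) (auto simp: greaterThan_def real_lawD(3)[OF assms(1)] real_lawD(2)[OF assms(1)])
    then show False using assms(2) by simp
  qed
  then have "0 < killed_mean \<kappa> 1 0" by (simp add: zero_less_iff_neq_zero)
  also have "\<dots> \<le> harmonic \<kappa> 0" unfolding harmonic_def by (intro SUP_upper) simp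
  also have "\<dots> \<le> harmonic \<kappa> y" by (rule harmonic_mono) fact
  finally show ?thesis .
qed

lemma killed_mean_eq_walk:
  assumes "\<And>i. real_law (\<kappa> i)"
  shows "killed_mean \<kappa> n y = (\<integral>\<^sup>+X. (\<Prod>i\<in>{1..n}. indicator {0..} (y + psum X i)) * ennreal (y + psum X n) \<partial>PiM UNIV \<kappa>)"
  using assms
proof (induction n arbitrary: \<kappa> y)
  case 0
  interpret prob_space "PiM UNIV \<kappa>" using 0 real_lawD by (intro prob_space_PiM) auto
  show ?case by (simp add: emeasure_space_1)
next
  case (Suc n)
  note [measurable_cong] = sets_PiM_real_law[OF Suc.prems] sets_PiM_real_law[of "\<lambda>i. \<kappa> (Suc i)", OF Suc.prems]
  have *: "prod f {1..Suc n} = f 1 * prod (\<lambda>i. f (Suc i)) {1..n}" for f :: "nat \<Rightarrow> ennreal"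
    by (induction n) (auto simp: mult.assoc)
  have **: "(\<Prod>i\<in>{1..Suc n}. indicator {0..} (y + psum (case_nat x X) i) :: ennreal) =
     indicator {0..} (y + x) * (\<Prod>i\<in>{1..n}. indicator {0..} (y + x + psum X i))" for x X
    unfolding * by (simp add: psum_case_nat[of x X 0, simplified] psum_case_nat add.assoc)
  have "(\<integral>\<^sup>+X. (\<Prod>i\<in>{1..Suc n}. indicator {0..} (y + psum X i)) * ennreal (y + psum X (Suc n)) \<partial>PiM UNIV \<kappa>) =
      (\<integral>\<^sup>+x. \<integral>\<^sup>+X. (\<Prod>i\<in>{1..Suc n}. indicator {0..} (y + psum (case_nat x X) i)) *
          ennreal (y + psum (case_nat x X) (Suc n)) \<partial>PiM UNIV (\<lambda>i. \<kappa> (Suc i)) \<partial>\<kappa> 0)"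
    using Suc.prems real_lawD(1) by (intro nn_integral_PiM_first) auto
  also have "\<dots> = (\<integral>\<^sup>+x. indicator {0..} (y + x) * (\<integral>\<^sup>+X. (\<Prod>i\<in>{1..n}. indicator {0..} (y + x + psum X i)) *
          ennreal (y + x + psum X n) \<partial>PiM UNIV (\<lambda>i. \<kappa> (Suc i))) \<partial>\<kappa> 0)"
    unfolding ** psum_case_nat mult.assoc add.assoc[symmetric]
    by (intro nn_integral_cong nn_integral_cmult) measurable
  also have "\<dots> = killed_mean \<kappa> (Suc n) y"
    using Suc.IH[of "\<lambda>i. \<kappa> (Suc i)"] Suc.prems by simp
  finally show ?case ..
qed

section \<open>Survival and time reversal\<close>

definition stays :: "nat \<Rightarrow> (nat \<Rightarrow> real) \<Rightarrow> bool" where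
  "stays m X \<longleftrightarrow> (\<forall>i\<le>m. 0 \<le> psum X i)"

lemma stays_Suc: "stays (Suc m) X \<longleftrightarrow> stays m X \<and> 0 \<le> psum X m + X m"
  by (auto simp: stays_def le_Suc_eq psum_Suc[symmetric])

lemma stays_antimono: "stays m X \<Longrightarrow> n \<le> m \<Longrightarrow> stays n X"
  by (auto simp: stays_def)

lemma stays_psum: "stays m X \<Longrightarrow> 0 \<le> psum X m"
  by (auto simp: stays_def)

lemma pred_stays [measurable]: "Measurable.pred path_space (stays m)"
  unfolding stays_def by measurable

lemma path_setI: "Measurable.pred path_space P \<Longrightarrow> {X. P X} \<in> sets path_space"
  by (simp add: pred_def space_PiM)

lemma stays_set [measurable]: "{X. stays m X} \<in> sets path_space"
  by (rule path_setI) measurable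

lemma stays_comb_seq:
  "stays (k + m) (comb_seq k X Y) \<longleftrightarrow> stays k X \<and> (\<forall>i\<le>m. 0 \<le> psum X k + psum Y i)"
proof -
  have "stays (k + m) Z \<longleftrightarrow> (\<forall>i\<le>k. 0 \<le> psum Z i) \<and> (\<forall>i\<le>m. 0 \<le> psum Z (k + i))" for Z
    unfolding stays_def by (metis add_leD1 le_add_diff_inverse nat_add_left_cancel_le nat_le_linear trans_le_add1)
  then show ?thesis by (simp add: psum_comb_seq_le psum_comb_seq_add stays_def)
qed

text \<open>
  Time reversal of the first \<open>k\<close> steps. For i.i.d. steps it preserves the law; it exchanges
  staying nonnegative with setting a new maximum, and a final minimum with a first return
  above zero.
\<close>

definition rev_steps :: "nat \<Rightarrow> (nat \<Rightarrow> real) \<Rightarrow> nat \<Rightarrow> real" where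
  "rev_steps k X = (\<lambda>i. X (if i < k then k - 1 - i else i))"

lemma psum_rev_steps: "j \<le> k \<Longrightarrow> psum (rev_steps k X) j = psum X k - psum X (k - j)"
proof (induction j)
  case (Suc j)
  then have "psum X (k - j) = psum X (k - Suc j) + X (k - Suc j)"
    by (metis Suc_diff_Suc Suc_le_lessD psum_Suc)
  with Suc show ?case by (simp add: psum_Suc rev_steps_def)
qed simp

lemma psum_cong: "(\<And>i. i < m \<Longrightarrow> X i = Y i) \<Longrightarrow> n \<le> m \<Longrightarrow> psum X n = psum Y n"
  unfolding psum_def by (intro sum.cong) auto

lemma stays_cong: "(\<And>i. i < m \<Longrightarrow> X i = Y i) \<Longrightarrow> stays m X = stays m Y"
  unfolding stays_def using psum_cong[of m X Y] by auto

lemma killed_weight_cong: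
  assumes "\<And>i. i < m \<Longrightarrow> X i = Y i"
  shows "indicator {X. stays m X} X * g (psum X m) = (indicator {X. stays m X} Y * g (psum Y m) :: ennreal)"
  using psum_cong[of m X Y m, OF assms] stays_cong[of m X Y, OF assms] by (simp add: indicator_def)

lemma rev_steps_measurable [measurable]: "rev_steps k \<in> path_space \<rightarrow>\<^sub>M path_space"
  unfolding rev_steps_def by (rule measurable_PiM_single') (auto simp: space_PiM)

section \<open>The i.i.d. walk\<close>

text \<open>
  The hypotheses are what the assumptions on the branching mechanism give for the annealed step law.
\<close>

locale centred_walk =
  fixes \<rho> :: "real measure"
  assumes centred: "centred \<rho>"
    and second_moment: "(\<integral>\<^sup>+x. ennreal (x\<^sup>2) \<partial>\<rho>) < \<infinity>"
    and positive_steps: "0 < emeasure \<rho> {0<..}"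
begin

sublocale step: prob_space \<rho> using centredD centred by auto

abbreviation steps :: "(nat \<Rightarrow> real) measure" where "steps \<equiv> PiM UNIV (\<lambda>_. \<rho>)"
abbreviation hn :: "nat \<Rightarrow> real \<Rightarrow> ennreal" where "hn \<equiv> killed_mean (\<lambda>_. \<rho>)"
abbreviation h :: "real \<Rightarrow> ennreal" where "h \<equiv> harmonic (\<lambda>_. \<rho>)"

sublocale walk: prob_space steps by (intro prob_space_PiM step.prob_space_axioms)

lemma sets_\<rho> [measurable_cong, simp]: "sets \<rho> = sets borel" and space_\<rho> [simp]: "space \<rho> = UNIV"
  using centredD[OF centred] by auto

lemma sets_steps [measurable_cong, simp]: "sets steps = sets path_space"
  by (intro sets_PiM_cong) auto

lemma space_steps [simp]: "space steps = UNIV" by (simp add: space_PiM)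

lemma measurable_hn [measurable]: "hn n \<in> borel_measurable borel"
  and measurable_h [measurable]: "h \<in> borel_measurable borel"
  using centredD[OF centred] by (auto intro!: measurable_killed_mean measurable_harmonic)

lemma nn_integral_split:
  assumes [measurable]: "F \<in> borel_measurable path_space"
  shows "(\<integral>\<^sup>+X. F X \<partial>steps) = (\<integral>\<^sup>+X. \<integral>\<^sup>+Y. F (comb_seq k X Y) \<partial>steps \<partial>steps)"
  by (rule nn_integral_PiM_split[OF step.prob_space_axioms]) measurable

lemma nn_integral_component:
  assumes [measurable]: "g \<in> borel_measurable borel"
  shows "(\<integral>\<^sup>+X. g (X i) \<partial>steps) = (\<integral>\<^sup>+x. g x \<partial>\<rho>)"
proof -
  have "distr steps \<rho> (\<lambda>X. X i) = \<rho>"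
    by (rule distr_PiM_component) (auto simp: step.prob_space_axioms)
  then have "(\<integral>\<^sup>+x. g x \<partial>\<rho>) = (\<integral>\<^sup>+x. g x \<partial>distr steps \<rho> (\<lambda>X. X i))" by simp
  also have "\<dots> = (\<integral>\<^sup>+X. g (X i) \<partial>steps)" by (rule nn_integral_distr[OF measurable_component_singleton]) auto
  finally show ?thesis ..
qed

text \<open>
  The step at time \<open>m\<close> is independent of the earlier ones, so it can be integrated out on its own.
  This is used where first-step recursions are awkward, namely for functionals of the path up to
  time \<open>m\<close>.
\<close>

lemma nn_integral_last_step:
  assumes G [measurable]: "(\<lambda>(X, x). G X x) \<in> borel_measurable (path_space \<Otimes>\<^sub>M borel)"
    and dep: "\<And>X Y x. (\<And>i. i < m \<Longrightarrow> X i = Y i) \<Longrightarrow> G X x = G Y x"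
  shows "(\<integral>\<^sup>+X. G X (X m) \<partial>steps) = (\<integral>\<^sup>+X. \<integral>\<^sup>+x. G X x \<partial>\<rho> \<partial>steps)"
proof -
  have sec: "G X \<in> borel_measurable borel" for X
    using measurable_compose[OF measurable_Pair1' G, of X] by (simp add: space_PiM)
  have "(\<integral>\<^sup>+X. G X (X m) \<partial>steps) =
      (\<integral>\<^sup>+X. \<integral>\<^sup>+Y. G (comb_seq m X Y) (comb_seq m X Y m) \<partial>steps \<partial>steps)"
    by (rule nn_integral_split) measurable
  also have "\<dots> = (\<integral>\<^sup>+X. \<integral>\<^sup>+Y. G X (Y 0) \<partial>steps \<partial>steps)"
    by (intro nn_integral_cong, subst dep[of "comb_seq m X Y" X for X Y]) (auto simp: comb_seq_def)
  also have "\<dots> = (\<integral>\<^sup>+X. \<integral>\<^sup>+x. G X x \<partial>\<rho> \<partial>steps)"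
    by (intro nn_integral_cong nn_integral_component sec)
  finally show ?thesis .
qed

lemma nn_integral_reverse:
  assumes [measurable]: "F \<in> borel_measurable path_space"
  shows "(\<integral>\<^sup>+X. F (rev_steps k X) \<partial>steps) = (\<integral>\<^sup>+X. F X \<partial>steps)"
proof -
  have "distr steps steps (rev_steps k) = steps"
  proof -
    have "inj (\<lambda>i. if i < k then k - 1 - i else i)" by (auto simp: inj_def split: if_splits)
    from distr_PiM_reindex[OF _ this, of UNIV "\<lambda>_. \<rho>"] show ?thesis
      by (simp add: step.prob_space_axioms rev_steps_def[abs_def] restrict_UNIV)
  qed
  then have "(\<integral>\<^sup>+X. F X \<partial>steps) = (\<integral>\<^sup>+X. F X \<partial>distr steps steps (rev_steps k))" by simp
  then show ?thesis by (subst (asm) nn_integral_distr) auto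
qed

lemma hn_walk: "hn n 0 = (\<integral>\<^sup>+X. indicator {X. stays n X} X * ennreal (psum X n) \<partial>steps)"
proof -
  have "(\<Prod>i\<in>{1..n}. indicator {0..} (psum X i)) = (indicator {X. stays n X} X :: ennreal)" for X
    by (induction n) (auto simp: stays_Suc psum_Suc, auto simp: stays_def split: split_indicator)
  then show ?thesis
    using centredD[OF centred] by (subst killed_mean_eq_walk) auto
qed

lemma hn_step:
  "hn (Suc n) y = (\<integral>\<^sup>+x. indicator {0..} (y + x) * hn n (y + x) \<partial>\<rho>)"
  by simp

lemma h_step: "0 \<le> y \<Longrightarrow> h y = (\<integral>\<^sup>+x. indicator {0..} (y + x) * h (y + x) \<partial>\<rho>)"
  using centred by (intro harmonic_step)

text \<open>
  \<open>h (S\<^sub>m)\<close> on the event of survival is a martingale, because \<open>h\<close> is harmonic for the killed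
  walk.
\<close>

lemma nn_integral_h_walk: "(\<integral>\<^sup>+X. indicator {X. stays m X} X * h (psum X m) \<partial>steps) = h 0"
proof (induction m)
  case 0
  show ?case by (simp add: stays_def walk.emeasure_space_1[simplified])
next
  case (Suc m)
  have "(\<integral>\<^sup>+X. indicator {X. stays (Suc m) X} X * h (psum X (Suc m)) \<partial>steps) =
     (\<integral>\<^sup>+X. indicator {X. stays m X} X * (indicator {0..} (psum X m + X m) * h (psum X m + X m)) \<partial>steps)"
    by (intro nn_integral_cong) (auto simp: stays_Suc psum_Suc split: split_indicator)
  also have "\<dots> = (\<integral>\<^sup>+X. \<integral>\<^sup>+x. indicator {X. stays m X} X * (indicator {0..} (psum X m + x) * h (psum X m + x)) \<partial>\<rho> \<partial>steps)"
    by (rule nn_integral_last_step, measurable) (rule killed_weight_cong, assumption)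
  also have "\<dots> = (\<integral>\<^sup>+X. indicator {X. stays m X} X * h (psum X m) \<partial>steps)"
    by (intro nn_integral_cong, subst nn_integral_cmult, measurable)
      (auto split: split_indicator simp: stays_psum h_step[symmetric])
  finally show ?case using Suc by simp
qed

lemma exists_jump: "\<exists>c>0. 0 < emeasure \<rho> {c..}"
proof (rule ccontr)
  assume "\<not> ?thesis"
  then have "emeasure \<rho> {inverse (real (Suc n))..} = 0" for n
    by (metis inverse_positive_iff_positive not_gr_zero of_nat_0_less_iff zero_less_Suc)
  then have "emeasure \<rho> (\<Union>n. {inverse (real (Suc n))..}) = 0"
    by (intro emeasure_UN_eq_0) auto
  moreover have "{0<..} \<subseteq> (\<Union>n. {inverse (real (Suc n))..})"
    using reals_Archimedean less_imp_le by fastforce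
  ultimately show False
    using positive_steps emeasure_mono[of "{0<..}" "\<Union>n. {inverse (real (Suc n))..}" \<rho>] by auto
qed

section \<open>Finiteness of the harmonic function\<close>

text \<open>
  The expected number of visits to a cell of length \<open>c\<close> by the walk killed below zero is bounded
  uniformly in the position of the cell. Reversing time turns a visit at time \<open>j\<close> into a weak new maximum
  at time \<open>j\<close> inside the cell. Such a maximum followed by a jump of at least \<open>c\<close> leaves the cell for
  good, hence is the last one there; these events are disjoint for different \<open>j\<close>, and the jump has
  the same probability each time.
\<close>

lemma occupation_bound:
  assumes "0 < c"
  shows "(\<Sum>j. emeasure steps {X. stays j X \<and> a \<le> psum X j \<and> psum X j < a + c}) * emeasure \<rho> {c..} \<le> 1"
proof -
  define new_max where "new_max j X \<longleftrightarrow> (\<forall>i\<le>j. psum X i \<le> psum X j) \<and> a \<le> psum X j \<and> psum X j < a + c" for j X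
  have [measurable]: "Measurable.pred path_space (new_max j)" for j
    unfolding new_max_def by measurable
  let ?B = "\<lambda>j. {X. new_max j X}"
  let ?C = "\<lambda>j. {X. new_max j X \<and> c \<le> X j}"
  have "Measurable.pred path_space (\<lambda>X. new_max j X \<and> c \<le> X j)"
    "Measurable.pred path_space (\<lambda>X. stays j X \<and> a \<le> psum X j \<and> psum X j < a + c)" for j
    by measurable
  then have B [measurable]: "?B j \<in> sets path_space" and C [measurable]: "?C j \<in> sets path_space"
    and A: "{X. stays j X \<and> a \<le> psum X j \<and> psum X j < a + c} \<in> sets path_space" for j
    by (auto intro!: path_setI)
  have 1: "emeasure steps {X. stays j X \<and> a \<le> psum X j \<and> psum X j < a + c} = emeasure steps (?B j)" for j
  proof -
    have "rev_steps j X \<in> ?B j \<longleftrightarrow> stays j X \<and> a \<le> psum X j \<and> psum X j < a + c" for X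
    proof -
      have "(\<forall>i\<le>j. psum (rev_steps j X) i \<le> psum (rev_steps j X) j) \<longleftrightarrow> (\<forall>i\<le>j. 0 \<le> psum X (j - i))"
        by (simp add: psum_rev_steps)
      also have "\<dots> \<longleftrightarrow> stays j X"
        unfolding stays_def by (metis diff_diff_cancel diff_le_self)
      finally show ?thesis by (simp add: new_max_def psum_rev_steps)
    qed
    then have "indicator {X. stays j X \<and> a \<le> psum X j \<and> psum X j < a + c} X = (indicator (?B j) (rev_steps j X) :: ennreal)" for X
      by (simp add: indicator_def)
    then show ?thesis
      using A by (simp add: nn_integral_indicator[symmetric] nn_integral_reverse[of "indicator (?B j)"] del: nn_integral_indicator)
  qed
  have 2: "emeasure steps (?B j) * emeasure \<rho> {c..} = emeasure steps (?C j)" for j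
  proof -
    have "emeasure steps (?C j) = (\<integral>\<^sup>+X. indicator (?C j) X \<partial>steps)" using C by simp
    also have "\<dots> = (\<integral>\<^sup>+X. indicator (?B j) X * indicator {c..} (X j) \<partial>steps)"
      by (intro nn_integral_cong) (auto split: split_indicator)
    also have "\<dots> = (\<integral>\<^sup>+X. \<integral>\<^sup>+x. indicator (?B j) X * indicator {c..} x \<partial>\<rho> \<partial>steps)"
    proof (rule nn_integral_last_step)
      fix X Y :: "nat \<Rightarrow> real" and x assume "\<And>i. i < j \<Longrightarrow> X i = Y i"
      from psum_cong[of j X Y, OF this]
      show "indicator (?B j) X * indicator {c..} x = (indicator (?B j) Y * indicator {c..} x :: ennreal)"
        by (auto simp: new_max_def split: split_indicator)
    qed measurable
    also have "\<dots> = emeasure steps (?B j) * emeasure \<rho> {c..}"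
      by (simp add: nn_integral_cmult nn_integral_multc)
    finally show ?thesis ..
  qed
  have "disjoint_family ?C"
  proof -
    have "False" if "X \<in> ?C i" "X \<in> ?C j" "i < j" for X i j
    proof -
      have "psum X (Suc i) \<le> psum X j" using that by (auto simp: new_max_def)
      then have "psum X i + X i \<le> psum X j" by (simp add: psum_Suc)
      then show False using that by (auto simp: new_max_def)
    qed
    then have "?C i \<inter> ?C j = {}" if "i \<noteq> j" for i j
      using that by (cases i j rule: linorder_cases) blast+
    then show ?thesis unfolding disjoint_family_on_def by blast
  qed
  then have "(\<Sum>j. emeasure steps (?C j)) = emeasure steps (\<Union>j. ?C j)"
    by (intro suminf_emeasure) (auto simp: C)
  also have "\<dots> \<le> 1" by (rule walk.emeasure_le_1)
  finally show ?thesis by (simp add: 1 2[symmetric])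
qed

definition undershoot :: "real \<Rightarrow> ennreal" where
  "undershoot s = (\<integral>\<^sup>+x. ennreal (- (s + x)) \<partial>\<rho>)"

lemma measurable_undershoot [measurable]: "undershoot \<in> borel_measurable borel"
  unfolding undershoot_def by measurable

text \<open>
  By optional stopping \<open>E (S\<^sub>n; survival)\<close> equals the expected undershoot at the killing time if
  that is at most \<open>n\<close>, here collected according to the last surviving position.
\<close>

lemma hn_increment:
  "hn n 0 = (\<Sum>j<n. \<integral>\<^sup>+X. indicator {X. stays j X} X * undershoot (psum X j) \<partial>steps)"
proof (induction n)
  case (Suc n)
  have "hn (Suc n) 0 = (\<integral>\<^sup>+X. indicator {X. stays n X} X * ennreal (psum X n + X n) \<partial>steps)"
    unfolding hn_walk by (intro nn_integral_cong) (auto simp: stays_Suc psum_Suc ennreal_neg split: split_indicator)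
  also have "\<dots> = (\<integral>\<^sup>+X. \<integral>\<^sup>+x. indicator {X. stays n X} X * ennreal (psum X n + x) \<partial>\<rho> \<partial>steps)"
    by (rule nn_integral_last_step, measurable) (rule killed_weight_cong, assumption)
  also have "\<dots> = (\<integral>\<^sup>+X. indicator {X. stays n X} X * ennreal (psum X n) +
      indicator {X. stays n X} X * undershoot (psum X n) \<partial>steps)"
    by (intro nn_integral_cong, subst nn_integral_cmult, measurable)
      (auto simp: undershoot_def stays_psum nn_integral_pos_part_shift[OF centred] split: split_indicator)
  also have "\<dots> = hn n 0 + (\<integral>\<^sup>+X. indicator {X. stays n X} X * undershoot (psum X n) \<partial>steps)"
    unfolding hn_walk by (rule nn_integral_add) measurable
  finally show ?case using Suc by simp
qed simp

lemma undershoot_antimono: "s \<le> t \<Longrightarrow> undershoot t \<le> undershoot s"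
  unfolding undershoot_def by (intro nn_integral_mono ennreal_leI) auto

text \<open>
  Summing \<open>(w - k c)\<^sup>+\<close> over \<open>k\<close> gives a quantity of order \<open>w\<^sup>2 / c + w\<close>. This is the place where
  the second moment is needed.
\<close>

lemma suminf_undershoot:
  assumes "0 < c"
  shows "(\<Sum>k. undershoot (real k * c)) < \<infinity>"
proof -
  have pt: "(\<Sum>k. ennreal (- (real k * c + x))) \<le> ennreal (1 / c) * ennreal (x\<^sup>2) + ennreal (- x)" for x
  proof (cases "x < 0")
    case True
    \<comment> \<open>the terms with \<open>k c \<ge> - x\<close> vanish\<close>
    define N where "N = nat \<lceil>- x / c\<rceil>"
    have zero: "ennreal (- (real k * c + x)) = 0" if "k \<notin> {..<N}" for k
    proof -
      have "- x / c \<le> real k" using that unfolding N_def by (simp add: not_less)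
      then have "- x \<le> real k * c" using assms by (simp add: field_simps)
      then show ?thesis by (simp add: ennreal_neg)
    qed
    have "(\<Sum>k. ennreal (- (real k * c + x))) = (\<Sum>k<N. ennreal (- (real k * c + x)))"
      using zero by (intro suminf_finite) auto
    also have "\<dots> \<le> (\<Sum>k<N. ennreal (- x))"
      using assms by (intro sum_mono ennreal_leI) auto
    also have "\<dots> = ennreal (real N * - x)"
      using True by (simp add: ennreal_mult'[symmetric] ennreal_of_nat_eq_real_of_nat)
    also have "\<dots> \<le> ennreal (1 / c * x\<^sup>2 + - x)"
    proof (rule ennreal_leI)
      have "0 \<le> - x / c" using True assms by (simp add: field_simps)
      then have "real N \<le> - x / c + 1" unfolding N_def by linarith
      then have "real N * - x \<le> (- x / c + 1) * - x" using True by (intro mult_right_mono) auto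
      also have "\<dots> = 1 / c * x\<^sup>2 + - x" by (simp add: field_simps power2_eq_square)
      finally show "real N * - x \<le> 1 / c * x\<^sup>2 + - x" .
    qed
    also have "\<dots> = ennreal (1 / c) * ennreal (x\<^sup>2) + ennreal (- x)"
      using True assms by (subst ennreal_plus) (auto simp: ennreal_mult'[symmetric])
    finally show ?thesis .
  next
    case False
    then have "0 \<le> real k * c + x" for k using assms by (intro add_nonneg_nonneg) auto
    then have "ennreal (- (real k * c + x)) = 0" for k
      by (intro ennreal_neg) (simp only: neg_le_0_iff_le)
    then show ?thesis by simp
  qed
  have "(\<Sum>k. undershoot (real k * c)) = (\<integral>\<^sup>+x. (\<Sum>k. ennreal (- (real k * c + x))) \<partial>\<rho>)"
    unfolding undershoot_def by (rule nn_integral_suminf[symmetric]) measurable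
  also have "\<dots> \<le> (\<integral>\<^sup>+x. ennreal (1 / c) * ennreal (x\<^sup>2) + ennreal (- x) \<partial>\<rho>)"
    by (intro nn_integral_mono pt)
  also have "\<dots> = ennreal (1 / c) * (\<integral>\<^sup>+x. ennreal (x\<^sup>2) \<partial>\<rho>) + (\<integral>\<^sup>+x. ennreal (- x) \<partial>\<rho>)"
    by (subst nn_integral_add, measurable, subst nn_integral_cmult, auto)
  also have "\<dots> < \<infinity>"
    using second_moment centred by (auto simp: centred_def ennreal_mult_less_top)
  finally show ?thesis .
qed

text \<open>
  Cut the half-line into cells of length \<open>c\<close>. On the \<open>k\<close>-th cell the undershoot is at most its
  value at the left end point, and the expected number of visits is bounded by a constant, so the sum
  over cells converges.
\<close>

lemma h_0_finite: "h 0 < \<infinity>"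
proof -
  obtain c where c: "0 < c" "0 < emeasure \<rho> {c..}" using exists_jump by auto
  define \<epsilon> where "\<epsilon> = emeasure \<rho> {c..}"
  define I where "I k = {real k * c..<real k * c + c}" for k
  define V where "V j k = emeasure steps {X. stays j X \<and> psum X j \<in> I k}" for j k
  have "Measurable.pred path_space (\<lambda>X. stays j X \<and> psum X j \<in> I k)" for j k
    unfolding I_def atLeastLessThan_iff by measurable
  then have A [measurable]: "{X. stays j X \<and> psum X j \<in> I k} \<in> sets path_space" for j k
    by (rule path_setI)
  have cell: "\<exists>k. s \<in> I k" if "0 \<le> s" for s
  proof
    have "real (nat \<lfloor>s / c\<rfloor>) = of_int \<lfloor>s / c\<rfloor>" using that c by simp
    moreover have "of_int \<lfloor>s / c\<rfloor> * c \<le> s" "s < of_int \<lfloor>s / c\<rfloor> * c + c"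
      using c floor_correct[of "s / c"] by (simp_all add: pos_le_divide_eq[symmetric] pos_divide_less_eq[symmetric] add_divide_distrib distrib_right[symmetric, of _ c 1, simplified])
    ultimately show "s \<in> I (nat \<lfloor>s / c\<rfloor>)" by (simp add: I_def)
  qed
  have pt: "indicator {X. stays j X} X * undershoot (psum X j) \<le>
      (\<Sum>k. undershoot (real k * c) * indicator {X. stays j X \<and> psum X j \<in> I k} X)" for j X
  proof (cases "stays j X")
    case True
    then obtain k where k: "psum X j \<in> I k" using cell stays_psum by blast
    then have "undershoot (psum X j) \<le> undershoot (real k * c)"
      by (intro undershoot_antimono) (auto simp: I_def)
    also have "\<dots> = (\<Sum>k\<in>{k}. undershoot (real k * c) * indicator {X. stays j X \<and> psum X j \<in> I k} X)"
      using True k by simp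
    also have "\<dots> \<le> (\<Sum>k. undershoot (real k * c) * indicator {X. stays j X \<and> psum X j \<in> I k} X)"
      by (intro sum_le_suminf) auto
    finally show ?thesis using True by simp
  qed simp
  have occ: "(\<Sum>j<n. V j k * \<epsilon>) \<le> 1" for n k
  proof -
    have "(\<Sum>j<n. V j k * \<epsilon>) \<le> (\<Sum>j. V j k * \<epsilon>)" by (intro sum_le_suminf) auto
    also have "\<dots> \<le> 1"
      using occupation_bound[OF c(1), of "real k * c"] by (simp add: V_def \<epsilon>_def I_def)
    finally show ?thesis .
  qed
  have "hn n 0 * \<epsilon> \<le> (\<Sum>k. undershoot (real k * c))" for n
  proof -
    have "hn n 0 \<le> (\<Sum>j<n. \<integral>\<^sup>+X. (\<Sum>k. undershoot (real k * c) * indicator {X. stays j X \<and> psum X j \<in> I k} X) \<partial>steps)"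
      unfolding hn_increment by (intro sum_mono nn_integral_mono pt)
    also have "\<dots> = (\<Sum>j<n. \<Sum>k. undershoot (real k * c) * V j k)"
      by (subst nn_integral_suminf, measurable) (simp add: nn_integral_cmult V_def)
    finally have "hn n 0 * \<epsilon> \<le> (\<Sum>j<n. \<Sum>k. undershoot (real k * c) * V j k) * \<epsilon>"
      by (rule mult_right_mono) simp
    also have "\<dots> = (\<Sum>k. \<Sum>j<n. undershoot (real k * c) * (V j k * \<epsilon>))"
      unfolding sum_distrib_right ennreal_suminf_multc[symmetric] mult.assoc
      by (rule suminf_sum[symmetric]) auto
    also have "\<dots> \<le> (\<Sum>k. undershoot (real k * c) * 1)"
      unfolding sum_distrib_left[symmetric] by (intro suminf_le mult_left_mono occ) auto
    finally show ?thesis by simp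
  qed
  then have "h 0 * \<epsilon> \<le> (\<Sum>k. undershoot (real k * c))"
    unfolding harmonic_def SUP_mult_right_ennreal by (intro SUP_least)
  also have "\<dots> < \<infinity>" by (rule suminf_undershoot) (rule c)
  finally show ?thesis using c(2) by (auto simp: \<epsilon>_def ennreal_mult_less_top)
qed

text \<open>
  From \<open>y\<close> the walk jumps to at least \<open>y + c\<close> with a fixed positive probability, so \<open>h\<close> grows by
  at most a constant factor over distance \<open>c\<close>; finiteness spreads from \<open>0\<close>.
\<close>

lemma h_finite: "h y < \<infinity>"
proof -
  obtain c where c: "0 < c" "0 < emeasure \<rho> {c..}" using exists_jump by auto
  have step: "h (y + c) * emeasure \<rho> {c..} \<le> h y" if "0 \<le> y" for y
  proof -
    have "h (y + c) * emeasure \<rho> {c..} = (\<integral>\<^sup>+x. h (y + c) * indicator {c..} x \<partial>\<rho>)"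
      by (simp add: nn_integral_cmult)
    also have "\<dots> \<le> (\<integral>\<^sup>+x. indicator {0..} (y + x) * h (y + x) \<partial>\<rho>)"
      using that c by (intro nn_integral_mono) (auto split: split_indicator intro: harmonic_mono)
    finally show ?thesis using that by (simp add: h_step[symmetric])
  qed
  have "h (real k * c) < \<infinity>" for k
  proof (induction k)
    case 0 show ?case using h_0_finite by simp
  next
    case (Suc k)
    have "h (real k * c + c) * emeasure \<rho> {c..} < \<infinity>"
      using step[of "real k * c"] Suc c by (auto intro: le_less_trans)
    then show ?case using c(2) by (auto simp: ennreal_mult_less_top algebra_simps)
  qed
  moreover obtain k where "y \<le> real k * c"
    using reals_Archimedean3[OF c(1)] less_imp_le by blast
  ultimately show ?thesis by (metis harmonic_mono le_less_trans)
qed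

text \<open>
  Started from \<open>x + s\<close>, watch the walk until it first goes below level \<open>x\<close>. Before that it is a
  walk from \<open>s\<close> raised by \<open>x\<close>; afterwards it starts from at most \<open>x\<close>.
\<close>

lemma hn_subadditive:
  assumes "0 \<le> x" "0 \<le> s"
  shows "hn n (x + s) \<le> ennreal x + hn n s + hn n x"
  using assms(2)
proof (induction n arbitrary: s)
  case 0 then show ?case using assms by (auto simp: ennreal_plus[symmetric] intro!: ennreal_leI simp del: ennreal_plus)
next
  case (Suc n)
  have pt: "indicator {0..} (x + s + y) * hn n (x + s + y) \<le>
      ennreal x + indicator {0..} (s + y) * hn n (s + y) + hn n x" for y
  proof (cases "0 \<le> s + y")
    case True
    then show ?thesis using Suc.IH[of "s + y"] assms by (auto simp: add.assoc split: split_indicator)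
  next
    case False
    then have "hn n (x + s + y) \<le> hn n x" by (intro killed_mean_mono) auto
    then show ?thesis by (auto split: split_indicator intro: add_increasing)
  qed
  have "hn (Suc n) (x + s) \<le> (\<integral>\<^sup>+y. ennreal x + indicator {0..} (s + y) * hn n (s + y) + hn n x \<partial>\<rho>)"
    unfolding hn_step by (intro nn_integral_mono pt)
  also have "\<dots> = ennreal x + hn (Suc n) s + hn n x"
    by (simp add: nn_integral_add step.emeasure_space_1[simplified])
  also have "\<dots> \<le> ennreal x + hn (Suc n) s + hn (Suc n) x"
    using assms centred by (intro add_mono killed_mean_incseq) auto
  finally show ?case .
qed

lemma h_subadditive:
  assumes "0 \<le> x" "0 \<le> s"
  shows "h (x + s) \<le> ennreal x + h s + h x"
  unfolding harmonic_def[of _ "x + s"]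
proof (rule SUP_least)
  fix n
  have "hn n (x + s) \<le> ennreal x + hn n s + hn n x" by (rule hn_subadditive) fact+
  also have "\<dots> \<le> ennreal x + h s + h x"
    unfolding harmonic_def by (intro add_mono SUP_upper) auto
  finally show "hn n (x + s) \<le> ennreal x + h s + h x" .
qed

section \<open>Decay of the survival probability\<close>

lemma nn_integral_past_future:
  assumes [measurable]: "F \<in> borel_measurable path_space" "G \<in> borel_measurable path_space"
    and dep: "\<And>X Y. (\<And>i. i < n \<Longrightarrow> X i = Y i) \<Longrightarrow> F X = F Y"
  shows "(\<integral>\<^sup>+X. F X * G (\<lambda>i. X (n + i)) \<partial>steps) = (\<integral>\<^sup>+X. F X \<partial>steps) * (\<integral>\<^sup>+X. G X \<partial>steps)"
proof -
  have [measurable]: "(\<lambda>X i. X (n + i)) \<in> path_space \<rightarrow>\<^sub>M path_space"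
    by (rule measurable_PiM_single') (auto simp: space_PiM)
  have "F (comb_seq n X Y) = F X" for X Y by (rule dep) (simp add: comb_seq_def)
  moreover have "(\<lambda>i. comb_seq n X Y (n + i)) = Y" for X Y :: "nat \<Rightarrow> real"
    by (simp add: comb_seq_def)
  ultimately show ?thesis
    by (subst nn_integral_split[of _ n]) (auto simp: nn_integral_cmult nn_integral_multc)
qed

lemma negative_steps: "0 < emeasure \<rho> {..<0}"
proof (rule ccontr)
  assume "\<not> ?thesis"
  then have "AE x in \<rho>. x \<notin> {..<0}" by (intro AE_not_in) auto
  then have "(\<integral>\<^sup>+x. ennreal (- x) \<partial>\<rho>) = 0"
    by (subst nn_integral_0_iff_AE) (auto simp: ennreal_neg)
  then have "(\<integral>\<^sup>+x. ennreal x \<partial>\<rho>) = 0" using centred by (simp add: centred_def)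
  then have "AE x in \<rho>. ennreal x = 0" by (subst (asm) nn_integral_0_iff_AE) auto
  then have "AE x in \<rho>. x \<notin> {0<..}"
    by eventually_elim (auto simp: ennreal_eq_0_iff)
  then have "emeasure \<rho> {0<..} = 0" by (subst (asm) AE_iff_null) (auto simp: greaterThan_def)
  then show False using positive_steps by simp
qed

lemma centred_walk_reflected: "centred_walk (distr \<rho> borel uminus)"
proof
  interpret R: prob_space "distr \<rho> borel uminus" by (rule step.prob_space_distr) auto
  show "centred (distr \<rho> borel uminus)"
    using centred R.prob_space_axioms by (auto simp: centred_def real_law_def nn_integral_distr)
  show "(\<integral>\<^sup>+x. ennreal (x\<^sup>2) \<partial>distr \<rho> borel uminus) < \<infinity>"
    using second_moment by (simp add: nn_integral_distr)
  have "uminus -` {0<..} = {..<0::real}" by auto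
  then show "0 < emeasure (distr \<rho> borel uminus) {0<..}"
    using negative_steps by (simp add: emeasure_distr)
qed

lemma distr_uminus_steps:
  "distr steps path_space (\<lambda>X i. - X i) = PiM UNIV (\<lambda>_. distr \<rho> borel uminus)"
proof (rule measure_eqI_PiM_infinite)
  interpret R: prob_space "distr \<rho> borel uminus" by (rule step.prob_space_distr) auto
  have neg [measurable]: "(\<lambda>X i. - X i :: real) \<in> path_space \<rightarrow>\<^sub>M path_space"
    by (rule measurable_PiM_single') (auto simp: space_PiM)
  show "sets (distr steps path_space (\<lambda>X i. - X i)) = sets path_space" by simp
  show "sets (PiM UNIV (\<lambda>_. distr \<rho> borel uminus)) = sets path_space"
    by (intro sets_PiM_cong) auto
  show "finite_measure (distr steps path_space (\<lambda>X i. - X i))"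
    by (intro prob_space.finite_measure walk.prob_space_distr) measurable
  fix A and J :: "nat set" assume J: "finite J" "\<And>i. i \<in> J \<Longrightarrow> A i \<in> sets (borel :: real measure)"
  have [measurable]: "prod_emb UNIV (\<lambda>_. borel) J (Pi\<^sub>E J A) \<in> sets path_space"
    using J by (intro sets_PiM_I) auto
  have pre: "uminus -` A i \<in> sets \<rho>" if "i \<in> J" for i
    using measurable_sets[of uminus borel borel "A i"] J that by simp
  have e1: "(\<lambda>X i. - X i) -` prod_emb UNIV (\<lambda>_. borel) J (Pi\<^sub>E J A) =
      prod_emb UNIV (\<lambda>_. \<rho>) J (\<Pi>\<^sub>E i\<in>J. uminus -` A i)"
    by (auto simp: prod_emb_def PiE_iff restrict_def space_PiM extensional_def)
  have e2: "prod_emb UNIV (\<lambda>_. borel) J (Pi\<^sub>E J A) = prod_emb UNIV (\<lambda>_. distr \<rho> borel uminus) J (Pi\<^sub>E J A)"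
    by (simp add: prod_emb_def)
  have "emeasure (distr steps path_space (\<lambda>X i. - X i)) (prod_emb UNIV (\<lambda>_. borel) J (Pi\<^sub>E J A)) =
      (\<Prod>i\<in>J. emeasure \<rho> (uminus -` A i))"
    using J pre by (simp add: emeasure_distr e1 emeasure_PiM_emb step.prob_space_axioms)
  also have "\<dots> = (\<Prod>i\<in>J. emeasure (distr \<rho> borel uminus) (A i))"
    using J by (intro prod.cong) (auto simp: emeasure_distr)
  also have "\<dots> = emeasure (PiM UNIV (\<lambda>_. distr \<rho> borel uminus)) (prod_emb UNIV (\<lambda>_. borel) J (Pi\<^sub>E J A))"
    unfolding e2 using J by (subst emeasure_PiM_emb) (auto simp: R.prob_space_axioms)
  finally show "emeasure (distr steps path_space (\<lambda>X i. - X i)) (prod_emb UNIV (\<lambda>_. borel) J (Pi\<^sub>E J A)) =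
      emeasure (PiM UNIV (\<lambda>_. distr \<rho> borel uminus)) (prod_emb UNIV (\<lambda>_. borel) J (Pi\<^sub>E J A))" .
qed

text \<open>
  Let \<open>p n\<close> be the survival probability and \<open>l\<close> its limit. Within \<open>N\<close> steps, a walk that is at height
  at most \<open>K\<close> is killed with a probability of at least some \<open>b > 0\<close>, while
  \<open>K P(survival, S\<^sub>n > K) \<le> E (S\<^sub>n; survival) \<le> h 0\<close>. Hence
  \<open>p (n + N) \<le> p n - b (p n - h 0 / K)\<close>, which forces \<open>l \<le> h 0 / K\<close> for every \<open>K\<close>.
\<close>

lemma stays_decay: "(\<lambda>m. measure steps {X. stays m X}) \<longlonglongrightarrow> 0"
proof -
  define p where "p m = measure steps {X. stays m X}" for m
  interpret R: centred_walk "distr \<rho> borel uminus" by (rule centred_walk_reflected)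
  obtain d where d: "0 < d" "0 < emeasure \<rho> {..- d}"
  proof -
    obtain d where "0 < d" "0 < emeasure (distr \<rho> borel uminus) {d..}" using R.exists_jump by auto
    moreover have "uminus -` {d..} = {..- d}" by auto
    ultimately show ?thesis using that by (simp add: emeasure_distr)
  qed
  define H where "H = enn2real (h 0)"
  have H: "h 0 = ennreal H" "0 \<le> H" using h_0_finite by (auto simp: H_def)
  have "decseq p" unfolding p_def decseq_def
    by (auto intro!: walk.finite_measure_mono dest: stays_antimono)
  then obtain l where l: "p \<longlonglongrightarrow> l" "\<And>m. l \<le> p m"
    using decseq_convergent[of p 0] by (auto simp: p_def)
  have "l \<le> H / K" if K: "0 < K" for K
  proof -
    obtain N where N: "K < real N * d" using reals_Archimedean3[OF d(1)] by blast
    define b where "b = measure steps {X. \<forall>i<N. X i \<le> - d}"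
    define q where "q n = measure steps {X. stays n X \<and> psum X n \<le> K}" for n
    have [measurable]: "Measurable.pred path_space (\<lambda>X. \<forall>i<N. X i \<le> - d)" 
       "Measurable.pred path_space (\<lambda>X. stays n X \<and> psum X n \<le> K)"
       "Measurable.pred path_space (\<lambda>X. stays n X \<and> \<not> psum X n \<le> K)"
       "Measurable.pred path_space (\<lambda>X. stays n X \<and> psum X n \<le> K \<and> (\<forall>i<N. X (n + i) \<le> - d))"
       for n by measurable
    note [measurable] = this[THEN path_setI]
    have b: "0 < b"
    proof -
      interpret product_prob_space "\<lambda>_. \<rho>" "UNIV :: nat set" ..
      have "measure steps {X \<in> space steps. \<forall>i\<in>{..<N}. X i \<in> {..- d}} = (\<Prod>i<N. measure \<rho> {..- d})"
        using emeasure_PiM_Collect[of "{..<N}" "\<lambda>_. {..- d}"]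
        by (simp add: walk.emeasure_eq_measure step.emeasure_eq_measure ennreal_power)
      moreover have "0 < measure \<rho> {..- d}"
        using d by (simp add: measure_def enn2real_positive_iff less_top[symmetric])
      ultimately show ?thesis by (simp add: b_def lessThan_def)
    qed
    have ineq1: "p (n + N) + q n * b \<le> p n" for n
    proof -
      let ?A = "{X. stays n X \<and> psum X n \<le> K \<and> (\<forall>i<N. X (n + i) \<le> - d)}"
      have "emeasure steps ?A = (\<integral>\<^sup>+X. indicator ?A X \<partial>steps)" by simp
      also have "\<dots> = (\<integral>\<^sup>+X. indicator {X. stays n X \<and> psum X n \<le> K} X *
          indicator {X. \<forall>i<N. X i \<le> - d} (\<lambda>i. X (n + i)) \<partial>steps)"
        by (intro nn_integral_cong) (auto split: split_indicator)
      also have "\<dots> = emeasure steps {X. stays n X \<and> psum X n \<le> K} * emeasure steps {X. \<forall>i<N. X i \<le> - d}"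
      proof (subst nn_integral_past_future)
        fix X Y :: "nat \<Rightarrow> real" assume "\<And>i. i < n \<Longrightarrow> X i = Y i"
        from stays_cong[of n X Y, OF this] psum_cong[of n X Y n, OF this]
        show "indicator {X. stays n X \<and> psum X n \<le> K} X = (indicator {X. stays n X \<and> psum X n \<le> K} Y :: ennreal)"
          by (simp add: indicator_def)
      qed auto
      finally have "measure steps ?A = q n * b" by (simp add: measure_def q_def b_def enn2real_mult)
      moreover have "?A \<inter> {X. stays (n + N) X} = {}"
      proof -
        have "False" if X: "X \<in> ?A" "stays (n + N) X" for X
        proof -
          have "i \<le> N \<Longrightarrow> psum X (n + i) \<le> psum X n - real i * d" for i
          proof (induction i)
            case (Suc i)
            then have "X (n + i) \<le> - d" "psum X (n + i) \<le> psum X n - real i * d" using X by auto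
            then show ?case by (simp add: psum_Suc algebra_simps)
          qed simp
          from this[of N] N X stays_psum[of "n + N" X] show False by simp
        qed
        then show ?thesis by blast
      qed
      ultimately have "p (n + N) + q n * b = measure steps ({X. stays (n + N) X} \<union> ?A)"
        unfolding p_def by (subst walk.finite_measure_Union) auto
      also have "\<dots> \<le> p n" unfolding p_def
        by (intro walk.finite_measure_mono) (auto intro: stays_antimono[OF _ le_add1])
      finally show ?thesis .
    qed
    have ineq2: "p n \<le> q n + H / K" for n
    proof -
      have "ennreal K * emeasure steps {X. stays n X \<and> \<not> psum X n \<le> K} =
          (\<integral>\<^sup>+X. ennreal K * indicator {X. stays n X \<and> \<not> psum X n \<le> K} X \<partial>steps)"
        by (simp add: nn_integral_cmult)
      also have "\<dots> \<le> (\<integral>\<^sup>+X. indicator {X. stays n X} X * ennreal (psum X n) \<partial>steps)"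
        by (intro nn_integral_mono) (auto split: split_indicator intro!: ennreal_leI)
      also have "\<dots> \<le> h 0"
        unfolding hn_walk[symmetric] harmonic_def by (intro SUP_upper) auto
      finally have "K * measure steps {X. stays n X \<and> \<not> psum X n \<le> K} \<le> H"
        using K H by (simp add: walk.emeasure_eq_measure ennreal_mult[symmetric])
      then have "measure steps {X. stays n X \<and> \<not> psum X n \<le> K} \<le> H / K"
        using K by (simp add: field_simps)
      moreover have "p n = q n + measure steps {X. stays n X \<and> \<not> psum X n \<le> K}"
        unfolding p_def q_def by (subst walk.finite_measure_Union[symmetric]) (auto intro!: arg_cong2[where f = measure])
      ultimately show ?thesis by simp
    qed
    have "p (n + N) + p n * b \<le> p n + H / K * b" for n
    proof -
      have "p n * b \<le> (q n + H / K) * b" using ineq2[of n] b by (intro mult_right_mono) auto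
      then show ?thesis using ineq1[of n] by (simp add: algebra_simps)
    qed
    then have "l + l * b \<le> l + H / K * b"
      using l(1) LIMSEQ_ignore_initial_segment[OF l(1), of N]
      by (intro LIMSEQ_le[of "\<lambda>n. p (n + N) + p n * b" _ "\<lambda>n. p n + H / K * b"] tendsto_intros) auto
    then have "l * b \<le> (H / K) * b" by simp
    then show ?thesis using b by (rule mult_right_le_imp_le)
  qed
  then have "l \<le> H / K" if "0 < K" for K using that .
  have "l \<le> 0"
  proof (rule ccontr)
    assume "\<not> l \<le> 0"
    \<comment> \<open>choose \<open>K = (H + 1) / l\<close>, for which the bound is smaller than \<open>l\<close>\<close>
    then have "l \<le> H / ((H + 1) / l)" using H by (intro \<open>\<And>K. 0 < K \<Longrightarrow> l \<le> H / K\<close>) auto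
    also have "\<dots> = l * (H / (H + 1))" by simp
    also have "\<dots> < l * 1" using \<open>\<not> l \<le> 0\<close> H by (intro mult_strict_left_mono) auto
    finally show False by simp
  qed
  moreover have "0 \<le> l" using l(1) by (rule LIMSEQ_le_const) (auto simp: p_def)
  ultimately show ?thesis using l(1) by (simp add: p_def[abs_def])
qed

text \<open>
  A walk that is always negative is, after a change of sign, a walk that stays nonnegative, and the
  reflected step law is again centred with a second moment.
\<close>

lemma AE_not_always_negative: "AE X in steps. \<exists>n\<ge>1. 0 \<le> psum X n"
proof -
  interpret R: centred_walk "distr \<rho> borel uminus" by (rule centred_walk_reflected)
  have neg [measurable]: "(\<lambda>X i. - X i :: real) \<in> path_space \<rightarrow>\<^sub>M path_space"
    by (rule measurable_PiM_single') (auto simp: space_PiM)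
  have ps: "psum (\<lambda>i. - X i) n = - psum X n" for X n by (simp add: psum_def sum_negf)
  have "emeasure steps {X. \<forall>n\<ge>1. psum X n < 0} \<le> ennreal (measure R.steps {X. stays m X})" for m
  proof -
    have "emeasure steps {X. \<forall>n\<ge>1. psum X n < 0} \<le> emeasure steps ((\<lambda>X i. - X i) -` {X. stays m X} \<inter> space steps)"
    proof (rule emeasure_mono)
      show "{X. \<forall>n\<ge>1. psum X n < 0} \<subseteq> (\<lambda>X i. - X i) -` {X. stays m X} \<inter> space steps"
      proof
        fix X assume "X \<in> {X. \<forall>n\<ge>1. psum X n < 0}"
        then have "psum X i \<le> 0" for i by (cases i) (auto simp: Suc_le_eq less_imp_le)
        then show "X \<in> (\<lambda>X i. - X i) -` {X. stays m X} \<inter> space steps" by (simp add: stays_def ps)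
      qed
    qed measurable
    also have "\<dots> = emeasure R.steps {X. stays m X}"
      by (subst distr_uminus_steps[symmetric], subst emeasure_distr) auto
    finally show ?thesis by (simp add: R.walk.emeasure_eq_measure)
  qed
  moreover have "(\<lambda>m. ennreal (measure R.steps {X. stays m X})) \<longlonglongrightarrow> 0"
    using tendsto_ennrealI[OF R.stays_decay] by simp
  ultimately have "emeasure steps {X. \<forall>n\<ge>1. psum X n < 0} \<le> 0"
    by (intro LIMSEQ_le_const) auto
  then have null: "emeasure steps {X. \<forall>n\<ge>1. psum X n < 0} = 0" by simp
  have eq: "{X \<in> space steps. \<not> (\<exists>n\<ge>1. 0 \<le> psum X n)} = {X. \<forall>n\<ge>1. psum X n < 0}"
    by (simp only: space_steps UNIV_I simp_thms not_ex de_Morgan_conj not_le imp_conv_disj)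
  have "{X. \<not> (\<exists>n\<ge>1. 0 \<le> psum X n)} \<in> sets path_space"
    by (rule path_setI) measurable
  then have "{X. \<forall>n\<ge>1. psum X n < 0} \<in> sets path_space"
    using eq by simp
  with null show ?thesis
    by (intro AE_I[of _ _ "{X. \<forall>n\<ge>1. psum X n < 0}"]) (simp_all only: eq sets_steps order_refl)
qed

lemma h_0_pos: "0 < h 0"
proof -
  obtain c where c: "0 < c" "0 < emeasure \<rho> {c..}" using exists_jump by auto
  have "0 < ennreal c * emeasure \<rho> {c..}" using c by (simp add: ennreal_zero_less_mult_iff)
  also have "\<dots> = (\<integral>\<^sup>+x. ennreal c * indicator {c..} x \<partial>\<rho>)" by (simp add: nn_integral_cmult)
  also have "\<dots> \<le> (\<integral>\<^sup>+x. indicator {0..} (0 + x) * h (0 + x) \<partial>\<rho>)"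
    using c by (intro nn_integral_mono) (auto split: split_indicator intro: order_trans[OF ennreal_leI harmonic_ge])
  also have "\<dots> = h 0" by (rule h_step[symmetric]) simp
  finally show ?thesis .
qed

end

section \<open>Future minima and ladder epochs\<close>

lemma Inf_enat_eq_iff: "Inf (enat ` S) = enat k \<longleftrightarrow> k \<in> S \<and> (\<forall>j\<in>S. k \<le> j)"
proof
  assume L: "Inf (enat ` S) = enat k"
  then have "S \<noteq> {}" by (auto simp: Inf_enat_def)
  then have "Inf (enat ` S) \<in> enat ` S"
    by (auto simp: Inf_enat_def intro: LeastI)
  then have "k \<in> S" using L by auto
  moreover have "k \<le> j" if "j \<in> S" for j
    using Inf_lower[of "enat j" "enat ` S"] that L by auto
  ultimately show "k \<in> S \<and> (\<forall>j\<in>S. k \<le> j)" by blast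
next
  assume "k \<in> S \<and> (\<forall>j\<in>S. k \<le> j)"
  then show "Inf (enat ` S) = enat k"
    by (intro antisym Inf_lower Inf_greatest) auto
qed

text \<open>
  Let \<open>k\<close> be a time of future minimum. An earlier \<open>j\<close> with \<open>z k < z j\<close> is not one. Conversely, if no
  earlier time is one, each earlier \<open>j\<close> has a later strictly smaller value; following such values
  upwards in time one ends at \<open>k\<close> or beyond, whence \<open>z k < z j\<close>.
\<close>

lemma future_min_time_eq_iff:
  "future_min_time z = enat k \<longleftrightarrow>
     1 \<le> k \<and> (\<forall>n. z k \<le> z (k + n)) \<and> (\<forall>j\<in>{1..<k}. z k < z j)"
proof -
  let ?S = "{m. m \<ge> 1 \<and> (\<forall>n. z (m + n) \<ge> z m)}"
  have "(\<forall>j\<in>?S. k \<le> j) \<longleftrightarrow> (\<forall>j\<in>{1..<k}. z k < z j)" if k: "1 \<le> k" "\<forall>n. z k \<le> z (k + n)"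
  proof
    assume R: "\<forall>j\<in>{1..<k}. z k < z j"
    show "\<forall>j\<in>?S. k \<le> j"
    proof (rule ballI, rule ccontr)
      fix j assume j: "j \<in> ?S" "\<not> k \<le> j"
      then have "z j \<le> z (j + (k - j))" by blast
      moreover have "j \<in> {1..<k}" using j by auto
      moreover have "j + (k - j) = k" using j by auto
      ultimately show False using R by (metis not_le)
    qed
  next
    assume L: "\<forall>j\<in>?S. k \<le> j"
    have "1 \<le> j \<Longrightarrow> j < k \<Longrightarrow> z k < z j" for j
    proof (induction "k - j" arbitrary: j rule: less_induct)
      case less
      have "j \<notin> ?S" using L less.prems by fastforce
      then have "\<not> (\<forall>n. z j \<le> z (j + n))" using less.prems by simp
      then obtain n where n: "z (j + n) < z j" by (auto simp: not_le)
      show ?case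
      proof (cases "k \<le> j + n")
        case True
        then have "z k \<le> z (k + (j + n - k))" using k by blast
        with True n show ?thesis by simp
      next
        case False
        moreover have "0 < n" using n by (cases n) auto
        ultimately have "z k < z (j + n)" using less.prems by (intro less.hyps) auto
        with n show ?thesis by simp
      qed
    qed
    then show "\<forall>j\<in>{1..<k}. z k < z j" by simp
  qed
  then show ?thesis unfolding future_min_time_def Inf_enat_eq_iff by auto
qed

lemma weak_ladder_epoch_eq_iff:
  "weak_ladder_epoch S = enat k \<longleftrightarrow> 1 \<le> k \<and> 0 \<le> S k \<and> (\<forall>j\<in>{1..<k}. S j < 0)"
  unfolding weak_ladder_epoch_def Inf_enat_eq_iff by (auto simp: not_le[symmetric])

lemma finite_time_iff: "(t :: enat) < \<infinity> \<longleftrightarrow> (\<exists>k. t = enat k)"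
  by (cases t) auto

lemma measurable_enat_time:
  assumes "\<And>k. {z \<in> space M. t z = enat k} \<in> sets M"
  shows "t \<in> M \<rightarrow>\<^sub>M count_space UNIV"
proof -
  have "{z \<in> space M. t z = \<infinity>} = space M - (\<Union>k. {z \<in> space M. t z = enat k})"
    by (auto simp: finite_time_iff)
  then have "{z \<in> space M. t z = \<infinity>} \<in> sets M" using assms by auto
  then have "t -` {x} \<inter> space M \<in> sets M" for x
    using assms by (cases x) (simp_all add: vimage_def Int_def conj_commute)
  then show ?thesis by (simp add: measurable_count_space_eq2_countable)
qed

lemma measurable_future_min_time [measurable]:
  "future_min_time \<in> path_space \<rightarrow>\<^sub>M count_space UNIV"
  by (rule measurable_enat_time) (unfold future_min_time_eq_iff, measurable)

lemma measurable_weak_ladder_epoch [measurable]: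
  "weak_ladder_epoch \<in> path_space \<rightarrow>\<^sub>M count_space UNIV"
  by (rule measurable_enat_time) (unfold weak_ladder_epoch_eq_iff, measurable)

text \<open>
  Padding with zeros keeps pieces of path of different lengths in the single space \<open>path_space\<close>.
\<close>

definition trunc :: "nat \<Rightarrow> (nat \<Rightarrow> real) \<Rightarrow> nat \<Rightarrow> real" where
  "trunc k z = (\<lambda>i. if i \<in> {1..k} then z i else 0)"

lemma measurable_trunc [measurable]: "trunc k \<in> path_space \<rightarrow>\<^sub>M path_space"
  unfolding trunc_def by (rule measurable_PiM_single') (auto simp: space_PiM)

definition reversed :: "nat \<Rightarrow> (nat \<Rightarrow> real) \<Rightarrow> nat \<Rightarrow> real" where
  "reversed k S = (\<lambda>i. S k - S (k - i))"

lemma measurable_reversed [measurable]: "reversed k \<in> path_space \<rightarrow>\<^sub>M path_space"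
  unfolding reversed_def by (rule measurable_PiM_single') (auto simp: space_PiM)

definition depends_upto :: "nat \<Rightarrow> (nat \<Rightarrow> real) set \<Rightarrow> bool" where
  "depends_upto m A \<longleftrightarrow> (\<forall>z w. (\<forall>i\<le>m. z i = w i) \<longrightarrow> z \<in> A \<longrightarrow> w \<in> A)"

lemma depends_upto_iff: "depends_upto m A \<Longrightarrow> (\<And>i. i \<le> m \<Longrightarrow> z i = w i) \<Longrightarrow> z \<in> A \<longleftrightarrow> w \<in> A"
  unfolding depends_upto_def by metis

text \<open>
  This is what the event \<open>\<nu> = k\<close> says about the path up to time \<open>k\<close>, as a set of step sequences.
  The later part must not go below \<open>z k\<close>, and \<open>kept_minimum k B m\<close> asks this for \<open>m\<close> further steps.
\<close>

definition final_minimum :: "nat \<Rightarrow> (nat \<Rightarrow> real) set \<Rightarrow> (nat \<Rightarrow> real) set" where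
  "final_minimum k B = {X. (\<forall>j\<in>{1..<k}. psum X k < psum X j) \<and> 0 \<le> psum X k \<and> trunc k (psum X) \<in> B}"

definition kept_minimum :: "nat \<Rightarrow> (nat \<Rightarrow> real) set \<Rightarrow> nat \<Rightarrow> (nat \<Rightarrow> real) set" where
  "kept_minimum k B m = {z. (\<forall>j\<in>{1..<k}. z k < z j) \<and> 0 \<le> z k \<and> trunc k z \<in> B \<and> (\<forall>n\<le>m. z k \<le> z (k + n))}"

lemma sets_final_minimum [measurable]:
  assumes [measurable]: "B \<in> sets path_space"
  shows "final_minimum k B \<in> sets path_space"
  unfolding final_minimum_def by (rule path_setI) measurable

lemma sets_kept_minimum [measurable]:
  assumes [measurable]: "B \<in> sets path_space"
  shows "kept_minimum k B m \<in> sets path_space"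
  unfolding kept_minimum_def by (rule path_setI) measurable

lemma final_minimum_stays: "X \<in> final_minimum k B \<Longrightarrow> stays k X"
proof -
  assume X: "X \<in> final_minimum k B"
  have "0 \<le> psum X i" if "i \<le> k" for i
  proof (cases "i = 0 \<or> i = k")
    case False
    then have "psum X k < psum X i" using that X by (auto simp: final_minimum_def)
    with X show ?thesis by (auto simp: final_minimum_def)
  qed (use X in \<open>auto simp: final_minimum_def\<close>)
  then show ?thesis by (simp add: stays_def)
qed

lemma kept_minimum_iff:
  "stays (k + m) (comb_seq k X Y) \<and> psum (comb_seq k X Y) \<in> kept_minimum k B m \<longleftrightarrow> X \<in> final_minimum k B \<and> stays m Y"
proof -
  have "trunc k (psum (comb_seq k X Y)) = trunc k (psum X)"
    by (auto simp: trunc_def psum_comb_seq_le)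
  moreover have "(\<forall>j\<in>{1..<k}. psum (comb_seq k X Y) k < psum (comb_seq k X Y) j) \<longleftrightarrow>
      (\<forall>j\<in>{1..<k}. psum X k < psum X j)"
    by (intro ball_cong) (auto simp: psum_comb_seq_le)
  ultimately have "psum (comb_seq k X Y) \<in> kept_minimum k B m \<longleftrightarrow> X \<in> final_minimum k B \<and> stays m Y"
    by (auto simp: kept_minimum_def final_minimum_def psum_comb_seq_le psum_comb_seq_add stays_def)
  moreover have "stays (k + m) (comb_seq k X Y)" if "X \<in> final_minimum k B" "stays m Y"
    using final_minimum_stays[OF that(1)] that(2) stays_psum[OF final_minimum_stays[OF that(1)]]
    unfolding stays_comb_seq by (auto simp: stays_def)
  ultimately show ?thesis by blast
qed

lemma emeasure_finite_time:
  assumes M: "sets M = sets path_space" and t [measurable]: "t \<in> path_space \<rightarrow>\<^sub>M count_space UNIV"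
    and 0: "\<And>z. t z \<noteq> enat 0" and P: "\<And>k. {z. P k z} \<in> sets path_space"
  shows "emeasure M {z. \<exists>k. t z = enat k \<and> P k z} = (\<Sum>k. emeasure M {z. t z = enat (Suc k) \<and> P (Suc k) z})"
proof -
  have "{z. t z = enat k} \<in> sets path_space" for k by (rule path_setI) measurable
  then have s: "{z. t z = enat k \<and> P k z} \<in> sets path_space" for k
    using P sets.Int by (auto simp: Collect_conj_eq)
  have "{z. \<exists>k. t z = enat k \<and> P k z} = (\<Union>k. {z. t z = enat (Suc k) \<and> P (Suc k) z})"
    using 0 by (auto, metis not0_implies_Suc)
  then show ?thesis
    using s M by (simp add: suminf_emeasure disjoint_family_on_def disjoint_iff image_subset_iff)
qed

definition future_pair :: "(nat \<Rightarrow> real) \<Rightarrow> nat \<times> (nat \<Rightarrow> real)" where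
  "future_pair z = (let k = the_enat (future_min_time z) in (k, trunc k z))"

definition ladder_pair :: "(nat \<Rightarrow> real) \<Rightarrow> nat \<times> (nat \<Rightarrow> real)" where
  "ladder_pair S = (let k = the_enat (weak_ladder_epoch S) in (k, trunc k (reversed k S)))"

lemma measurable_future_pair [measurable]: "future_pair \<in> path_space \<rightarrow>\<^sub>M count_space UNIV \<Otimes>\<^sub>M path_space"
proof -
  have [measurable]: "(\<lambda>z. the_enat (future_min_time z)) \<in> path_space \<rightarrow>\<^sub>M count_space UNIV" by measurable
  have "(\<lambda>z. trunc (the_enat (future_min_time z)) z) \<in> path_space \<rightarrow>\<^sub>M path_space"
    by (rule measurable_compose_countable) measurable
  then show ?thesis unfolding future_pair_def Let_def by measurable
qed

lemma measurable_ladder_pair [measurable]: "ladder_pair \<in> path_space \<rightarrow>\<^sub>M count_space UNIV \<Otimes>\<^sub>M path_space"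
proof -
  have [measurable]: "(\<lambda>z. the_enat (weak_ladder_epoch z)) \<in> path_space \<rightarrow>\<^sub>M count_space UNIV" by measurable
  have "(\<lambda>z. trunc (the_enat (weak_ladder_epoch z)) (reversed (the_enat (weak_ladder_epoch z)) z)) \<in> path_space \<rightarrow>\<^sub>M path_space"
    by (rule measurable_compose_countable[where f = "\<lambda>k z. trunc k (reversed k z)"]) measurable
  then show ?thesis unfolding ladder_pair_def Let_def by measurable
qed

context centred_walk
begin

text \<open>
  Read backwards from its end point, a path with a strict final minimum at time \<open>k\<close> is negative
  before time \<open>k\<close> and nonnegative at time \<open>k\<close>: a first weak ascending ladder epoch.
\<close>

lemma final_minimum_reversal:
  assumes [measurable]: "B \<in> sets path_space" and k: "1 \<le> k"
  shows "emeasure steps (final_minimum k B) =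
    emeasure steps {X. weak_ladder_epoch (psum X) = enat k \<and> trunc k (reversed k (psum X)) \<in> B}"
proof -
  have meas: "{X. weak_ladder_epoch (psum X) = enat k \<and> trunc k (reversed k (psum X)) \<in> B} \<in> sets path_space"
    by (rule path_setI) measurable
  have "rev_steps k X \<in> final_minimum k B \<longleftrightarrow> weak_ladder_epoch (psum X) = enat k \<and> trunc k (reversed k (psum X)) \<in> B" for X
  proof -
    have "trunc k (psum (rev_steps k X)) = trunc k (reversed k (psum X))"
      by (auto simp: trunc_def reversed_def psum_rev_steps)
    moreover have "(\<forall>j\<in>{1..<k}. psum (rev_steps k X) k < psum (rev_steps k X) j) \<longleftrightarrow> (\<forall>j\<in>{1..<k}. psum X j < 0)"
    proof -
      have "(\<forall>j\<in>{1..<k}. psum (rev_steps k X) k < psum (rev_steps k X) j) \<longleftrightarrow> (\<forall>j\<in>{1..<k}. psum X (k - j) < 0)"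
        by (intro ball_cong) (auto simp: psum_rev_steps)
      also have "\<dots> \<longleftrightarrow> (\<forall>j\<in>(\<lambda>j. k - j) ` {1..<k}. psum X j < 0)" by simp
      also have "(\<lambda>j. k - j) ` {1..<k} = {1..<k}"
      proof -
        have "j \<in> (\<lambda>j. k - j) ` {1..<k}" if "j \<in> {1..<k}" for j
          using that by (intro image_eqI[of _ _ "k - j"]) auto
        then show ?thesis by auto
      qed
      finally show ?thesis .
    qed
    ultimately show ?thesis
      using k by (auto simp: final_minimum_def weak_ladder_epoch_eq_iff psum_rev_steps)
  qed
  then have ind: "indicator {X. weak_ladder_epoch (psum X) = enat k \<and> trunc k (reversed k (psum X)) \<in> B} X =
      (indicator (final_minimum k B) (rev_steps k X) :: ennreal)" for X
    by (simp add: indicator_def)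
  have "emeasure steps (final_minimum k B) = (\<integral>\<^sup>+X. indicator (final_minimum k B) X \<partial>steps)" by simp
  also have "\<dots> = (\<integral>\<^sup>+X. indicator (final_minimum k B) (rev_steps k X) \<partial>steps)"
    by (rule nn_integral_reverse[symmetric]) measurable
  also have "\<dots> = emeasure steps {X. weak_ladder_epoch (psum X) = enat k \<and> trunc k (reversed k (psum X)) \<in> B}"
    unfolding ind[symmetric] using meas by simp
  finally show ?thesis .
qed

lemma AE_weak_ladder_epoch_finite: "AE X in steps. weak_ladder_epoch (psum X) < \<infinity>"
  using AE_not_always_negative
proof eventually_elim
  fix X :: "nat \<Rightarrow> real" assume "\<exists>n\<ge>1. 0 \<le> psum X n"
  then obtain n where "1 \<le> n" "0 \<le> psum X n" by blast
  then have "weak_ladder_epoch (psum X) \<le> enat n"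
    unfolding weak_ladder_epoch_def by (intro Inf_lower) auto
  then show "weak_ladder_epoch (psum X) < \<infinity>" by (rule le_less_trans) simp
qed

end

section \<open>The Doob transform of the i.i.d. walk\<close>

text \<open>
  \<open>T\<close> is the walk conditioned to stay nonnegative in the sense of Doob: up to time \<open>m\<close> its density
  with respect to the free walk is \<open>h (S\<^sub>m) / h 0\<close> on the event of survival.
\<close>

locale htransformed_walk = centred_walk +
  fixes T :: "(nat \<Rightarrow> real) measure"
  assumes prob_T: "prob_space T" and sets_T [simp, measurable_cong]: "sets T = sets path_space"
    and htransform: "\<And>m A. A \<in> sets path_space \<Longrightarrow> depends_upto m A \<Longrightarrow>
      h 0 * emeasure T A = (\<integral>\<^sup>+X. indicator {X. stays m X} X * indicator A (psum X) * h (psum X m) \<partial>steps)"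
begin

sublocale T: prob_space T by (rule prob_T)

lemma space_T [simp]: "space T = UNIV"
  using sets_eq_imp_space_eq[OF sets_T] by (simp add: space_PiM)

text \<open>
  By the Markov property at time \<open>k\<close>, \<open>h 0\<close> times the \<open>T\<close>-probability is the expectation of
  \<open>g (S\<^sub>k)\<close> on the event \<^const>\<open>final_minimum\<close>, where \<open>g s = E (h (s + S\<^sub>m); survival up to m)\<close>. Since
  \<open>h\<close> is increasing, \<open>g s \<ge> g 0 = h 0\<close>; since \<open>h (s + t) \<le> h t + h s + s\<close> and \<open>s \<le> h s\<close>, the
  difference \<open>g s - h 0\<close> is at most \<open>2 h s\<close> times the survival probability. So asymptotically the
  cost of staying above the minimum does not depend on its height.
\<close>

lemma emeasure_kept_minimum:
  assumes [measurable]: "B \<in> sets path_space"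
  shows "emeasure steps (final_minimum k B) \<le> emeasure T (kept_minimum k B m)"
    and "emeasure T (kept_minimum k B m) \<le> emeasure steps (final_minimum k B) + 2 * emeasure steps {X. stays m X}"
proof -
  define g where "g s = (\<integral>\<^sup>+Y. indicator {X. stays m X} Y * h (s + psum Y m) \<partial>steps)" for s
  have [measurable]: "g \<in> borel_measurable borel" unfolding g_def by measurable
  have "depends_upto (k + m) (kept_minimum k B m)"
  proof -
    have "w \<in> kept_minimum k B m" if eq: "\<And>i. i \<le> k + m \<Longrightarrow> z i = w i" and z: "z \<in> kept_minimum k B m" for z w
    proof -
      have "trunc k z = trunc k w" using eq by (auto simp: trunc_def)
      with z eq show ?thesis by (simp add: kept_minimum_def)
    qed
    then show ?thesis unfolding depends_upto_def by blast
  qed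
  then have "h 0 * emeasure T (kept_minimum k B m) = (\<integral>\<^sup>+X. indicator {X. stays (k + m) X} X *
      indicator (kept_minimum k B m) (psum X) * h (psum X (k + m)) \<partial>steps)"
    by (intro htransform) measurable
  also have "\<dots> = (\<integral>\<^sup>+X. \<integral>\<^sup>+Y. indicator {X. stays (k + m) X} (comb_seq k X Y) *
      indicator (kept_minimum k B m) (psum (comb_seq k X Y)) * h (psum (comb_seq k X Y) (k + m)) \<partial>steps \<partial>steps)"
    by (rule nn_integral_split) measurable
  also have "\<dots> = (\<integral>\<^sup>+X. \<integral>\<^sup>+Y. indicator (final_minimum k B) X * (indicator {X. stays m X} Y * h (psum X k + psum Y m)) \<partial>steps \<partial>steps)"
  proof (intro nn_integral_cong)
    fix X Y
    show "indicator {X. stays (k + m) X} (comb_seq k X Y) * indicator (kept_minimum k B m) (psum (comb_seq k X Y)) *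
        h (psum (comb_seq k X Y) (k + m)) =
      indicator (final_minimum k B) X * (indicator {X. stays m X} Y * h (psum X k + psum Y m))"
      using kept_minimum_iff[of k m X Y B] by (auto simp: indicator_def psum_comb_seq_add)
  qed
  also have "\<dots> = (\<integral>\<^sup>+X. indicator (final_minimum k B) X * g (psum X k) \<partial>steps)"
    unfolding g_def by (intro nn_integral_cong nn_integral_cmult) measurable
  finally have eq: "h 0 * emeasure T (kept_minimum k B m) = (\<integral>\<^sup>+X. indicator (final_minimum k B) X * g (psum X k) \<partial>steps)" .
  have nz: "h 0 \<noteq> 0" "h 0 \<noteq> top" using h_0_pos h_0_finite by auto
  have cancel: "a \<le> b" if "h 0 * a \<le> h 0 * b" for a b :: ennreal
    using that nz by (metis ennreal_mult_le_mult_iff)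
  have "h 0 * emeasure steps (final_minimum k B) = (\<integral>\<^sup>+X. indicator (final_minimum k B) X * h 0 \<partial>steps)"
    by (subst nn_integral_multc) (auto simp: mult.commute)
  also have "\<dots> \<le> (\<integral>\<^sup>+X. indicator (final_minimum k B) X * g (psum X k) \<partial>steps)"
  proof (intro nn_integral_mono)
    fix X
    show "indicator (final_minimum k B) X * h 0 \<le> indicator (final_minimum k B) X * g (psum X k)"
    proof (cases "X \<in> final_minimum k B")
      case True
      then have "0 \<le> psum X k" by (simp add: final_minimum_def)
      then have "h 0 \<le> g (psum X k)"
        unfolding g_def nn_integral_h_walk[symmetric, of m]
        by (intro nn_integral_mono mult_left_mono harmonic_mono) auto
      then show ?thesis by (intro mult_left_mono) auto
    qed simp
  qed
  finally show "emeasure steps (final_minimum k B) \<le> emeasure T (kept_minimum k B m)"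
    by - (rule cancel, simp add: eq)
  let ?p = "emeasure steps {X. stays m X}"
  have g_le: "g s \<le> h 0 + 2 * h s * ?p" if "0 \<le> s" for s
  proof -
    have "g s \<le> (\<integral>\<^sup>+Y. indicator {X. stays m X} Y * h (psum Y m) + indicator {X. stays m X} Y * (2 * h s) \<partial>steps)"
      unfolding g_def
    proof (intro nn_integral_mono)
      fix Y
      show "indicator {X. stays m X} Y * h (s + psum Y m) \<le>
          indicator {X. stays m X} Y * h (psum Y m) + indicator {X. stays m X} Y * (2 * h s)"
      proof (cases "stays m Y")
        case True
        have "h (s + psum Y m) \<le> ennreal s + h (psum Y m) + h s"
          using that stays_psum[OF True] by (rule h_subadditive)
        also have "\<dots> \<le> h s + h (psum Y m) + h s"
          by (intro add_mono harmonic_ge order_refl)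
        also have "\<dots> = h (psum Y m) + 2 * h s" by (simp only: mult_2 ac_simps)
        finally show ?thesis using True by simp
      qed simp
    qed
    also have "\<dots> = h 0 + 2 * h s * ?p"
      by (subst nn_integral_add) (auto simp: nn_integral_h_walk nn_integral_multc mult.commute)
    finally show ?thesis .
  qed
  have "h 0 * emeasure T (kept_minimum k B m) \<le>
      (\<integral>\<^sup>+X. h 0 * indicator (final_minimum k B) X + 2 * ?p * (indicator {X. stays k X} X * h (psum X k)) \<partial>steps)"
    unfolding eq
  proof (intro nn_integral_mono)
    fix X
    show "indicator (final_minimum k B) X * g (psum X k) \<le>
      h 0 * indicator (final_minimum k B) X + 2 * ?p * (indicator {X. stays k X} X * h (psum X k))"
      using final_minimum_stays[of X k B] g_le[of "psum X k"] stays_psum[of k X]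
      by (auto simp: mult.assoc mult.commute[of _ ?p] split: split_indicator)
  qed
  also have "\<dots> = h 0 * emeasure steps (final_minimum k B) + 2 * ?p * h 0"
    by (subst nn_integral_add) (auto simp: nn_integral_cmult nn_integral_h_walk)
  finally show "emeasure T (kept_minimum k B m) \<le> emeasure steps (final_minimum k B) + 2 * ?p"
    by - (rule cancel, simp add: distrib_left mult.commute)
qed

text \<open>
  Let \<open>m\<close> tend to infinity in the two bounds: they meet because the survival probability tends
  to zero.
\<close>

lemma future_min_law_final_minimum:
  assumes [measurable]: "B \<in> sets path_space" and k: "1 \<le> k"
  shows "emeasure T {z. future_min_time z = enat k \<and> trunc k z \<in> B} = emeasure steps (final_minimum k B)"
proof -
  have "(\<lambda>m. emeasure T (kept_minimum k B m)) \<longlonglongrightarrow> emeasure T (\<Inter>m. kept_minimum k B m)"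
  proof (rule Lim_emeasure_decseq)
    show "decseq (kept_minimum k B)" by (auto simp: decseq_def kept_minimum_def)
  qed auto
  moreover have "(\<lambda>m. emeasure T (kept_minimum k B m)) \<longlonglongrightarrow> emeasure steps (final_minimum k B)"
  proof (rule tendsto_sandwich[where f = "\<lambda>_. emeasure steps (final_minimum k B)"
        and h = "\<lambda>m. emeasure steps (final_minimum k B) + 2 * emeasure steps {X. stays m X}"])
    have "(\<lambda>m. emeasure steps (final_minimum k B) + 2 * ennreal (measure steps {X. stays m X})) \<longlonglongrightarrow>
        emeasure steps (final_minimum k B) + 2 * ennreal 0"
      by (intro tendsto_add tendsto_const ennreal_tendsto_cmult tendsto_ennrealI stays_decay) simp
    then show "(\<lambda>m. emeasure steps (final_minimum k B) + 2 * emeasure steps {X. stays m X}) \<longlonglongrightarrow> emeasure steps (final_minimum k B)"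
      by (simp add: walk.emeasure_eq_measure)
    show "\<forall>\<^sub>F m in sequentially. emeasure steps (final_minimum k B) \<le> emeasure T (kept_minimum k B m)"
      "\<forall>\<^sub>F m in sequentially. emeasure T (kept_minimum k B m) \<le> emeasure steps (final_minimum k B) + 2 * emeasure steps {X. stays m X}"
      using emeasure_kept_minimum[OF assms(1)] by auto
  qed (rule tendsto_const)
  ultimately have lim: "emeasure T (\<Inter>m. kept_minimum k B m) = emeasure steps (final_minimum k B)"
    by (rule LIMSEQ_unique)
  \<comment> \<open>\<open>T\<close> lives on nonnegative paths, so the condition \<open>0 \<le> z k\<close> in \<open>kept_minimum\<close> costs nothing\<close>
  have neg_set: "{z. z k < 0} \<in> sets path_space" by (rule path_setI) measurable
  have "h 0 * emeasure T {z. z k < 0} =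
      (\<integral>\<^sup>+X. indicator {X. stays k X} X * indicator {z. z k < 0} (psum X) * h (psum X k) \<partial>steps)"
    by (intro htransform neg_set) (auto simp: depends_upto_def)
  also have "\<dots> = 0"
    by (intro nn_integral_zero' AE_I2) (auto split: split_indicator dest: stays_psum)
  finally have "emeasure T {z. z k < 0} = 0" using h_0_pos by auto
  then have "AE z in T. 0 \<le> z k"
    using neg_set by (intro AE_I[of _ _ "{z. z k < 0}"]) auto
  then have "emeasure T {z. future_min_time z = enat k \<and> trunc k z \<in> B} = emeasure T (\<Inter>m. kept_minimum k B m)"
  proof (intro emeasure_eq_AE, eventually_elim)
    fix z :: "nat \<Rightarrow> real" assume "0 \<le> z k"
    then show "z \<in> {z. future_min_time z = enat k \<and> trunc k z \<in> B} \<longleftrightarrow> z \<in> (\<Inter>m. kept_minimum k B m)"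
      using k unfolding future_min_time_eq_iff kept_minimum_def by auto
  next
    show "{z. future_min_time z = enat k \<and> trunc k z \<in> B} \<in> sets T"
      unfolding sets_T by (rule path_setI) measurable
  qed measurable
  then show ?thesis using lim by simp
qed

lemma future_min_law:
  assumes "B \<in> sets path_space" "1 \<le> k"
  shows "emeasure T {z. future_min_time z = enat k \<and> trunc k z \<in> B} =
    emeasure steps {X. weak_ladder_epoch (psum X) = enat k \<and> trunc k (reversed k (psum X)) \<in> B}"
  using future_min_law_final_minimum[OF assms] final_minimum_reversal[OF assms] by simp

text \<open>
  The ladder epoch is finite, and the two times have the same law on the positive integers, so no
  mass is left for an infinite time.
\<close>

lemma AE_future_min_time_finite: "AE z in T. future_min_time z < \<infinity>"
proof -
  have "emeasure T {z. \<exists>k. future_min_time z = enat k \<and> True} =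
      (\<Sum>k. emeasure T {z. future_min_time z = enat (Suc k) \<and> True})"
    by (rule emeasure_finite_time) (auto simp: future_min_time_eq_iff)
  also have "\<dots> = (\<Sum>k. emeasure steps {X. weak_ladder_epoch (psum X) = enat (Suc k) \<and> True})"
    using future_min_law[of UNIV, OF UNIV_path_space] by simp
  also have "\<dots> = emeasure steps {X. \<exists>k. weak_ladder_epoch (psum X) = enat k \<and> True}"
    by (rule emeasure_finite_time[symmetric]) (auto simp: weak_ladder_epoch_eq_iff)
  also have "\<dots> = emeasure steps (space steps)"
  proof (rule emeasure_eq_AE)
    show "AE X in steps. X \<in> {X. \<exists>k. weak_ladder_epoch (psum X) = enat k \<and> True} \<longleftrightarrow> X \<in> space steps"
      using AE_weak_ladder_epoch_finite by eventually_elim (auto simp: finite_time_iff)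
    show "{X. \<exists>k. weak_ladder_epoch (psum X) = enat k \<and> True} \<in> sets steps"
      unfolding sets_steps by (rule path_setI) measurable
  qed simp
  also have "\<dots> = 1" by (rule walk.emeasure_space_1)
  finally have "emeasure T {z \<in> space T. future_min_time z < \<infinity>} = 1"
    by (simp only: finite_time_iff simp_thms space_T UNIV_I)
  then show ?thesis
    by (subst T.AE_iff_emeasure_eq_1) auto
qed

text \<open>
  The joint law of the time and the piece of path that it cuts off. All assertions about functionals
  follow by transport along these two maps.
\<close>

theorem pair_law:
  "distr T (count_space UNIV \<Otimes>\<^sub>M path_space) future_pair =
   distr (distr steps path_space psum) (count_space UNIV \<Otimes>\<^sub>M path_space) ladder_pair"
proof (rule measure_eqI)
  fix C assume "C \<in> sets (distr T (count_space UNIV \<Otimes>\<^sub>M path_space) future_pair)"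
  then have C [measurable]: "C \<in> sets (count_space UNIV \<Otimes>\<^sub>M path_space)" by simp
  define B where "B k = Pair k -` C" for k
  have B [measurable]: "B k \<in> sets path_space" for k
    unfolding B_def by (rule sets_Pair1[OF C])
  have "emeasure (distr T (count_space UNIV \<Otimes>\<^sub>M path_space) future_pair) C = emeasure T (future_pair -` C \<inter> space T)"
    by (rule emeasure_distr) measurable
  also have "\<dots> = emeasure T {z. \<exists>k. future_min_time z = enat k \<and> trunc k z \<in> B k}"
  proof (rule emeasure_eq_AE)
    show "AE z in T. z \<in> future_pair -` C \<inter> space T \<longleftrightarrow> z \<in> {z. \<exists>k. future_min_time z = enat k \<and> trunc k z \<in> B k}"
      using AE_future_min_time_finite
      by eventually_elim (auto simp: finite_time_iff future_pair_def B_def)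
    show "{z. \<exists>k. future_min_time z = enat k \<and> trunc k z \<in> B k} \<in> sets T"
      unfolding sets_T by (rule path_setI) measurable
  qed measurable
  also have "\<dots> = (\<Sum>k. emeasure T {z. future_min_time z = enat (Suc k) \<and> trunc (Suc k) z \<in> B (Suc k)})"
    by (rule emeasure_finite_time) (auto simp: future_min_time_eq_iff intro!: path_setI)
  also have "\<dots> = (\<Sum>k. emeasure steps {X. weak_ladder_epoch (psum X) = enat (Suc k) \<and>
      trunc (Suc k) (reversed (Suc k) (psum X)) \<in> B (Suc k)})"
    by (intro suminf_cong future_min_law B) simp
  also have "\<dots> = emeasure steps {X. \<exists>k. weak_ladder_epoch (psum X) = enat k \<and> trunc k (reversed k (psum X)) \<in> B k}"
    by (rule emeasure_finite_time[symmetric]) (auto simp: weak_ladder_epoch_eq_iff intro!: path_setI)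
  also have "\<dots> = emeasure steps (psum -` (ladder_pair -` C \<inter> space path_space) \<inter> space steps)"
  proof (rule emeasure_eq_AE)
    show "AE X in steps. X \<in> {X. \<exists>k. weak_ladder_epoch (psum X) = enat k \<and> trunc k (reversed k (psum X)) \<in> B k} \<longleftrightarrow>
        X \<in> psum -` (ladder_pair -` C \<inter> space path_space) \<inter> space steps"
      using AE_weak_ladder_epoch_finite
      by eventually_elim (auto simp: finite_time_iff ladder_pair_def B_def space_PiM)
    show "{X. \<exists>k. weak_ladder_epoch (psum X) = enat k \<and> trunc k (reversed k (psum X)) \<in> B k} \<in> sets steps"
      unfolding sets_steps by (rule path_setI) measurable
    show "psum -` (ladder_pair -` C \<inter> space path_space) \<inter> space steps \<in> sets steps"
      by (rule measurable_sets[of _ _ path_space]) measurable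
  qed
  also have "\<dots> = emeasure (distr (distr steps path_space psum) (count_space UNIV \<Otimes>\<^sub>M path_space) ladder_pair) C"
    by (subst emeasure_distr, measurable, subst emeasure_distr, measurable)
  finally show "emeasure (distr T (count_space UNIV \<Otimes>\<^sub>M path_space) future_pair) C = \<dots>" .
qed simp

end

section \<open>Expectations over killed paths\<close>

text \<open>
  \<open>killed_paths \<kappa> m G\<close> is the expectation of \<open>G\<close> over paths of length \<open>m\<close> from the origin that stay
  nonnegative. The recursion integrates out the last step, which makes it compatible with the transition
  law of a Markov chain and keeps \<open>G\<close> a function of the whole path.
\<close>

fun killed_paths :: "(nat \<Rightarrow> real measure) \<Rightarrow> nat \<Rightarrow> ((nat \<Rightarrow> real) \<Rightarrow> ennreal) \<Rightarrow> ennreal" where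
  "killed_paths \<kappa> 0 G = G (\<lambda>_. 0)"
| "killed_paths \<kappa> (Suc m) G =
    killed_paths \<kappa> m (\<lambda>z. \<integral>\<^sup>+x. indicator {0..} (z m + x) * G (z(Suc m := z m + x)) \<partial>\<kappa> m)"

text \<open>
  The path that is built starts at zero and each update keeps it nonnegative.
\<close>

lemma killed_paths_cong:
  assumes "\<And>z. (\<And>i. 0 \<le> z i) \<Longrightarrow> G z = G' z"
  shows "killed_paths \<kappa> m G = killed_paths \<kappa> m G'"
  using assms
proof (induction m arbitrary: G G')
  case (Suc m)
  show ?case unfolding killed_paths.simps
    using Suc.prems by (intro Suc.IH nn_integral_cong) (auto split: split_indicator)
qed simp

definition cutoff :: "nat \<Rightarrow> (nat \<Rightarrow> real) \<Rightarrow> nat \<Rightarrow> real" where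
  "cutoff m z = (\<lambda>i. if i \<le> m then z i else 0)"

lemma measurable_cutoff [measurable]: "cutoff m \<in> path_space \<rightarrow>\<^sub>M path_space"
  unfolding cutoff_def by (rule measurable_PiM_single') (auto simp: space_PiM)

lemma cutoff_Suc: "cutoff (Suc m) z = (cutoff m z)(Suc m := z (Suc m))"
  by (auto simp: cutoff_def fun_eq_iff)

lemma measurable_upd [measurable (raw)]:
  assumes f: "f \<in> N \<rightarrow>\<^sub>M path_space" and g: "g \<in> borel_measurable N"
  shows "(\<lambda>x. (f x)(k := g x)) \<in> N \<rightarrow>\<^sub>M path_space"
proof (rule measurable_PiM_single')
  show "(\<lambda>x. ((f x)(k := g x)) i) \<in> borel_measurable N" for i
    using g measurable_compose[OF f measurable_component_singleton[of i UNIV]] by (cases "i = k") auto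
qed (auto simp: space_PiM)

context centred_walk
begin

lemma killed_paths_walk:
  assumes "G \<in> borel_measurable path_space"
  shows "killed_paths (\<lambda>_. \<rho>) m G = (\<integral>\<^sup>+X. indicator {X. stays m X} X * G (cutoff m (psum X)) \<partial>steps)"
  using assms
proof (induction m arbitrary: G)
  case 0
  have "cutoff 0 (psum X) = (\<lambda>_. 0)" for X by (auto simp: cutoff_def)
  then show ?case by (simp add: stays_def walk.emeasure_space_1[simplified])
next
  case (Suc m)
  note [measurable] = Suc.prems
  have "killed_paths (\<lambda>_. \<rho>) (Suc m) G = (\<integral>\<^sup>+X. indicator {X. stays m X} X *
     (\<integral>\<^sup>+x. indicator {0..} (psum X m + x) * G ((cutoff m (psum X))(Suc m := psum X m + x)) \<partial>\<rho>) \<partial>steps)"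
    unfolding killed_paths.simps by (subst Suc.IH) (measurable, simp add: cutoff_def)
  also have "\<dots> = (\<integral>\<^sup>+X. \<integral>\<^sup>+x. indicator {X. stays m X} X *
     (indicator {0..} (psum X m + x) * G ((cutoff m (psum X))(Suc m := psum X m + x))) \<partial>\<rho> \<partial>steps)"
    by (intro nn_integral_cong nn_integral_cmult[symmetric]) measurable
  also have "\<dots> = (\<integral>\<^sup>+X. indicator {X. stays m X} X *
     (indicator {0..} (psum X m + X m) * G ((cutoff m (psum X))(Suc m := psum X m + X m))) \<partial>steps)"
  proof (rule nn_integral_last_step[symmetric])
    fix X Y :: "nat \<Rightarrow> real" and x assume eq: "\<And>i. i < m \<Longrightarrow> X i = Y i"
    have "psum X m = psum Y m" "stays m X = stays m Y" "cutoff m (psum X) = cutoff m (psum Y)"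
      using psum_cong[of m X Y, OF eq] stays_cong[of m X Y, OF eq] by (auto simp: cutoff_def)
    then show "indicator {X. stays m X} X * (indicator {0..} (psum X m + x) * G ((cutoff m (psum X))(Suc m := psum X m + x))) =
      indicator {X. stays m X} Y * (indicator {0..} (psum Y m + x) * G ((cutoff m (psum Y))(Suc m := psum Y m + x)))"
      by (simp add: indicator_def)
  qed measurable
  also have "\<dots> = (\<integral>\<^sup>+X. indicator {X. stays (Suc m) X} X * G (cutoff (Suc m) (psum X)) \<partial>steps)"
    by (intro nn_integral_cong) (auto simp: stays_Suc cutoff_Suc psum_Suc split: split_indicator)
  finally show ?case .
qed

end

section \<open>Averaging over the environment\<close>

text \<open>
  An i.i.d. environment of law \<open>P\<close> in which the environment \<open>e\<close> at one time determines the step law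
  \<open>\<mu> e\<close>. The average \<open>mean_law\<close> is the annealed step law.
\<close>

locale random_steps = P: prob_space P for P :: "'e measure" +
  fixes \<mu> :: "'e \<Rightarrow> real measure"
  assumes measurable_\<mu>: "\<mu> \<in> P \<rightarrow>\<^sub>M prob_algebra borel"
    and centred_\<mu>: "\<And>e. e \<in> space P \<Longrightarrow> centred (\<mu> e)"
begin

abbreviation env :: "(nat \<Rightarrow> 'e) measure" where "env \<equiv> PiM UNIV (\<lambda>_. P)"
definition mean_law :: "real measure" where "mean_law = P \<bind> \<mu>"

sublocale env: prob_space env by (intro prob_space_PiM P.prob_space_axioms)

lemma measurable_\<mu>_sub [measurable]: "\<mu> \<in> P \<rightarrow>\<^sub>M subprob_algebra borel"
  by (rule measurable_prob_algebraD[OF measurable_\<mu>])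

lemma centred_env: "e \<in> space env \<Longrightarrow> centred (\<mu> (e i))"
  by (rule centred_\<mu>) (auto simp: space_PiM PiE_iff)

lemma nn_integral_mean_law:
  "g \<in> borel_measurable borel \<Longrightarrow> (\<integral>\<^sup>+x. g x \<partial>mean_law) = (\<integral>\<^sup>+e. \<integral>\<^sup>+x. g x \<partial>\<mu> e \<partial>P)"
  unfolding mean_law_def by (rule nn_integral_bind[where B = borel]) auto

lemma sets_mean_law [measurable_cong, simp]: "sets mean_law = sets borel"
  unfolding mean_law_def by (rule sets_bind[OF _ P.not_empty]) (simp add: centredD[OF centred_\<mu>])

lemma prob_space_mean_law: "prob_space mean_law"
proof
  have "emeasure mean_law (space mean_law) = (\<integral>\<^sup>+x. 1 \<partial>mean_law)" by simp
  also have "\<dots> = (\<integral>\<^sup>+e. \<integral>\<^sup>+x. 1 \<partial>\<mu> e \<partial>P)" by (rule nn_integral_mean_law) simp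
  also have "\<dots> = (\<integral>\<^sup>+e. emeasure (\<mu> e) (space (\<mu> e)) \<partial>P)" by simp
  also have "\<dots> = (\<integral>\<^sup>+e. 1 \<partial>P)"
    by (intro nn_integral_cong prob_space.emeasure_space_1 centredD(2) centred_\<mu>)
  finally show "emeasure mean_law (space mean_law) = 1" by (simp add: P.emeasure_space_1)
qed

lemma measurable_shift [measurable]: "(\<lambda>e i. e (k + i)) \<in> env \<rightarrow>\<^sub>M env"
  by (rule measurable_PiM_single') (auto simp: space_PiM PiE_iff)

lemma measurable_shift_Suc [measurable]: "(\<lambda>e i. e (Suc i)) \<in> env \<rightarrow>\<^sub>M env"
  using measurable_shift[of 1] by simp

text \<open>
  The first step depends on the environment at time \<open>0\<close> only, so it is independent of the shifted
  environment: the average of a quenched step is an annealed step.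
\<close>

lemma nn_integral_first_env:
  assumes G [measurable]: "(\<lambda>(e, x). G e x) \<in> borel_measurable (env \<Otimes>\<^sub>M borel)"
  shows "(\<integral>\<^sup>+e. \<integral>\<^sup>+x. G (\<lambda>i. e (Suc i)) x \<partial>\<mu> (e 0) \<partial>env) = (\<integral>\<^sup>+x. \<integral>\<^sup>+e. G e x \<partial>env \<partial>mean_law)"
proof -
  have meas: "(\<lambda>e. \<integral>\<^sup>+x. G (\<lambda>i. e (Suc i)) x \<partial>\<mu> (e 0)) \<in> borel_measurable env"
    by (rule nn_integral_measurable_subprob_algebra2[where N = borel]) measurable
  have "(\<integral>\<^sup>+e. \<integral>\<^sup>+x. G (\<lambda>i. e (Suc i)) x \<partial>\<mu> (e 0) \<partial>env) = (\<integral>\<^sup>+s. \<integral>\<^sup>+e. \<integral>\<^sup>+x. G e x \<partial>\<mu> s \<partial>env \<partial>P)"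
    by (subst nn_integral_PiM_first[OF P.prob_space_axioms meas]) simp
  also have "\<dots> = (\<integral>\<^sup>+s. \<integral>\<^sup>+x. \<integral>\<^sup>+e. G e x \<partial>env \<partial>\<mu> s \<partial>P)"
  proof (rule nn_integral_cong)
    fix s assume "s \<in> space P"
    then have s: "centred (\<mu> s)" by (rule centred_\<mu>)
    interpret s: prob_space "\<mu> s" by (rule centredD(2)[OF s])
    interpret pair_sigma_finite env "\<mu> s" ..
    have [measurable]: "(\<lambda>(e, x). G e x) \<in> borel_measurable (env \<Otimes>\<^sub>M \<mu> s)"
      using G unfolding measurable_cong_sets[OF sets_pair_measure_cong[OF refl centredD(3)[OF s]] refl] .
    show "(\<integral>\<^sup>+e. \<integral>\<^sup>+x. G e x \<partial>\<mu> s \<partial>env) = (\<integral>\<^sup>+x. \<integral>\<^sup>+e. G e x \<partial>env \<partial>\<mu> s)"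
      by (rule Fubini'[symmetric]) measurable
  qed
  also have "\<dots> = (\<integral>\<^sup>+x. \<integral>\<^sup>+e. G e x \<partial>env \<partial>mean_law)"
    by (rule nn_integral_mean_law[symmetric]) measurable
  finally show ?thesis .
qed

lemma measurable_killed_mean_env [measurable]:
  "(\<lambda>(e, y). killed_mean (\<lambda>i. \<mu> (e i)) n y) \<in> borel_measurable (env \<Otimes>\<^sub>M borel)"
proof (induction n)
  case 0 then show ?case by simp
next
  case (Suc n)
  note [measurable] = Suc
  have "(\<lambda>p. \<integral>\<^sup>+x. indicator {0..} (snd p + x) * (\<lambda>(e, y). killed_mean (\<lambda>i. \<mu> (e i)) n y) (\<lambda>i. fst p (Suc i), snd p + x) \<partial>\<mu> (fst p 0))
     \<in> borel_measurable (env \<Otimes>\<^sub>M borel)"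
    by (rule nn_integral_measurable_subprob_algebra2[where N = borel]) measurable
  then show ?case by (simp add: split_beta')
qed

lemma measurable_harmonic_env [measurable]:
  "(\<lambda>(e, y). harmonic (\<lambda>i. \<mu> (e i)) y) \<in> borel_measurable (env \<Otimes>\<^sub>M borel)"
proof -
  have "(\<lambda>p. SUP n. (\<lambda>(e, y). killed_mean (\<lambda>i. \<mu> (e i)) n y) p) \<in> borel_measurable (env \<Otimes>\<^sub>M borel)"
    by (rule borel_measurable_SUP) (auto intro: measurable_killed_mean_env)
  then show ?thesis by (simp add: harmonic_def split_beta')
qed

lemma measurable_harmonic_env_at [measurable]:
  "(\<lambda>e. harmonic (\<lambda>i. \<mu> (e i)) y) \<in> borel_measurable env"
  using measurable_compose[OF measurable_Pair2' measurable_harmonic_env] by simp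

lemma nn_integral_killed_mean:
  "(\<integral>\<^sup>+e. killed_mean (\<lambda>i. \<mu> (e i)) n y \<partial>env) = killed_mean (\<lambda>_. mean_law) n y"
proof (induction n arbitrary: y)
  case 0 then show ?case by (simp add: env.emeasure_space_1)
next
  case (Suc n)
  have m: "(\<lambda>e. killed_mean (\<lambda>i. \<mu> (e i)) n z) \<in> borel_measurable env" for z
    using measurable_compose[OF measurable_Pair2' measurable_killed_mean_env[of n]] by simp
  have "(\<integral>\<^sup>+e. killed_mean (\<lambda>i. \<mu> (e i)) (Suc n) y \<partial>env) =
     (\<integral>\<^sup>+x. \<integral>\<^sup>+e. indicator {0..} (y + x) * killed_mean (\<lambda>i. \<mu> (e i)) n (y + x) \<partial>env \<partial>mean_law)"
    unfolding killed_mean.simps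
    by (rule nn_integral_first_env[where G = "\<lambda>e x. indicator {0..} (y + x) * killed_mean (\<lambda>i. \<mu> (e i)) n (y + x)"]) measurable
  also have "\<dots> = killed_mean (\<lambda>_. mean_law) (Suc n) y"
    by (simp add: nn_integral_cmult[OF m] Suc)
  finally show ?case .
qed

lemma nn_integral_harmonic:
  assumes "0 \<le> y"
  shows "(\<integral>\<^sup>+e. harmonic (\<lambda>i. \<mu> (e i)) y \<partial>env) = harmonic (\<lambda>_. mean_law) y"
  unfolding harmonic_def nn_integral_killed_mean[symmetric]
proof (rule nn_integral_monotone_convergence_SUP_AE)
  show "AE e in env. killed_mean (\<lambda>i. \<mu> (e i)) n y \<le> killed_mean (\<lambda>i. \<mu> (e i)) (Suc n) y" for n
    using assms by (intro AE_I2 killed_mean_incseq centred_env)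
qed measurable

lemma measurable_killed_paths_env:
  assumes "(\<lambda>(e, z). G e z) \<in> borel_measurable (env \<Otimes>\<^sub>M path_space)"
  shows "(\<lambda>e. killed_paths (\<lambda>i. \<mu> (e i)) m (G e)) \<in> borel_measurable env"
  using assms
proof (induction m arbitrary: G)
  case 0
  note [measurable] = 0
  have [measurable]: "(\<lambda>e. (\<lambda>_::nat. 0::real)) \<in> env \<rightarrow>\<^sub>M path_space"
    by (rule measurable_const) (simp add: space_PiM)
  show ?case by simp
next
  case (Suc m)
  note [measurable] = Suc.prems
  show ?case unfolding killed_paths.simps
  proof (rule Suc.IH)
    have "(\<lambda>p. \<integral>\<^sup>+x. indicator {0..} (snd p m + x) * G (fst p) ((snd p)(Suc m := snd p m + x)) \<partial>\<mu> (fst p m))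
       \<in> borel_measurable (env \<Otimes>\<^sub>M path_space)"
      by (rule nn_integral_measurable_subprob_algebra2[where N = borel]) measurable
    then show "(\<lambda>(e, z). \<integral>\<^sup>+x. indicator {0..} (z m + x) * G e (z(Suc m := z m + x)) \<partial>\<mu> (e m))
       \<in> borel_measurable (env \<Otimes>\<^sub>M path_space)" by (simp add: split_beta')
  qed
qed

text \<open>
  The key averaging step. The first \<open>m\<close> steps use the environment before time \<open>m\<close>, and \<open>G\<close> sees
  only the environment from time \<open>m\<close> on, so averaging replaces the step laws by their mean and \<open>G\<close> by
  its expectation, independently of each other.
\<close>

lemma nn_integral_killed_paths:
  assumes "(\<lambda>(e, z). G e z) \<in> borel_measurable (env \<Otimes>\<^sub>M path_space)"
  shows "(\<integral>\<^sup>+e. killed_paths (\<lambda>i. \<mu> (e i)) m (G (\<lambda>i. e (m + i))) \<partial>env) =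
    killed_paths (\<lambda>_. mean_law) m (\<lambda>z. \<integral>\<^sup>+e. G e z \<partial>env)"
  using assms
proof (induction m arbitrary: G)
  case 0 then show ?case by simp
next
  case (Suc m)
  note [measurable] = Suc.prems
  define G' where "G' e z = (\<integral>\<^sup>+x. indicator {0..} (z m + x) * G (\<lambda>i. e (Suc i)) (z(Suc m := z m + x)) \<partial>\<mu> (e 0))" for e z
  have [measurable]: "(\<lambda>(e, z). G' e z) \<in> borel_measurable (env \<Otimes>\<^sub>M path_space)"
  proof -
    have "(\<lambda>p. \<integral>\<^sup>+x. indicator {0..} (snd p m + x) * (\<lambda>(e, z). G e z) (\<lambda>i. fst p (Suc i), (snd p)(Suc m := snd p m + x)) \<partial>\<mu> (fst p 0))
       \<in> borel_measurable (env \<Otimes>\<^sub>M path_space)"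
      by (rule nn_integral_measurable_subprob_algebra2[where N = borel]) measurable
    then show ?thesis by (simp add: split_beta' G'_def)
  qed
  have sec: "(\<lambda>e. G e z) \<in> borel_measurable env" for z
    using measurable_compose[OF measurable_Pair2' Suc.prems] by simp
  have "(\<integral>\<^sup>+e. killed_paths (\<lambda>i. \<mu> (e i)) (Suc m) (G (\<lambda>i. e (Suc m + i))) \<partial>env) =
      (\<integral>\<^sup>+e. killed_paths (\<lambda>i. \<mu> (e i)) m (G' (\<lambda>i. e (m + i))) \<partial>env)"
    by (simp add: G'_def[abs_def])
  also have "\<dots> = killed_paths (\<lambda>_. mean_law) m (\<lambda>z. \<integral>\<^sup>+e. G' e z \<partial>env)"
    by (rule Suc.IH) measurable
  also have "(\<lambda>z. \<integral>\<^sup>+e. G' e z \<partial>env) =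
      (\<lambda>z. \<integral>\<^sup>+x. indicator {0..} (z m + x) * (\<integral>\<^sup>+e. G e (z(Suc m := z m + x)) \<partial>env) \<partial>mean_law)"
  proof
    fix z :: "nat \<Rightarrow> real"
    have [measurable]: "(\<lambda>x. z(Suc m := z m + x)) \<in> borel \<rightarrow>\<^sub>M path_space"
      by (rule measurable_upd) (auto simp: space_PiM)
    have "(\<integral>\<^sup>+e. G' e z \<partial>env) = (\<integral>\<^sup>+x. \<integral>\<^sup>+e. indicator {0..} (z m + x) * G e (z(Suc m := z m + x)) \<partial>env \<partial>mean_law)"
      unfolding G'_def by (rule nn_integral_first_env) measurable
    then show "(\<integral>\<^sup>+e. G' e z \<partial>env) =
        (\<integral>\<^sup>+x. indicator {0..} (z m + x) * (\<integral>\<^sup>+e. G e (z(Suc m := z m + x)) \<partial>env) \<partial>mean_law)"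
      by (simp add: nn_integral_cmult[OF sec])
  qed
  finally show ?case by simp
qed

lemma distr_shift_env: "distr env env (\<lambda>e i. e (k + i)) = env"
  using distr_PiM_reindex[of UNIV "\<lambda>_. P" "\<lambda>i. k + i" UNIV] P.prob_space_axioms
  by (simp add: restrict_UNIV inj_on_def)

lemma AE_env_shift: "AE e in env. R e \<Longrightarrow> AE e in env. R (\<lambda>i. e (k + i))"
  by (rule AE_distrD[OF measurable_shift[of k]]) (subst distr_shift_env)

lemma AE_env_component: "AE s in P. R s \<Longrightarrow> AE e in env. R (e i)"
  by (rule AE_PiM_component) (auto simp: P.prob_space_axioms)

text \<open>
  At integer points finiteness holds almost surely because the mean is finite; monotonicity in \<open>y\<close>
  extends it to all \<open>y\<close> at once, and shift invariance to all times.
\<close>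

lemma AE_harmonic_good:
  assumes walk: "centred_walk mean_law" and pos: "AE s in P. 0 < emeasure (\<mu> s) {0<..}"
  shows "AE e in env. \<forall>j. \<forall>y\<ge>0. 0 < harmonic (\<lambda>i. \<mu> (e (j + i))) y \<and> harmonic (\<lambda>i. \<mu> (e (j + i))) y < \<infinity>"
proof -
  interpret W: centred_walk mean_law by (rule walk)
  have "AE e in env. harmonic (\<lambda>i. \<mu> (e i)) (real k) \<noteq> \<infinity>" for k
  proof (rule nn_integral_noteq_infinite)
    show "(\<lambda>e. harmonic (\<lambda>i. \<mu> (e i)) (real k)) \<in> borel_measurable env" by measurable
    show "(\<integral>\<^sup>+e. harmonic (\<lambda>i. \<mu> (e i)) (real k) \<partial>env) \<noteq> \<infinity>"
      using W.h_finite[of "real k"] by (simp add: nn_integral_harmonic)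
  qed
  then have fin: "AE e in env. \<forall>k. harmonic (\<lambda>i. \<mu> (e i)) (real k) \<noteq> \<infinity>"
    by (simp add: AE_all_countable)
  have "AE e in env. \<forall>y\<ge>0. 0 < harmonic (\<lambda>i. \<mu> (e i)) y \<and> harmonic (\<lambda>i. \<mu> (e i)) y < \<infinity>"
    using fin AE_env_component[OF pos, of 0] AE_space
  proof eventually_elim
    case (elim e)
    show ?case
    proof (intro allI impI conjI)
      fix y :: real assume "0 \<le> y"
      then show "0 < harmonic (\<lambda>i. \<mu> (e i)) y"
        using elim centredD(1)[OF centred_env] by (intro harmonic_pos) auto
      obtain k where "y \<le> real k" using real_arch_simple by blast
      then have "harmonic (\<lambda>i. \<mu> (e i)) y \<le> harmonic (\<lambda>i. \<mu> (e i)) (real k)" by (rule harmonic_mono)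
      then show "harmonic (\<lambda>i. \<mu> (e i)) y < \<infinity>" using elim(1) by (auto simp: less_top intro: le_less_trans)
    qed
  qed
  then show ?thesis by (subst AE_all_countable) (intro allI AE_env_shift)
qed

end

section \<open>The conditioned chain in a fixed environment\<close>

text \<open>
  A chain whose one-step law is a walk step, killed below zero and reweighted by \<open>U\<close>. The formula
  for the kernel concerns nonnegative states, where the chain lives (\<open>AE_nonneg\<close>).
\<close>

locale conditioned_chain =
  fixes \<kappa> :: "nat \<Rightarrow> real measure" and U :: "nat \<Rightarrow> real \<Rightarrow> ennreal"
    and K :: "nat \<Rightarrow> real \<Rightarrow> real measure" and Q :: "(nat \<Rightarrow> real) measure"
  assumes real_law: "\<And>i. real_law (\<kappa> i)"
    and measurable_U [measurable]: "\<And>j. U j \<in> borel_measurable borel"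
    and U_pos: "\<And>j y. 0 \<le> y \<Longrightarrow> 0 < U j y" and U_finite: "\<And>j y. 0 \<le> y \<Longrightarrow> U j y < \<infinity>"
    and kernel: "\<And>j x B. 0 \<le> x \<Longrightarrow> B \<in> sets borel \<Longrightarrow> emeasure (K (Suc j) x) B =
      (\<integral>\<^sup>+t. indicator B (x + t) * (indicator {0..} (x + t) * U (Suc j) (x + t) / U j x) \<partial>\<kappa> j)"
    and chain: "markov_chain_law K 0 Q"
begin

sublocale Q: prob_space Q using chain by (simp add: markov_chain_law_def)

lemma sets_Q [simp, measurable_cong]: "sets Q = sets path_space"
  using chain by (simp add: markov_chain_law_def)

lemma space_Q [simp]: "space Q = UNIV"
  using sets_eq_imp_space_eq[OF sets_Q] by simp

lemma chain_step:
  assumes "C \<in> sets (PiM {..<Suc m} (\<lambda>_. borel))" "B \<in> sets borel"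
  shows "emeasure Q {z. restrict z {..<Suc m} \<in> C \<and> z (Suc m) \<in> B} =
    (\<integral>\<^sup>+z. indicator C (restrict z {..<Suc m}) * emeasure (K (Suc m) (z m)) B \<partial>Q)"
proof -
  have "\<forall>j\<ge>1. \<forall>C\<in>sets (PiM {..<j} (\<lambda>_. borel)). \<forall>B\<in>sets borel.
        emeasure Q {z \<in> space Q. restrict z {..<j} \<in> C \<and> z j \<in> B} =
        (\<integral>\<^sup>+z. indicator C (restrict z {..<j}) * emeasure (K j (z (j - 1))) B \<partial>Q)"
    using chain unfolding markov_chain_law_def by blast
  from this[rule_format, of "Suc m" C B] show ?thesis using assms by simp
qed

lemma AE_nonneg: "AE z in Q. 0 \<le> z m"
proof (induction m)
  case 0
  have "AE z in Q. z 0 = 0" using chain by (simp add: markov_chain_law_def)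
  then show ?case by eventually_elim simp
next
  case (Suc m)
  have meas: "{z. z (Suc m) < 0} \<in> sets path_space" by (rule path_setI) measurable
  have restr: "restrict z {..<Suc m} \<in> space (PiM {..<Suc m} (\<lambda>_. borel))" for z :: "nat \<Rightarrow> real"
    by (simp add: space_PiM)
  have "emeasure Q {z. z (Suc m) < 0} =
      emeasure Q {z. restrict z {..<Suc m} \<in> space (PiM {..<Suc m} (\<lambda>_. borel)) \<and> z (Suc m) \<in> {..<0}}"
    using restr by simp
  also have "\<dots> = (\<integral>\<^sup>+z. emeasure (K (Suc m) (z m)) {..<0} \<partial>Q)"
    by (subst chain_step) (auto simp: restr)
  also have "\<dots> = (\<integral>\<^sup>+z. 0 \<partial>Q)"
  proof (rule nn_integral_cong_AE, use Suc in eventually_elim)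
    fix z :: "nat \<Rightarrow> real" assume "0 \<le> z m"
    then show "emeasure (K (Suc m) (z m)) {..<0} = 0"
      by (subst kernel) (auto intro!: nn_integral_zero' simp: indicator_def)
  qed
  finally have "emeasure Q {z. z (Suc m) < 0} = 0" by simp
  then show ?case
    using meas by (intro AE_I[of _ _ "{z. z (Suc m) < 0}"]) auto
qed

definition weight :: "nat \<Rightarrow> (nat \<Rightarrow> real) \<Rightarrow> real \<Rightarrow> ennreal" where
  "weight m z t = indicator {0..} (z m + t) * U (Suc m) (z m + t) / U m (z m)"

text \<open>
  The Markov property is given for rectangles. Both sides are integrals of \<open>F\<close> against finite
  measures on path space, which agree on cylinders and are therefore equal.
\<close>

lemma cutoff_step:
  assumes F [measurable]: "F \<in> borel_measurable path_space"
  shows "(\<integral>\<^sup>+z. F (cutoff (Suc m) z) \<partial>Q) =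
    (\<integral>\<^sup>+z. \<integral>\<^sup>+t. weight m z t * F ((cutoff m z)(Suc m := z m + t)) \<partial>\<kappa> m \<partial>Q)"
proof -
  interpret k: prob_space "\<kappa> m" by (rule real_lawD(1)[OF real_law])
  note [measurable_cong] = real_lawD(2)[OF real_law[of m]]
  have [measurable]: "(\<lambda>(z, t). weight m z t) \<in> borel_measurable (Q \<Otimes>\<^sub>M \<kappa> m)"
    unfolding weight_def by measurable
  define N1 where "N1 = distr Q path_space (cutoff (Suc m))"
  \<comment> \<open>\<open>N1\<close> is the law of the chain up to time \<open>m + 1\<close>; \<open>N2\<close> performs the last step by the kernel.\<close>
  define g where "g = (\<lambda>(z, t). (cutoff m z)(Suc m := z m + t))"
  have g [measurable]: "g \<in> Q \<Otimes>\<^sub>M \<kappa> m \<rightarrow>\<^sub>M path_space" unfolding g_def by measurable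
  define N2 where "N2 = distr (density (Q \<Otimes>\<^sub>M \<kappa> m) (\<lambda>(z, t). weight m z t)) path_space g"
  have int2: "(\<integral>\<^sup>+z. G z \<partial>N2) =
     (\<integral>\<^sup>+z. \<integral>\<^sup>+t. weight m z t * G ((cutoff m z)(Suc m := z m + t)) \<partial>\<kappa> m \<partial>Q)"
    if [measurable]: "G \<in> borel_measurable path_space" for G
  proof -
    have "(\<integral>\<^sup>+z. G z \<partial>N2) = (\<integral>\<^sup>+p. G (g p) \<partial>density (Q \<Otimes>\<^sub>M \<kappa> m) (\<lambda>(z, t). weight m z t))"
      unfolding N2_def by (rule nn_integral_distr) (auto simp: measurable_density_eq1)
    also have "\<dots> = (\<integral>\<^sup>+p. (\<lambda>(z, t). weight m z t) p * G (g p) \<partial>(Q \<Otimes>\<^sub>M \<kappa> m))"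
      by (rule nn_integral_density) measurable
    also have "\<dots> = (\<integral>\<^sup>+z. \<integral>\<^sup>+t. weight m z t * G (g (z, t)) \<partial>\<kappa> m \<partial>Q)"
      by (subst k.nn_integral_fst[symmetric]) auto
    finally show ?thesis by (simp add: g_def)
  qed
  have "N1 = N2"
  proof (rule measure_eqI_PiM_infinite)
    show "sets N1 = sets path_space" "sets N2 = sets path_space" by (simp_all add: N1_def N2_def)
    show "finite_measure N1"
      unfolding N1_def by (intro prob_space.finite_measure Q.prob_space_distr) measurable
    fix A and J :: "nat set" assume J: "finite J" "\<And>i. i \<in> J \<Longrightarrow> A i \<in> sets (borel :: real measure)"
    let ?D = "prod_emb UNIV (\<lambda>_. borel) J (Pi\<^sub>E J A)"
    have D [measurable]: "?D \<in> sets path_space" using J by (intro sets_PiM_I) auto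
    have D_iff: "z \<in> ?D \<longleftrightarrow> (\<forall>i\<in>J. z i \<in> A i)" for z
      by (auto simp: prod_emb_def PiE_iff restrict_def extensional_def)
    define B where "B = (if Suc m \<in> J then A (Suc m) else UNIV)"
    have B [measurable]: "B \<in> sets borel" using J by (simp add: B_def)
    define C where "C = {r \<in> space (PiM {..<Suc m} (\<lambda>_. borel :: real measure)).
        (\<forall>i\<in>J \<inter> {..<Suc m}. r i \<in> A i) \<and> (\<forall>i\<in>J - {..Suc m}. 0 \<in> A i)}"
    have C: "C \<in> sets (PiM {..<Suc m} (\<lambda>_. borel))"
    proof -
      have "C = {r \<in> space (PiM {..<Suc m} (\<lambda>_. borel :: real measure)). (\<forall>i\<in>J \<inter> {..<Suc m}. r i \<in> A i)} \<inter>
          {r \<in> space (PiM {..<Suc m} (\<lambda>_. borel :: real measure)). (\<forall>i\<in>J - {..Suc m}. 0 \<in> A i)}"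
        by (auto simp: C_def)
      also have "\<dots> \<in> sets (PiM {..<Suc m} (\<lambda>_. borel))"
        using J by (intro sets.Int sets.sets_Collect_finite_All sets_Collect_single' sets.sets_Collect_const) auto
      finally show ?thesis .
    qed
    have restrict_C: "restrict z {..<Suc m} \<in> C \<longleftrightarrow> (\<forall>i\<in>J \<inter> {..<Suc m}. z i \<in> A i) \<and> (\<forall>i\<in>J - {..Suc m}. 0 \<in> A i)" for z
      by (auto simp: C_def space_PiM)
    have trich: "(\<forall>i\<in>J. R i) \<longleftrightarrow>
        (\<forall>i\<in>J \<inter> {..<Suc m}. R i) \<and> (\<forall>i\<in>J - {..Suc m}. R i) \<and> (Suc m \<in> J \<longrightarrow> R (Suc m))" for R
    proof -
      have "R i" if "\<forall>i\<in>J \<inter> {..<Suc m}. R i" "\<forall>i\<in>J - {..Suc m}. R i" "Suc m \<in> J \<longrightarrow> R (Suc m)" "i \<in> J" for i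
        using that by (cases i "Suc m" rule: linorder_cases) auto
      then show ?thesis by blast
    qed
    have upd: "(cutoff m z)(Suc m := y) \<in> ?D \<longleftrightarrow> restrict z {..<Suc m} \<in> C \<and> y \<in> B" for z y
    proof -
      have "(\<forall>i\<in>J. ((cutoff m z)(Suc m := y)) i \<in> A i) \<longleftrightarrow>
         (\<forall>i\<in>J \<inter> {..<Suc m}. ((cutoff m z)(Suc m := y)) i \<in> A i) \<and>
         (\<forall>i\<in>J - {..Suc m}. ((cutoff m z)(Suc m := y)) i \<in> A i) \<and> (Suc m \<in> J \<longrightarrow> y \<in> A (Suc m))"
        using trich[of "\<lambda>i. ((cutoff m z)(Suc m := y)) i \<in> A i"] by simp
      also have "\<dots> \<longleftrightarrow> restrict z {..<Suc m} \<in> C \<and> y \<in> B"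
        unfolding restrict_C by (auto simp: cutoff_def B_def)
      finally show ?thesis unfolding D_iff .
    qed
    have "emeasure N1 ?D = emeasure Q (cutoff (Suc m) -` ?D \<inter> space Q)"
      unfolding N1_def by (rule emeasure_distr) (auto simp: D)
    also have "cutoff (Suc m) -` ?D \<inter> space Q = {z. restrict z {..<Suc m} \<in> C \<and> z (Suc m) \<in> B}"
      by (auto simp: cutoff_Suc upd)
    also have "emeasure Q \<dots> = (\<integral>\<^sup>+z. indicator C (restrict z {..<Suc m}) * emeasure (K (Suc m) (z m)) B \<partial>Q)"
      by (rule chain_step[OF C B])
    also have "\<dots> = (\<integral>\<^sup>+z. \<integral>\<^sup>+t. weight m z t * indicator ?D ((cutoff m z)(Suc m := z m + t)) \<partial>\<kappa> m \<partial>Q)"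
    proof (rule nn_integral_cong_AE, use AE_nonneg[of m] in eventually_elim)
      fix z :: "nat \<Rightarrow> real" assume z: "0 \<le> z m"
      have "indicator C (restrict z {..<Suc m}) * emeasure (K (Suc m) (z m)) B =
          (\<integral>\<^sup>+t. indicator C (restrict z {..<Suc m}) * (indicator B (z m + t) * weight m z t) \<partial>\<kappa> m)"
        unfolding kernel[OF z B] weight_def by (rule nn_integral_cmult[symmetric]) measurable
      also have "\<dots> = (\<integral>\<^sup>+t. weight m z t * indicator ?D ((cutoff m z)(Suc m := z m + t)) \<partial>\<kappa> m)"
        by (intro nn_integral_cong) (auto simp: upd split: split_indicator)
      finally show "indicator C (restrict z {..<Suc m}) * emeasure (K (Suc m) (z m)) B = \<dots>" .
    qed
    also have "\<dots> = (\<integral>\<^sup>+z. indicator ?D z \<partial>N2)" by (rule int2[symmetric]) measurable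
    also have "\<dots> = emeasure N2 ?D" using D by (simp add: N2_def)
    finally show "emeasure N1 ?D = emeasure N2 ?D" .
  qed
  have "(\<integral>\<^sup>+z. F (cutoff (Suc m) z) \<partial>Q) = (\<integral>\<^sup>+z. F z \<partial>N1)"
    unfolding N1_def by (rule nn_integral_distr[symmetric]) auto
  also have "\<dots> = (\<integral>\<^sup>+z. F z \<partial>N2)" using \<open>N1 = N2\<close> by simp
  also have "\<dots> = (\<integral>\<^sup>+z. \<integral>\<^sup>+t. weight m z t * F ((cutoff m z)(Suc m := z m + t)) \<partial>\<kappa> m \<partial>Q)"
    by (rule int2) measurable
  finally show ?thesis .
qed

text \<open>
  The weights \<open>U (j + 1) / U j\<close> along the path telescope: the density of the chain with respect to
  the killed walk is \<open>U m (z m) / U 0 0\<close>.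
\<close>

lemma chain_law:
  assumes "F \<in> borel_measurable path_space"
  shows "U 0 0 * (\<integral>\<^sup>+z. F (cutoff m z) \<partial>Q) = killed_paths \<kappa> m (\<lambda>z. F z * U m (z m))"
  using assms
proof (induction m arbitrary: F)
  case 0
  have "AE z in Q. z 0 = 0" using chain by (simp add: markov_chain_law_def)
  then have "(\<integral>\<^sup>+z. F (cutoff 0 z) \<partial>Q) = (\<integral>\<^sup>+z. F (\<lambda>_. 0) \<partial>Q)"
    by (intro nn_integral_cong_AE, eventually_elim) (auto intro!: arg_cong[where f = F] simp: cutoff_def)
  then show ?case by (simp add: Q.emeasure_space_1[simplified] mult.commute)
next
  case (Suc m)
  interpret k: prob_space "\<kappa> m" by (rule real_lawD(1)[OF real_law])
  note [measurable_cong] = real_lawD(2)[OF real_law[of m]]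
  note [measurable] = Suc.prems
  define \<Phi> where "\<Phi> z = (\<integral>\<^sup>+t. weight m z t * F (z(Suc m := z m + t)) \<partial>\<kappa> m)" for z
  have [measurable]: "\<Phi> \<in> borel_measurable path_space"
    unfolding \<Phi>_def weight_def by measurable
  have "(\<integral>\<^sup>+z. F (cutoff (Suc m) z) \<partial>Q) = (\<integral>\<^sup>+z. \<Phi> (cutoff m z) \<partial>Q)"
    by (subst cutoff_step[OF Suc.prems]) (simp add: \<Phi>_def weight_def cutoff_def[of m, THEN fun_cong, of _ m])
  then have "U 0 0 * (\<integral>\<^sup>+z. F (cutoff (Suc m) z) \<partial>Q) = killed_paths \<kappa> m (\<lambda>z. \<Phi> z * U m (z m))"
    by (simp add: Suc.IH)
  also have "\<dots> = killed_paths \<kappa> (Suc m) (\<lambda>z. F z * U (Suc m) (z (Suc m)))"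
    unfolding killed_paths.simps
  proof (rule killed_paths_cong)
    fix z :: "nat \<Rightarrow> real" assume z: "\<And>i. 0 \<le> z i"
    have [measurable]: "(\<lambda>t. z(Suc m := z m + t)) \<in> borel \<rightarrow>\<^sub>M path_space"
      by (rule measurable_upd) auto
    have cancel: "a / U m (z m) * b * U m (z m) = a * b" for a b
      using U_pos[OF z[of m], of m] U_finite[OF z[of m], of m]
      by (simp add: mult.assoc ennreal_divide_times ennreal_mult_divide_eq)
    have "\<Phi> z * U m (z m) = (\<integral>\<^sup>+t. weight m z t * F (z(Suc m := z m + t)) * U m (z m) \<partial>\<kappa> m)"
      unfolding \<Phi>_def weight_def by (rule nn_integral_multc[symmetric]) measurable
    also have "\<dots> = (\<integral>\<^sup>+t. indicator {0..} (z m + t) *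
        (F (z(Suc m := z m + t)) * U (Suc m) ((z(Suc m := z m + t)) (Suc m))) \<partial>\<kappa> m)"
    proof (rule nn_integral_cong)
      fix t
      have "weight m z t * F (z(Suc m := z m + t)) * U m (z m) =
          indicator {0..} (z m + t) * U (Suc m) (z m + t) * F (z(Suc m := z m + t))"
        unfolding weight_def by (rule cancel)
      then show "weight m z t * F (z(Suc m := z m + t)) * U m (z m) = indicator {0..} (z m + t) *
        (F (z(Suc m := z m + t)) * U (Suc m) ((z(Suc m := z m + t)) (Suc m)))"
        by (simp add: mult_ac)
    qed
    finally show "\<Phi> z * U m (z m) = \<dots>" .
  qed
  finally show ?case .
qed

end

section \<open>The quenched harmonic function and kernel\<close>

lemma measurable_translate_psum [measurable]: "(\<lambda>X n. a + psum X n) \<in> path_space \<rightarrow>\<^sub>M path_space"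
  by (rule measurable_PiM_single') (auto simp: space_PiM)

lemma random_walk_law_eq:
  assumes "\<And>i. real_law (\<kappa> (Suc i))"
  shows "random_walk_law \<kappa> a = distr (PiM UNIV (\<lambda>i. \<kappa> (Suc i))) path_space (\<lambda>X n. a + psum X n)"
proof -
  note [measurable_cong] = sets_PiM_real_law[of "\<lambda>i. \<kappa> (Suc i)", OF assms]
  have eq: "(\<Pi>\<^sub>M i\<in>{1..}. \<kappa> (Suc (i - 1))) = PiM {1..} \<kappa>"
    by (rule PiM_cong) auto
  have "distr (PiM UNIV (\<lambda>i. \<kappa> (Suc i))) (\<Pi>\<^sub>M i\<in>{1..}. \<kappa> (Suc (i - 1)))
      (\<lambda>\<omega>. \<lambda>n\<in>{1..}. \<omega> (n - 1)) = (\<Pi>\<^sub>M i\<in>{1..}. \<kappa> (Suc (i - 1)))"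
    by (rule distr_PiM_reindex) (use assms real_lawD in \<open>auto simp: inj_on_def\<close>)
  then have D: "PiM {1..} \<kappa> = distr (PiM UNIV (\<lambda>i. \<kappa> (Suc i))) (PiM {1..} \<kappa>) (\<lambda>\<omega>. \<lambda>n\<in>{1..}. \<omega> (n - 1))"
    unfolding eq by simp
  have sets: "sets (PiM {1..} \<kappa>) = sets (PiM {1..} (\<lambda>_. borel))"
  proof (rule sets_PiM_cong)
    fix i :: nat assume "i \<in> {1..}"
    then show "sets (\<kappa> i) = sets borel" using real_lawD(2)[OF assms[of "i - 1"]] by simp
  qed simp
  have m1: "(\<lambda>X n. a + (\<Sum>i=1..n. X i)) \<in> PiM {1..} \<kappa> \<rightarrow>\<^sub>M path_space"
    unfolding measurable_cong_sets[OF sets refl]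
    by (rule measurable_PiM_single') (auto simp: space_PiM)
  have m2: "(\<lambda>\<omega>. \<lambda>n\<in>{1..}. \<omega> (n - 1)) \<in> PiM UNIV (\<lambda>i. \<kappa> (Suc i)) \<rightarrow>\<^sub>M PiM {1..} \<kappa>"
    unfolding measurable_cong_sets[OF refl sets]
    by (rule measurable_restrict) measurable
  have s: "(\<Sum>i=1..n. (\<lambda>n\<in>{1..}. X (n - 1)) i) = psum X n" for X :: "nat \<Rightarrow> real" and n
    by (induction n) (auto simp: psum_Suc)
  have "random_walk_law \<kappa> a = distr (distr (PiM UNIV (\<lambda>i. \<kappa> (Suc i))) (PiM {1..} \<kappa>) (\<lambda>\<omega>. \<lambda>n\<in>{1..}. \<omega> (n - 1)))
      path_space (\<lambda>X n. a + (\<Sum>i=1..n. X i))"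
    unfolding random_walk_law_def using D by simp
  also have "\<dots> = distr (PiM UNIV (\<lambda>i. \<kappa> (Suc i))) path_space (\<lambda>X n. a + psum X n)"
    by (subst distr_distr[OF m1 m2]) (simp only: comp_def s)
  finally show ?thesis .
qed

lemma exit_time_greater_iff: "enat n < exit_time y S \<longleftrightarrow> (\<forall>i\<in>{1..n}. 0 \<le> y + S i)"
proof -
  let ?A = "{n. n \<ge> 1 \<and> y + S n < 0}"
  have "enat n < Inf (enat ` ?A) \<longleftrightarrow> (\<forall>a\<in>?A. n < a)"
  proof
    assume "enat n < Inf (enat ` ?A)"
    then show "\<forall>a\<in>?A. n < a"
      using Inf_lower[of _ "enat ` ?A"] by (metis (mono_tags, lifting) enat_ord_simps(2) imageI less_le_trans)
  next
    assume R: "\<forall>a\<in>?A. n < a"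
    show "enat n < Inf (enat ` ?A)"
    proof (cases "Inf (enat ` ?A)")
      case (enat k)
      then have "k \<in> ?A" using Inf_enat_eq_iff[of ?A k] by blast
      then show ?thesis using R enat by simp
    qed simp
  qed
  then show ?thesis unfolding exit_time_def by (auto simp: not_less[symmetric])
qed

text \<open>
  Wherever the limit is finite, \<^const>\<open>harmonic_U\<close> is the limit of an increasing sequence of
  \<^const>\<open>killed_mean\<close> values.
\<close>

lemma harmonic_U_eq:
  assumes centred: "\<And>i. centred (step_law (L (e (Suc i))))" and y: "0 \<le> y"
    and finite: "harmonic (\<lambda>i. step_law (L (e (Suc i)))) y < \<infinity>"
  shows "harmonic_U L e y = enn2real (harmonic (\<lambda>i. step_law (L (e (Suc i)))) y)"
proof -
  define \<kappa> where "\<kappa> i = step_law (L (e (Suc i)))" for i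
  have law: "real_law (\<kappa> i)" for i unfolding \<kappa>_def by (rule centredD(1)[OF centred])
  note [measurable_cong] = sets_PiM_real_law[of \<kappa>, OF law]
  have W: "quenched_walk L e 0 = distr (PiM UNIV \<kappa>) path_space (\<lambda>X n. 0 + psum X n)"
    unfolding quenched_walk_def \<kappa>_def
    by (rule random_walk_law_eq) (rule centredD(1)[OF centred])
  have [measurable]: "{S. enat n < exit_time y S} \<in> sets path_space" for n
    unfolding exit_time_greater_iff by (rule path_setI) measurable
  have "(\<integral>S. (y + S n) * indicator {S. exit_time y S > enat n} S \<partial>(quenched_walk L e 0)) =
      enn2real (killed_mean \<kappa> n y)" for n
  proof -
    have ind: "(\<Prod>i\<in>{1..n}. indicator {0..} (y + psum X i)) =
        (indicator {S. enat n < exit_time y S} (psum X) :: ennreal)" for X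
      unfolding exit_time_greater_iff
      by (induction n) (auto simp: atLeastAtMostSuc_conv split: split_indicator)
    have pos: "0 \<le> (y + psum X n) * indicator {S. enat n < exit_time y S} (psum X)" for X
      using y by (cases n) (auto simp: exit_time_greater_iff split: split_indicator)
    have "(\<integral>S. (y + S n) * indicator {S. exit_time y S > enat n} S \<partial>(quenched_walk L e 0)) =
        (\<integral>X. (y + psum X n) * indicator {S. enat n < exit_time y S} (psum X) \<partial>PiM UNIV \<kappa>)"
      unfolding W by (subst integral_distr) auto
    also have "\<dots> = enn2real (\<integral>\<^sup>+X. ennreal ((y + psum X n) * indicator {S. enat n < exit_time y S} (psum X)) \<partial>PiM UNIV \<kappa>)"
      by (rule integral_eq_nn_integral) (auto simp: pos)
    also have "(\<integral>\<^sup>+X. ennreal ((y + psum X n) * indicator {S. enat n < exit_time y S} (psum X)) \<partial>PiM UNIV \<kappa>) =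
        killed_mean \<kappa> n y"
      unfolding killed_mean_eq_walk[OF law] ind
      by (intro nn_integral_cong) (auto split: split_indicator)
    finally show ?thesis .
  qed
  then have "harmonic_U L e y = lim (\<lambda>n. enn2real (killed_mean \<kappa> n y))"
    unfolding harmonic_U_def by simp
  also have "\<dots> = enn2real (harmonic \<kappa> y)"
  proof (rule limI)
    have "(\<lambda>n. killed_mean \<kappa> n y) \<longlonglongrightarrow> harmonic \<kappa> y"
      unfolding harmonic_def using incseq_killed_mean[of \<kappa> y] centred y
      by (intro LIMSEQ_SUP) (simp add: \<kappa>_def)
    then show "(\<lambda>n. enn2real (killed_mean \<kappa> n y)) \<longlonglongrightarrow> enn2real (harmonic \<kappa> y)"
      using finite by (intro tendsto_enn2real) (auto simp: \<kappa>_def[abs_def] intro!: enn2real_nonneg)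
  qed
  finally show ?thesis by (simp add: \<kappa>_def[abs_def])
qed

lemma env_shift_funpow: "(env_shift ^^ m) e = (\<lambda>n. e (n + m))"
  by (induction m) (simp_all add: env_shift_def)

text \<open>
  The kernel of the conditioned walk in the form required by \<^locale>\<open>conditioned_chain\<close>, with the
  walk starting from \<open>x\<close> written as \<open>x\<close> plus a step.
\<close>

lemma emeasure_conditioned_kernel:
  fixes L e
  defines "\<kappa> \<equiv> \<lambda>i. step_law (L (e (Suc i)))"
  defines "U \<equiv> \<lambda>j. harmonic (\<lambda>i. \<kappa> (j + i))"
  assumes centred: "\<And>i. centred (\<kappa> i)"
    and pos: "\<And>j y. 0 \<le> y \<Longrightarrow> 0 < U j y" and fin: "\<And>j y. 0 \<le> y \<Longrightarrow> U j y < \<infinity>"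
    and x: "0 \<le> x" and B [measurable]: "B \<in> sets borel"
  shows "emeasure (conditioned_kernel L e (Suc j) x) B =
    (\<integral>\<^sup>+t. indicator B (x + t) * (indicator {0..} (x + t) * U (Suc j) (x + t) / U j x) \<partial>\<kappa> j)"
proof -
  have law: "real_law (\<kappa> i)" for i by (rule centredD(1)[OF centred])
  note [measurable_cong] = sets_PiM_real_law[of "\<lambda>i. \<kappa> (j + i)", OF law] real_lawD(2)[OF law[of j]]
  have [measurable]: "U i \<in> borel_measurable borel" for i
    unfolding U_def by (intro measurable_harmonic law)
  have hU: "harmonic_U L ((env_shift ^^ i) e) y = enn2real (U i y)" if "0 \<le> y" for i y
    unfolding env_shift_funpow
    using harmonic_U_eq[of L "\<lambda>n. e (n + i)" y] that centred fin[of y i]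
    by (simp add: \<kappa>_def U_def add.commute)
  have W: "distr (quenched_walk L ((env_shift ^^ j) e) x) borel (\<lambda>S. S 1) = distr (\<kappa> j) borel (\<lambda>t. x + t)"
  proof -
    have "quenched_walk L ((env_shift ^^ j) e) x = distr (PiM UNIV (\<lambda>i. \<kappa> (j + i))) path_space (\<lambda>X n. x + psum X n)"
      unfolding quenched_walk_def env_shift_funpow
      using random_walk_law_eq[of "\<lambda>n. step_law (L (e (n + j)))" x] law by (simp add: \<kappa>_def add.commute)
    then have "distr (quenched_walk L ((env_shift ^^ j) e) x) borel (\<lambda>S. S 1) =
        distr (PiM UNIV (\<lambda>i. \<kappa> (j + i))) borel (\<lambda>X. x + X 0)"
      by (simp add: distr_distr comp_def psum_Suc)
    also have "\<dots> = distr (distr (PiM UNIV (\<lambda>i. \<kappa> (j + i))) (\<kappa> (j + 0)) (\<lambda>X. X 0)) borel (\<lambda>t. x + t)"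
      by (subst distr_distr) (auto simp: comp_def)
    also have "distr (PiM UNIV (\<lambda>i. \<kappa> (j + i))) (\<kappa> (j + 0)) (\<lambda>X. X 0) = \<kappa> (j + 0)"
      by (rule distr_PiM_component) (auto intro: real_lawD(1)[OF law])
    finally show ?thesis by simp
  qed
  have dens: "(\<lambda>y. ennreal (harmonic_U L ((env_shift ^^ Suc j) e) y * indicator {0..} y /
        harmonic_U L ((env_shift ^^ j) e) x)) = (\<lambda>y. indicator {0..} y * U (Suc j) y / U j x)"
  proof
    fix y :: real
    obtain r where r: "U j x = ennreal r" "0 < r"
      using pos[OF x, of j] fin[OF x, of j] by (cases "U j x") auto
    show "ennreal (harmonic_U L ((env_shift ^^ Suc j) e) y * indicator {0..} y / harmonic_U L ((env_shift ^^ j) e) x) =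
        indicator {0..} y * U (Suc j) y / U j x"
    proof (cases "0 \<le> y")
      case True
      then obtain s where s: "U (Suc j) y = ennreal s" "0 \<le> s"
        using fin[of y "Suc j"] by (cases "U (Suc j) y") auto
      show ?thesis using r s True x
        by (simp only: hU) (simp add: divide_ennreal)
    qed simp
  qed
  have "emeasure (conditioned_kernel L e (Suc j) x) B =
      (\<integral>\<^sup>+y. (indicator {0..} y * U (Suc j) y / U j x) * indicator B y \<partial>distr (\<kappa> j) borel (\<lambda>t. x + t))"
    unfolding conditioned_kernel_def diff_Suc_1 W dens by (rule emeasure_density) measurable
  also have "\<dots> = (\<integral>\<^sup>+t. (indicator {0..} (x + t) * U (Suc j) (x + t) / U j x) * indicator B (x + t) \<partial>\<kappa> j)"
    by (rule nn_integral_distr) measurable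
  finally show ?thesis by (simp add: mult.commute)
qed

section \<open>Step laws of point processes\<close>

lemma space_configuration_space: "space configuration_space = point_configurations"
  unfolding configuration_space_def by (auto simp: space_Sup_eq_UN)

lemma sets_configuration: "N \<in> space configuration_space \<Longrightarrow> sets N = sets borel"
  by (simp add: space_configuration_space point_configurations_def)

lemma measurable_emeasure_configuration:
  "B \<in> sets borel \<Longrightarrow> (\<lambda>N. emeasure N B) \<in> borel_measurable configuration_space"
  unfolding configuration_space_def
  by (rule measurable_SUP1[of B]) (auto intro: measurable_vimage_algebra1)

lemma measurable_atom_sum:
  assumes "g \<in> borel_measurable borel"
  shows "(\<lambda>N. atom_sum N g) \<in> borel_measurable configuration_space"
  unfolding atom_sum_def using assms
proof induction
  case (cong f g)
  have "(\<integral>\<^sup>+x. f x \<partial>N) = (\<integral>\<^sup>+x. g x \<partial>N)" for N :: "real measure"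
    using cong(3) by (intro nn_integral_cong) simp
  with cong show ?case by simp
next
  case (set B)
  have "(\<integral>\<^sup>+x. indicator B x \<partial>N) = emeasure N B" if "N \<in> space configuration_space" for N
    using set sets_configuration[OF that] by (simp add: nn_integral_indicator)
  then show ?case
    using measurable_emeasure_configuration[OF set] by (simp cong: measurable_cong)
next
  case (mult u c)
  have "(\<integral>\<^sup>+x. c * u x \<partial>N) = c * (\<integral>\<^sup>+x. u x \<partial>N)" if "N \<in> space configuration_space" for N
    using mult(2) by (intro nn_integral_cmult) (simp cong: measurable_cong_sets add: sets_configuration[OF that])
  then show ?case using mult by (simp cong: measurable_cong)
next
  case (add u v)
  have "(\<integral>\<^sup>+x. v x + u x \<partial>N) = (\<integral>\<^sup>+x. v x \<partial>N) + (\<integral>\<^sup>+x. u x \<partial>N)" if "N \<in> space configuration_space" for N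
    using add by (intro nn_integral_add) (simp_all cong: measurable_cong_sets add: sets_configuration[OF that])
  then show ?case using add by (simp cong: measurable_cong)
next
  case (seq V)
  have "(\<integral>\<^sup>+x. (SUP i. V i) x \<partial>N) = (SUP i. \<integral>\<^sup>+x. V i x \<partial>N)" if "N \<in> space configuration_space" for N
    unfolding SUP_apply using seq
    by (intro nn_integral_monotone_convergence_SUP) (simp_all cong: measurable_cong_sets add: sets_configuration[OF that])
  then show ?case using seq by (simp cong: measurable_cong)
qed

lemma measurable_expected_atom_sum:
  assumes "g \<in> borel_measurable borel"
  shows "(\<lambda>\<Lambda>. expected_atom_sum \<Lambda> g) \<in> borel_measurable (prob_algebra configuration_space)"
  unfolding expected_atom_sum_def prob_algebra_def
  by (intro measurable_restrict_space1 nn_integral_measurable_subprob_algebra measurable_atom_sum assms)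

context
  fixes \<Lambda> :: "real measure measure"
  assumes \<Lambda>: "\<Lambda> \<in> space (prob_algebra configuration_space)"
begin

lemma sets_\<Lambda>: "sets \<Lambda> = sets configuration_space" and space_\<Lambda>: "space \<Lambda> = space configuration_space"
  and prob_space_\<Lambda>: "prob_space \<Lambda>"
  using \<Lambda> by (auto simp: space_prob_algebra dest: sets_eq_imp_space_eq)

lemma measurable_atom_sum_\<Lambda>: "g \<in> borel_measurable borel \<Longrightarrow> (\<lambda>N. atom_sum N g) \<in> borel_measurable \<Lambda>"
  using measurable_atom_sum by (simp cong: measurable_cong_sets add: sets_\<Lambda>)

lemma borel_measurable_atoms:
  assumes "N \<in> space \<Lambda>" "g \<in> borel_measurable borel"
  shows "g \<in> borel_measurable N"
  using assms sets_configuration by (simp cong: measurable_cong_sets add: space_\<Lambda>)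

lemma expected_atom_sum_suminf:
  assumes "\<And>i. g i \<in> borel_measurable borel"
  shows "expected_atom_sum \<Lambda> (\<lambda>x. \<Sum>i. g i x) = (\<Sum>i. expected_atom_sum \<Lambda> (g i))"
proof -
  have "expected_atom_sum \<Lambda> (\<lambda>x. \<Sum>i. g i x) = (\<integral>\<^sup>+N. (\<Sum>i. atom_sum N (g i)) \<partial>\<Lambda>)"
    unfolding expected_atom_sum_def atom_sum_def
    by (intro nn_integral_cong nn_integral_suminf) (auto intro: borel_measurable_atoms[OF _ assms])
  also have "\<dots> = (\<Sum>i. expected_atom_sum \<Lambda> (g i))"
    unfolding expected_atom_sum_def by (intro nn_integral_suminf measurable_atom_sum_\<Lambda> assms)
  finally show ?thesis .
qed

lemma expected_atom_sum_cmult: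
  assumes "g \<in> borel_measurable borel"
  shows "expected_atom_sum \<Lambda> (\<lambda>x. c * g x) = c * expected_atom_sum \<Lambda> g"
proof -
  have "expected_atom_sum \<Lambda> (\<lambda>x. c * g x) = (\<integral>\<^sup>+N. c * atom_sum N g \<partial>\<Lambda>)"
    unfolding expected_atom_sum_def atom_sum_def
    by (intro nn_integral_cong nn_integral_cmult) (auto intro: borel_measurable_atoms[OF _ assms])
  then show ?thesis unfolding expected_atom_sum_def
    by (simp add: nn_integral_cmult measurable_atom_sum_\<Lambda> assms)
qed

lemma expected_atom_sum_add:
  assumes "f \<in> borel_measurable borel" "g \<in> borel_measurable borel"
  shows "expected_atom_sum \<Lambda> (\<lambda>x. f x + g x) = expected_atom_sum \<Lambda> f + expected_atom_sum \<Lambda> g"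
proof -
  have "expected_atom_sum \<Lambda> (\<lambda>x. f x + g x) = (\<integral>\<^sup>+N. atom_sum N f + atom_sum N g \<partial>\<Lambda>)"
    unfolding expected_atom_sum_def atom_sum_def
    by (intro nn_integral_cong nn_integral_add) (auto intro: borel_measurable_atoms[OF _ assms(1)] borel_measurable_atoms[OF _ assms(2)])
  then show ?thesis unfolding expected_atom_sum_def
    by (simp add: nn_integral_add measurable_atom_sum_\<Lambda> assms)
qed

lemma expected_atom_sum_mono:
  "(\<And>x. f x \<le> g x) \<Longrightarrow> expected_atom_sum \<Lambda> f \<le> expected_atom_sum \<Lambda> g"
  unfolding expected_atom_sum_def atom_sum_def by (intro nn_integral_mono)

lemma sets_step_law [simp]: "sets (step_law \<Lambda>) = sets borel"
  unfolding step_law_def using sets.sigma_sets_eq[of "borel :: real measure"] by simp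

lemma emeasure_step_law:
  assumes "B \<in> sets borel"
  shows "emeasure (step_law \<Lambda>) B = expected_atom_sum \<Lambda> (\<lambda>x. indicator B x * ennreal (exp (- x)))"
  unfolding step_law_def
proof (rule emeasure_measure_of_sigma)
  let ?\<nu> = "\<lambda>B. expected_atom_sum \<Lambda> (\<lambda>x. indicator B x * ennreal (exp (- x)))"
  show "sigma_algebra UNIV (sets (borel :: real measure))"
    by (metis sets.sigma_algebra_axioms space_borel)
  show "positive (sets borel) ?\<nu>" by (simp add: positive_def expected_atom_sum_def atom_sum_def)
  show "countably_additive (sets borel) ?\<nu>"
  proof (rule countably_additiveI)
    fix A :: "nat \<Rightarrow> real set" assume A: "range A \<subseteq> sets borel" "disjoint_family A"
    have "(\<lambda>x. indicator (\<Union>i. A i) x * ennreal (exp (- x))) =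
        (\<lambda>x. \<Sum>i. indicator (A i) x * ennreal (exp (- x)))"
      using A(2) by (simp add: suminf_indicator)
    then show "(\<Sum>i. ?\<nu> (A i)) = ?\<nu> (\<Union>i. A i)"
      using A(1) by (subst expected_atom_sum_suminf[symmetric]) auto
  qed
qed fact

text \<open>The many-to-one formula for one generation.\<close>

lemma nn_integral_step_law:
  assumes "g \<in> borel_measurable borel"
  shows "(\<integral>\<^sup>+x. g x \<partial>step_law \<Lambda>) = expected_atom_sum \<Lambda> (\<lambda>x. g x * ennreal (exp (- x)))"
  using assms
proof induction
  case (cong f g)
  then have "f = g" by auto
  with cong show ?case by simp
next
  case (set B)
  then show ?case by (simp add: emeasure_step_law)
next
  case (mult u c)
  then show ?case
    by (subst nn_integral_cmult) (auto simp: mult.assoc expected_atom_sum_cmult cong: measurable_cong_sets)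
next
  case (add u v)
  then show ?case
    by (subst nn_integral_add) (auto simp: distrib_right expected_atom_sum_add cong: measurable_cong_sets)
next
  case (seq V)
  have "(\<integral>\<^sup>+x. (SUP i. V i) x \<partial>step_law \<Lambda>) = (SUP i. \<integral>\<^sup>+x. V i x \<partial>step_law \<Lambda>)"
    unfolding SUP_apply using seq
    by (intro nn_integral_monotone_convergence_SUP) (auto cong: measurable_cong_sets)
  also have "\<dots> = (SUP i. expected_atom_sum \<Lambda> (\<lambda>x. V i x * ennreal (exp (- x))))"
    using seq by simp
  also have "\<dots> = (SUP i. \<integral>\<^sup>+N. atom_sum N (\<lambda>x. V i x * ennreal (exp (- x))) \<partial>\<Lambda>)"
    by (simp add: expected_atom_sum_def)
  also have "\<dots> = (\<integral>\<^sup>+N. (SUP i. atom_sum N (\<lambda>x. V i x * ennreal (exp (- x)))) \<partial>\<Lambda>)"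
    using seq unfolding atom_sum_def
    by (intro nn_integral_monotone_convergence_SUP[symmetric] measurable_atom_sum_\<Lambda>[unfolded atom_sum_def])
      (auto simp: incseq_def le_fun_def intro!: nn_integral_mono mult_right_mono)
  also have "\<dots> = expected_atom_sum \<Lambda> (\<lambda>x. (SUP i. V i) x * ennreal (exp (- x)))"
    unfolding expected_atom_sum_def atom_sum_def SUP_apply SUP_mult_right_ennreal using seq
    by (intro nn_integral_cong nn_integral_monotone_convergence_SUP[symmetric])
      (auto simp: incseq_def le_fun_def intro!: mult_right_mono intro: borel_measurable_atoms[OF _ borel_measurable_times_ennreal])
  finally show ?case .
qed

text \<open>
  The first moment condition is given as a Bochner integral of a Bochner integral. The inner one
  is the difference of the positive part \<open>p N\<close> and the negative part \<open>q N\<close> for almost every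
  configuration \<open>N\<close>, and both parts are integrable.
\<close>

lemma centred_step_law:
  assumes mass: "expected_atom_sum \<Lambda> (\<lambda>x. ennreal (exp (- x))) = 1"
    and int: "expected_atom_sum \<Lambda> (\<lambda>x. ennreal (\<bar>x\<bar> * exp (- x))) < \<infinity>"
    and mean: "(\<integral>N. (\<integral>x. x * exp (- x) \<partial>N) \<partial>\<Lambda>) = 0"
  shows "centred (step_law \<Lambda>)"
proof -
  define p where "p N = atom_sum N (\<lambda>x. ennreal x * ennreal (exp (- x)))" for N
  define q where "q N = atom_sum N (\<lambda>x. ennreal (- x) * ennreal (exp (- x)))" for N
  have m [measurable]: "p \<in> borel_measurable \<Lambda>" "q \<in> borel_measurable \<Lambda>"
    unfolding p_def q_def by (auto intro!: measurable_atom_sum_\<Lambda>)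
  have P: "(\<integral>\<^sup>+x. ennreal x \<partial>step_law \<Lambda>) = (\<integral>\<^sup>+N. p N \<partial>\<Lambda>)"
    and Q: "(\<integral>\<^sup>+x. ennreal (- x) \<partial>step_law \<Lambda>) = (\<integral>\<^sup>+N. q N \<partial>\<Lambda>)"
    using nn_integral_step_law[of ennreal] nn_integral_step_law[of "\<lambda>x. ennreal (- x)"]
    by (simp_all add: p_def[abs_def] q_def[abs_def] expected_atom_sum_def)
  have le: "ennreal x * ennreal (exp (- x)) \<le> ennreal (\<bar>x\<bar> * exp (- x))"
    "ennreal (- x) * ennreal (exp (- x)) \<le> ennreal (\<bar>x\<bar> * exp (- x))" for x :: real
    by (subst ennreal_mult''[symmetric], simp, rule ennreal_leI, rule mult_right_mono, auto)+
  have fin: "(\<integral>\<^sup>+N. p N \<partial>\<Lambda>) < \<infinity>" "(\<integral>\<^sup>+N. q N \<partial>\<Lambda>) < \<infinity>"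
    using le_less_trans[OF expected_atom_sum_mono int, OF le(1)] le_less_trans[OF expected_atom_sum_mono int, OF le(2)]
    by (simp_all only: p_def q_def expected_atom_sum_def)
  have ae: "AE N in \<Lambda>. p N \<noteq> \<infinity>" "AE N in \<Lambda>. q N \<noteq> \<infinity>"
    using fin nn_integral_noteq_infinite[OF m(1)] nn_integral_noteq_infinite[OF m(2)] by simp_all
  have I: "integrable \<Lambda> (\<lambda>N. enn2real (p N))" "integrable \<Lambda> (\<lambda>N. enn2real (q N))"
    "(\<integral>N. enn2real (p N) \<partial>\<Lambda>) = enn2real (\<integral>\<^sup>+N. p N \<partial>\<Lambda>)"
    "(\<integral>N. enn2real (q N) \<partial>\<Lambda>) = enn2real (\<integral>\<^sup>+N. q N \<partial>\<Lambda>)"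
  proof -
    have "(\<integral>\<^sup>+N. ennreal (enn2real (p N)) \<partial>\<Lambda>) = (\<integral>\<^sup>+N. p N \<partial>\<Lambda>)"
      by (rule nn_integral_cong_AE, use ae(1) in eventually_elim) (simp add: less_top)
    moreover have "(\<integral>\<^sup>+N. ennreal (enn2real (q N)) \<partial>\<Lambda>) = (\<integral>\<^sup>+N. q N \<partial>\<Lambda>)"
      by (rule nn_integral_cong_AE, use ae(2) in eventually_elim) (simp add: less_top)
    ultimately have c: "(\<integral>\<^sup>+N. ennreal (enn2real (p N)) \<partial>\<Lambda>) = (\<integral>\<^sup>+N. p N \<partial>\<Lambda>)"
      "(\<integral>\<^sup>+N. ennreal (enn2real (q N)) \<partial>\<Lambda>) = (\<integral>\<^sup>+N. q N \<partial>\<Lambda>)" .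
    show "integrable \<Lambda> (\<lambda>N. enn2real (p N))" "integrable \<Lambda> (\<lambda>N. enn2real (q N))"
      using fin c by (auto intro!: integrableI_nonneg)
    show "(\<integral>N. enn2real (p N) \<partial>\<Lambda>) = enn2real (\<integral>\<^sup>+N. p N \<partial>\<Lambda>)"
      "(\<integral>N. enn2real (q N) \<partial>\<Lambda>) = enn2real (\<integral>\<^sup>+N. q N \<partial>\<Lambda>)"
      by (subst integral_eq_nn_integral, auto simp: c)+
  qed
  have "0 = (\<integral>N. (\<integral>x. x * exp (- x) \<partial>N) \<partial>\<Lambda>)" using mean by simp
  also have "\<dots> = (\<integral>N. enn2real (p N) - enn2real (q N) \<partial>\<Lambda>)"
  proof (rule integral_cong_AE)
    have inner: "AE N in \<Lambda>. (\<integral>x. x * exp (- x) \<partial>N) = enn2real (p N) - enn2real (q N)"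
      using ae AE_space
    proof eventually_elim
      case (elim N)
      have pq: "p N = (\<integral>\<^sup>+x. ennreal (x * exp (- x)) \<partial>N)" "q N = (\<integral>\<^sup>+x. ennreal (- (x * exp (- x))) \<partial>N)"
        unfolding p_def q_def atom_sum_def
        by (simp_all add: ennreal_mult''[symmetric])
      have meas: "(\<lambda>x. x * exp (- x)) \<in> borel_measurable N"
        using elim(3) by (rule borel_measurable_atoms) measurable
      have "integrable N (\<lambda>x. x * exp (- x))"
        unfolding real_integrable_def using elim meas pq by auto
      then show ?case unfolding pq by (rule real_lebesgue_integral_def)
    qed
    then show "AE N in \<Lambda>. (\<integral>x. x * exp (- x) \<partial>N) = enn2real (p N) - enn2real (q N)" .
    have e: "(\<integral>x. x * exp (- x) \<partial>N) = (if p N \<noteq> \<infinity> \<and> q N \<noteq> \<infinity> then enn2real (p N) - enn2real (q N) else 0)"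
      if "N \<in> space \<Lambda>" for N
    proof -
      have pq: "p N = (\<integral>\<^sup>+x. ennreal (x * exp (- x)) \<partial>N)" "q N = (\<integral>\<^sup>+x. ennreal (- (x * exp (- x))) \<partial>N)"
        unfolding p_def q_def atom_sum_def
        by (simp_all add: ennreal_mult''[symmetric])
      have meas: "(\<lambda>x. x * exp (- x)) \<in> borel_measurable N"
        using that by (rule borel_measurable_atoms) measurable
      have iff: "integrable N (\<lambda>x. x * exp (- x)) \<longleftrightarrow> p N \<noteq> \<infinity> \<and> q N \<noteq> \<infinity>"
        unfolding real_integrable_def using meas pq by auto
      show ?thesis
      proof (cases "integrable N (\<lambda>x. x * exp (- x))")
        case True
        with iff show ?thesis unfolding pq by (simp add: real_lebesgue_integral_def)
      next
        case False
        with iff show ?thesis by (auto simp: not_integrable_integral_eq)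
      qed
    qed
    show "(\<lambda>N. \<integral>x. x * exp (- x) \<partial>N) \<in> borel_measurable \<Lambda>"
      by (subst measurable_cong[OF e]) measurable
  qed measurable
  also have "\<dots> = enn2real (\<integral>\<^sup>+N. p N \<partial>\<Lambda>) - enn2real (\<integral>\<^sup>+N. q N \<partial>\<Lambda>)"
    using I by simp
  finally have "(\<integral>\<^sup>+N. p N \<partial>\<Lambda>) = (\<integral>\<^sup>+N. q N \<partial>\<Lambda>)"
    using fin by (cases "\<integral>\<^sup>+N. p N \<partial>\<Lambda>"; cases "\<integral>\<^sup>+N. q N \<partial>\<Lambda>") auto
  moreover have "prob_space (step_law \<Lambda>)"
  proof
    have "space (step_law \<Lambda>) = UNIV" by (simp add: step_law_def)
    then show "emeasure (step_law \<Lambda>) (space (step_law \<Lambda>)) = 1"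
      using mass by (simp add: emeasure_step_law)
  qed
  ultimately show ?thesis using fin P Q by (simp add: centred_def real_law_def)
qed

end

section \<open>The random environment\<close>

lemma centred_return_0: "centred (return borel 0)"
proof -
  interpret prob_space "return borel (0 :: real)" by (rule prob_space_return) simp
  show ?thesis
    using prob_space_axioms by (auto simp: centred_def real_law_def nn_integral_return)
qed

locale walk_environment = M: prob_space M for M :: "'w measure" +
  fixes E :: "'e measure" and \<xi> :: "nat \<Rightarrow> 'w \<Rightarrow> 'e"
    and L :: "'e \<Rightarrow> real measure measure"
    and Q :: "(nat \<Rightarrow> 'e) \<Rightarrow> (nat \<Rightarrow> real) measure"
  assumes indep: "M.indep_vars (\<lambda>_. E) \<xi> {1..}"
    and ident: "\<And>n. n \<ge> 1 \<Longrightarrow> distr M E (\<xi> n) = distr M E (\<xi> 1)"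
    and L [measurable]: "L \<in> E \<rightarrow>\<^sub>M prob_algebra configuration_space"
    and A1: "assumption_A1 M (\<lambda>\<omega>. L (\<xi> 1 \<omega>))"
    and A2: "assumption_A2 M (\<lambda>\<omega>. L (\<xi> 1 \<omega>))"
    and A3: "assumption_A3 M (\<lambda>\<omega>. L (\<xi> 1 \<omega>))"
    and chain_Q: "AE \<omega> in M. markov_chain_law (conditioned_kernel L (\<lambda>n. \<xi> n \<omega>)) 0 (Q (\<lambda>n. \<xi> n \<omega>))"
begin

lemma \<xi>_measurable [measurable]: "\<xi> (Suc n) \<in> M \<rightarrow>\<^sub>M E"
  using indep unfolding M.indep_vars_def by auto

lemma \<xi>1_measurable [measurable]: "\<xi> 1 \<in> M \<rightarrow>\<^sub>M E" using \<xi>_measurable[of 0] by simp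

definition P :: "'e measure" where "P = distr M E (\<xi> 1)"
text \<open>
  On the null set of environments where the step law is not a centred probability law, it is replaced
  by a unit mass at zero. Then every environment has a centred step law, and the monotonicity in
  \<^const>\<open>killed_mean\<close> needs no exceptional set.
\<close>

definition \<mu> :: "'e \<Rightarrow> real measure" where
  "\<mu> e = (if centred (step_law (L e)) then step_law (L e) else return borel 0)"

lemma sets_P [simp, measurable_cong]: "sets P = sets E" and space_P [simp]: "space P = space E"
  by (simp_all add: P_def)

lemma distr_\<xi>: "distr M E (\<xi> (Suc n)) = P"
  using ident[of "Suc n"] by (simp add: P_def)

lemma L_space: "e \<in> space E \<Longrightarrow> L e \<in> space (prob_algebra configuration_space)"
  by (rule measurable_space[OF L])

lemma measurable_expected [measurable]:
  "g \<in> borel_measurable borel \<Longrightarrow> (\<lambda>e. expected_atom_sum (L e) g) \<in> borel_measurable E"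
  by (rule measurable_compose[OF L measurable_expected_atom_sum])

lemma pred_centred [measurable]: "Measurable.pred E (\<lambda>e. centred (step_law (L e)))"
proof -
  have iff: "centred (step_law (L e)) \<longleftrightarrow>
      expected_atom_sum (L e) (\<lambda>x. ennreal (exp (- x))) = 1 \<and>
      expected_atom_sum (L e) (\<lambda>x. ennreal x * ennreal (exp (- x))) = expected_atom_sum (L e) (\<lambda>x. ennreal (- x) * ennreal (exp (- x))) \<and>
      expected_atom_sum (L e) (\<lambda>x. ennreal x * ennreal (exp (- x))) < \<infinity>"
    if "e \<in> space E" for e
  proof -
    note S = sets_step_law[OF L_space[OF that]]
    have sp: "space (step_law (L e)) = UNIV" using sets_eq_imp_space_eq[OF S] by simp
    have "prob_space (step_law (L e)) \<longleftrightarrow> emeasure (step_law (L e)) UNIV = 1"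
      using sp by (metis prob_space.emeasure_space_1 prob_spaceI)
    then have "real_law (step_law (L e)) \<longleftrightarrow> expected_atom_sum (L e) (\<lambda>x. ennreal (exp (- x))) = 1"
      using S by (simp add: real_law_def emeasure_step_law[OF L_space[OF that]])
    then show ?thesis
      unfolding centred_def
      using nn_integral_step_law[OF L_space[OF that], of ennreal]
        nn_integral_step_law[OF L_space[OF that], of "\<lambda>x. ennreal (- x)"] by simp
  qed
  show ?thesis by (subst measurable_cong[OF iff]) measurable
qed

lemma \<mu>_centred: "centred (\<mu> e)"
  by (simp add: \<mu>_def centred_return_0)

lemma \<mu>_measurable: "\<mu> \<in> E \<rightarrow>\<^sub>M prob_algebra borel"
proof (rule measurable_prob_algebraI)
  show "prob_space (\<mu> e)" for e by (rule centredD(2)[OF \<mu>_centred])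
  show "\<mu> \<in> E \<rightarrow>\<^sub>M subprob_algebra borel"
  proof (rule measurable_subprob_algebra)
    fix e
    show "subprob_space (\<mu> e)" by (rule prob_space_imp_subprob_space) (rule centredD(2)[OF \<mu>_centred])
    show "sets (\<mu> e) = sets borel" by (rule centredD(3)[OF \<mu>_centred])
  next
    fix A :: "real set" assume A [measurable]: "A \<in> sets borel"
    have "emeasure (\<mu> e) A = (if centred (step_law (L e))
        then expected_atom_sum (L e) (\<lambda>x. indicator A x * ennreal (exp (- x))) else indicator A 0)"
      if "e \<in> space E" for e
      using emeasure_step_law[OF L_space[OF that] A] A by (simp add: \<mu>_def)
    then show "(\<lambda>e. emeasure (\<mu> e) A) \<in> borel_measurable E"
      by (subst measurable_cong) (assumption, measurable)
  qed
qed

sublocale random_steps P \<mu>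
proof (intro random_steps.intro random_steps_axioms.intro)
  show "prob_space P" unfolding P_def by (rule M.prob_space_distr) measurable
  show "\<mu> \<in> P \<rightarrow>\<^sub>M prob_algebra borel"
    using \<mu>_measurable unfolding measurable_cong_sets[OF sets_P refl] .
  show "centred (\<mu> e)" for e by (rule \<mu>_centred)
qed

lemma AE_centred: "AE \<omega> in M. centred (step_law (L (\<xi> 1 \<omega>)))"
  using A2[unfolded assumption_A2_def] AE_space
proof eventually_elim
  case (elim \<omega>)
  have "\<xi> 1 \<omega> \<in> space E" using elim(2) \<xi>1_measurable by (rule measurable_space[rotated])
  then show ?case using elim(1) by (intro centred_step_law L_space) auto
qed

lemma AE_P_centred: "AE e in P. centred (step_law (L e))"
  unfolding P_def using AE_centred by (subst AE_distr_iff) (auto intro: pred_centred[unfolded pred_def])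

lemma AE_P_\<xi>: "AE e in P. R e \<Longrightarrow> AE \<omega> in M. \<forall>n. R (\<xi> (Suc n) \<omega>)"
  by (subst AE_all_countable, intro allI, rule AE_distrD[OF \<xi>_measurable]) (subst distr_\<xi>)

lemma AE_step_law: "AE \<omega> in M. \<forall>n. step_law (L (\<xi> (Suc n) \<omega>)) = \<mu> (\<xi> (Suc n) \<omega>)"
  using AE_P_\<xi>[OF AE_P_centred] by eventually_elim (simp add: \<mu>_def)

lemma nn_integral_P: "g \<in> borel_measurable E \<Longrightarrow> (\<integral>\<^sup>+e. g e \<partial>P) = (\<integral>\<^sup>+\<omega>. g (\<xi> (Suc n) \<omega>) \<partial>M)"
  unfolding distr_\<xi>[of n, symmetric] by (rule nn_integral_distr) measurable

text \<open>
  The numbering from \<open>1\<close> of the sequence \<open>\<xi>\<close> is shifted to that of the product space, from \<open>0\<close>.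
\<close>

definition environment :: "'w \<Rightarrow> nat \<Rightarrow> 'e" where "environment \<omega> i = \<xi> (Suc i) \<omega>"

lemma environment_measurable [measurable]: "environment \<in> M \<rightarrow>\<^sub>M env"
proof (rule measurable_PiM_single')
  show "(\<lambda>\<omega>. environment \<omega> i) \<in> M \<rightarrow>\<^sub>M P" for i
    using \<xi>_measurable[of i] unfolding measurable_cong_sets[OF refl sets_P] environment_def .
  show "environment \<in> space M \<rightarrow> UNIV \<rightarrow>\<^sub>E space P"
    using measurable_space[OF \<xi>_measurable] unfolding environment_def space_P by blast
qed

lemma distr_environment: "distr M env environment = env"
proof -
  let ?X = "\<lambda>\<omega>. \<lambda>i\<in>{1..}. \<xi> i \<omega>"
  have rv: "\<xi> i \<in> M \<rightarrow>\<^sub>M E" if "i \<in> {1..}" for i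
    using \<xi>_measurable[of "i - 1"] that by (cases i) auto
  have iP: "distr M E (\<xi> i) = P" if "i \<in> {1..}" for i
    unfolding P_def using that by (intro ident) simp
  have "distr M (PiM {1..} (\<lambda>_. E)) ?X = PiM {1..} (\<lambda>i. distr M E (\<xi> i))"
    using indep M.indep_vars_iff_distr_eq_PiM'[of "{1..}" \<xi> "\<lambda>_. E", OF _ rv] by simp
  also have "\<dots> = PiM {1..} (\<lambda>_. P)"
    using iP by (intro PiM_cong) auto
  finally have X: "distr M (PiM {1..} (\<lambda>_. E)) ?X = PiM {1..} (\<lambda>_. P)" .
  have sets: "sets (PiM {1..} (\<lambda>_. P)) = sets (PiM {1..} (\<lambda>_::nat. E))" by (intro sets_PiM_cong) auto
  have mX: "?X \<in> M \<rightarrow>\<^sub>M PiM {1..} (\<lambda>_. E)" by (intro measurable_restrict rv)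
  have mS: "(\<lambda>\<omega> n. \<omega> (Suc n)) \<in> PiM {1..} (\<lambda>_. E) \<rightarrow>\<^sub>M env"
    unfolding measurable_cong_sets[OF sets[symmetric] refl]
    by (rule measurable_PiM_single') (auto simp: space_PiM PiE_iff)
  have "env = distr (PiM {1..} (\<lambda>_. P)) env (\<lambda>\<omega> n. \<omega> (Suc n))"
    using distr_PiM_reindex[of "{1..}" "\<lambda>_. P" Suc UNIV] P.prob_space_axioms by (simp add: restrict_UNIV)
  also have "\<dots> = distr M env ((\<lambda>\<omega> n. \<omega> (Suc n)) \<circ> ?X)"
    unfolding X[symmetric] by (rule distr_distr[OF mS mX])
  also have "(\<lambda>\<omega> n. \<omega> (Suc n)) \<circ> ?X = environment"
    by (auto simp: fun_eq_iff environment_def)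
  finally show ?thesis ..
qed

lemma AE_environment: "AE e in env. R e \<Longrightarrow> AE \<omega> in M. R (environment \<omega>)"
  by (rule AE_distrD[OF environment_measurable]) (subst distr_environment)

lemma nn_integral_environment:
  "g \<in> borel_measurable env \<Longrightarrow> (\<integral>\<^sup>+\<omega>. g (environment \<omega>) \<partial>M) = (\<integral>\<^sup>+e. g e \<partial>env)"
  using nn_integral_distr[OF environment_measurable, of g] by (simp add: distr_environment)

lemma nn_integral_mean_law_M:
  assumes [measurable]: "g \<in> borel_measurable borel"
  shows "(\<integral>\<^sup>+x. g x \<partial>mean_law) = (\<integral>\<^sup>+\<omega>. expected_atom_sum (L (\<xi> 1 \<omega>)) (\<lambda>x. g x * ennreal (exp (- x))) \<partial>M)"
proof -
  have meas: "(\<lambda>e. \<integral>\<^sup>+x. g x \<partial>\<mu> e) \<in> borel_measurable E"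
    using measurable_prob_algebraD[OF \<mu>_measurable]
    by (rule measurable_compose) (rule nn_integral_measurable_subprob_algebra, measurable)
  have "(\<integral>\<^sup>+x. g x \<partial>mean_law) = (\<integral>\<^sup>+e. \<integral>\<^sup>+x. g x \<partial>\<mu> e \<partial>P)"
    by (rule nn_integral_mean_law) fact
  also have "\<dots> = (\<integral>\<^sup>+\<omega>. \<integral>\<^sup>+x. g x \<partial>\<mu> (\<xi> 1 \<omega>) \<partial>M)"
    using nn_integral_P[OF meas, of 0] unfolding One_nat_def .
  also have "\<dots> = (\<integral>\<^sup>+\<omega>. expected_atom_sum (L (\<xi> 1 \<omega>)) (\<lambda>x. g x * ennreal (exp (- x))) \<partial>M)"
  proof (rule nn_integral_cong_AE, use AE_centred AE_space in eventually_elim)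
    fix \<omega> assume c: "centred (step_law (L (\<xi> 1 \<omega>)))" and \<omega>: "\<omega> \<in> space M"
    have "\<mu> (\<xi> 1 \<omega>) = step_law (L (\<xi> 1 \<omega>))" unfolding \<mu>_def by (rule if_P[OF c])
    then show "(\<integral>\<^sup>+x. g x \<partial>\<mu> (\<xi> 1 \<omega>)) = expected_atom_sum (L (\<xi> 1 \<omega>)) (\<lambda>x. g x * ennreal (exp (- x)))"
      using nn_integral_step_law[OF L_space[OF measurable_space[OF \<xi>1_measurable \<omega>]] assms] by (simp only:)
  qed
  finally show ?thesis .
qed

lemma second_moment: "(\<integral>\<^sup>+x. ennreal (x\<^sup>2) \<partial>mean_law) < \<infinity>"
proof -
  from A3 obtain \<delta> where \<delta>: "0 < \<delta>" "(\<integral>\<^sup>+\<omega>. expected_atom_sum (L (\<xi> 1 \<omega>))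
      (\<lambda>x. ennreal (\<bar>x\<bar> powr (2 + \<delta>) * exp (- x))) \<partial>M) < \<infinity>"
    unfolding assumption_A3_def by blast
  have le: "x\<^sup>2 \<le> 1 + \<bar>x\<bar> powr (2 + \<delta>)" for x :: real
  proof (cases "\<bar>x\<bar> \<le> 1")
    case True
    then have "x\<^sup>2 \<le> 1" by (simp add: abs_square_le_1)
    then show ?thesis by (smt (verit) powr_ge_zero)
  next
    case False
    then have "x\<^sup>2 = \<bar>x\<bar> powr 2" by simp
    also have "\<dots> \<le> \<bar>x\<bar> powr (2 + \<delta>)" using False \<delta> by (intro powr_mono) auto
    finally show ?thesis by simp
  qed
  have "(\<integral>\<^sup>+x. ennreal (x\<^sup>2) \<partial>mean_law) \<le> (\<integral>\<^sup>+x. 1 + ennreal (\<bar>x\<bar> powr (2 + \<delta>)) \<partial>mean_law)"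
    using le by (intro nn_integral_mono) (simp add: ennreal_plus[symmetric] ennreal_leI ennreal_1[symmetric] del: ennreal_plus ennreal_1)
  also have "\<dots> = 1 + (\<integral>\<^sup>+x. ennreal (\<bar>x\<bar> powr (2 + \<delta>)) \<partial>mean_law)"
    using prob_space.emeasure_space_1[OF prob_space_mean_law] by (subst nn_integral_add) auto
  also have "(\<integral>\<^sup>+x. ennreal (\<bar>x\<bar> powr (2 + \<delta>)) \<partial>mean_law) < \<infinity>"
    using \<delta>(2) by (subst nn_integral_mean_law_M) (simp_all add: ennreal_mult''[symmetric])
  finally show ?thesis by simp
qed

lemma AE_P_positive: "AE s in P. 0 < emeasure (\<mu> s) {0<..}"
proof -
  have "AE \<omega> in M. 0 < expected_atom_sum (L (\<xi> 1 \<omega>)) (\<lambda>x. indicator {0<..} x * ennreal (exp (- x)))"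
    using A1 unfolding assumption_A1_def by blast
  then have "AE e in P. 0 < expected_atom_sum (L e) (\<lambda>x. indicator {0<..} x * ennreal (exp (- x)))"
    unfolding P_def by (subst AE_distr_iff) auto
  with AE_P_centred AE_space show ?thesis
    by eventually_elim (simp add: \<mu>_def emeasure_step_law L_space)
qed

lemma centred_walk_mean_law: "centred_walk mean_law"
proof
  have "(\<integral>\<^sup>+x. ennreal x \<partial>\<mu> e) = (\<integral>\<^sup>+x. ennreal (- x) \<partial>\<mu> e)" for e
    using \<mu>_centred[of e] by (simp add: centred_def)
  then have "(\<integral>\<^sup>+x. ennreal x \<partial>mean_law) = (\<integral>\<^sup>+x. ennreal (- x) \<partial>mean_law)"
    by (simp add: nn_integral_mean_law)
  moreover have "(\<integral>\<^sup>+x. ennreal x \<partial>mean_law) < \<infinity>"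
  proof -
    have "x \<le> 1 + x\<^sup>2" for x :: real
    proof -
      have "2 * x \<le> x\<^sup>2 + 1" using zero_le_power2[of "x - 1"] by (simp add: power2_diff)
      moreover have "0 \<le> x\<^sup>2" by simp
      ultimately show ?thesis by linarith
    qed
    then have "(\<integral>\<^sup>+x. ennreal x \<partial>mean_law) \<le> (\<integral>\<^sup>+x. 1 + ennreal (x\<^sup>2) \<partial>mean_law)"
      by (intro nn_integral_mono) (simp add: ennreal_plus[symmetric] ennreal_leI ennreal_1[symmetric] del: ennreal_plus ennreal_1)
    also have "\<dots> = 1 + (\<integral>\<^sup>+x. ennreal (x\<^sup>2) \<partial>mean_law)"
      using prob_space.emeasure_space_1[OF prob_space_mean_law] by (subst nn_integral_add) auto
    also have "\<dots> < \<infinity>" using second_moment by simp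
    finally show ?thesis .
  qed
  ultimately show "centred mean_law"
    by (simp add: centred_def real_law_def prob_space_mean_law)
  show "(\<integral>\<^sup>+x. ennreal (x\<^sup>2) \<partial>mean_law) < \<infinity>" by (rule second_moment)
  show "0 < emeasure mean_law {0<..}"
  proof (rule ccontr)
    assume "\<not> 0 < emeasure mean_law {0<..}"
    then have "(\<integral>\<^sup>+x. indicator {0<..} x \<partial>mean_law) = 0" by simp
    then have "(\<integral>\<^sup>+e. \<integral>\<^sup>+x. indicator {0<..} x \<partial>\<mu> e \<partial>P) = 0" by (subst (asm) nn_integral_mean_law) auto
    then have "AE e in P. (\<integral>\<^sup>+x. indicator {0<..} x \<partial>\<mu> e) = 0"
      by (subst (asm) nn_integral_0_iff_AE) (auto intro!: measurable_compose[OF measurable_\<mu>_sub nn_integral_measurable_subprob_algebra])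
    with AE_P_positive have "AE e in P. False"
    proof eventually_elim
      case (elim e)
      then show False using centredD(3)[OF \<mu>_centred, of e] by simp
    qed
    then show False by simp
  qed
qed

sublocale W: centred_walk mean_law by (rule centred_walk_mean_law)

section \<open>The tilted law\<close>

text \<open>
  \<open>V \<omega> j\<close> is \<open>U(\<theta>\<^sup>j\<xi>, \<cdot>)\<close> at \<open>\<omega>\<close>.
\<close>

definition V :: "'w \<Rightarrow> nat \<Rightarrow> real \<Rightarrow> ennreal" where
  "V \<omega> j = harmonic (\<lambda>i. \<mu> (environment \<omega> (j + i)))"

abbreviation Q\<xi> :: "'w \<Rightarrow> (nat \<Rightarrow> real) measure" where "Q\<xi> \<omega> \<equiv> Q (\<lambda>n. \<xi> n \<omega>)"

definition good :: "'w \<Rightarrow> bool" where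
  "good \<omega> \<longleftrightarrow> (\<forall>j. \<forall>y\<ge>0. 0 < V \<omega> j y \<and> V \<omega> j y < \<infinity>) \<and>
     (\<forall>n. step_law (L (\<xi> (Suc n) \<omega>)) = \<mu> (\<xi> (Suc n) \<omega>)) \<and>
     markov_chain_law (conditioned_kernel L (\<lambda>n. \<xi> n \<omega>)) 0 (Q\<xi> \<omega>)"

lemma good_V: "good \<omega> \<Longrightarrow> 0 \<le> y \<Longrightarrow> 0 < V \<omega> j y \<and> V \<omega> j y < \<infinity>"
  unfolding good_def by blast

lemma AE_good: "AE \<omega> in M. good \<omega>"
  using AE_environment[OF AE_harmonic_good[OF centred_walk_mean_law AE_P_positive]] AE_step_law chain_Q
  by eventually_elim (simp add: good_def V_def)

lemma conditioned_chain_good: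
  assumes "good \<omega>"
  shows "conditioned_chain (\<lambda>i. \<mu> (environment \<omega> i)) (V \<omega>) (conditioned_kernel L (\<lambda>n. \<xi> n \<omega>)) (Q\<xi> \<omega>)"
proof
  have \<kappa>: "(\<lambda>i. step_law (L (\<xi> (Suc i) \<omega>))) = (\<lambda>i. \<mu> (environment \<omega> i))"
    using assms by (simp add: good_def environment_def)
  have \<kappa>': "step_law (L (\<xi> (Suc i) \<omega>)) = \<mu> (environment \<omega> i)" for i
    using \<kappa> by meson
  show "real_law (\<mu> (environment \<omega> i))" for i by (rule centredD(1)[OF \<mu>_centred])
  show "V \<omega> j \<in> borel_measurable borel" for j
    unfolding V_def by (intro measurable_harmonic centredD(1)[OF \<mu>_centred])
  show "0 < V \<omega> j y" "V \<omega> j y < \<infinity>" if "0 \<le> y" for j y using assms that by (auto simp: good_def)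
  show "markov_chain_law (conditioned_kernel L (\<lambda>n. \<xi> n \<omega>)) 0 (Q\<xi> \<omega>)" using assms by (simp add: good_def)
  show "emeasure (conditioned_kernel L (\<lambda>n. \<xi> n \<omega>) (Suc j) x) B =
      (\<integral>\<^sup>+t. indicator B (x + t) * (indicator {0..} (x + t) * V \<omega> (Suc j) (x + t) / V \<omega> j x) \<partial>\<mu> (environment \<omega> j))"
    if "0 \<le> x" "B \<in> sets borel" for j x B
    using emeasure_conditioned_kernel[of L "\<lambda>n. \<xi> n \<omega>" x B j, unfolded \<kappa>'] that assms \<mu>_centred
    by (simp add: V_def good_def)
qed

lemma ennreal_harmonic_U:
  assumes "good \<omega>"
  shows "ennreal (harmonic_U L (\<lambda>n. \<xi> n \<omega>) 0) = V \<omega> 0 0"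
proof -
  have \<kappa>: "(\<lambda>i. step_law (L (\<xi> (Suc i) \<omega>))) = (\<lambda>i. \<mu> (environment \<omega> i))"
    using assms by (simp add: good_def environment_def)
  have \<kappa>': "step_law (L (\<xi> (Suc i) \<omega>)) = \<mu> (environment \<omega> i)" for i
    using \<kappa> by meson
  have fin: "V \<omega> 0 0 < \<infinity>" using assms by (simp add: good_def)
  then have "harmonic_U L (\<lambda>n. \<xi> n \<omega>) 0 = enn2real (V \<omega> 0 0)"
    using harmonic_U_eq[of L "\<lambda>n. \<xi> n \<omega>" 0, unfolded \<kappa>'] \<mu>_centred by (simp add: V_def)
  then show ?thesis using fin by (simp add: less_top[symmetric])
qed

lemma measurable_V0: "(\<lambda>\<omega>. V \<omega> 0 0) \<in> borel_measurable M"
  using measurable_compose[OF environment_measurable measurable_harmonic_env_at] by (simp add: V_def)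

lemma nn_integral_V0: "(\<integral>\<^sup>+\<omega>. V \<omega> 0 0 \<partial>M) = W.h 0"
  using nn_integral_environment[OF measurable_harmonic_env_at, of 0] by (simp add: V_def nn_integral_harmonic)

lemma mean_U_eq: "mean_U M \<xi> L = W.h 0"
  unfolding mean_U_def nn_integral_V0[symmetric]
  by (rule nn_integral_cong_AE, use AE_good in eventually_elim) (rule ennreal_harmonic_U)

text \<open>
  The tilt by \<open>U(\<xi>, 0)\<close> cancels the denominator of the density of the chain, so that the tilted
  quenched probability of a cylinder is a killed expectation of \<open>U(\<theta>\<^sup>m\<xi>, z m)\<close>.
\<close>

lemma cylinder_weight:
  assumes "good \<omega>" and A: "A \<in> sets path_space" "depends_upto m A"
  shows "V \<omega> 0 0 * emeasure (Q\<xi> \<omega>) A =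
    killed_paths (\<lambda>i. \<mu> (environment \<omega> i)) m (\<lambda>z. indicator A z * V \<omega> m (z m))"
proof -
  interpret C: conditioned_chain "\<lambda>i. \<mu> (environment \<omega> i)" "V \<omega>" "conditioned_kernel L (\<lambda>n. \<xi> n \<omega>)" "Q\<xi> \<omega>"
    by (rule conditioned_chain_good) fact
  have "cutoff m z \<in> A \<longleftrightarrow> z \<in> A" for z
    by (rule depends_upto_iff[OF A(2)]) (simp add: cutoff_def)
  then have "emeasure (Q\<xi> \<omega>) A = (\<integral>\<^sup>+z. indicator A (cutoff m z) \<partial>Q\<xi> \<omega>)"
    using A(1) by (simp add: indicator_def[of A] flip: nn_integral_indicator)
  then show ?thesis using C.chain_law[of "indicator A" m] A(1) by simp
qed

definition cylinder_fun :: "nat \<Rightarrow> (nat \<Rightarrow> real) set \<Rightarrow> (nat \<Rightarrow> 'e) \<Rightarrow> (nat \<Rightarrow> real) \<Rightarrow> ennreal" where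
  "cylinder_fun m A e z = indicator A z * harmonic (\<lambda>i. \<mu> (e i)) (z m)"

lemma measurable_cylinder_fun:
  assumes [measurable]: "A \<in> sets path_space"
  shows "(\<lambda>(e, z). cylinder_fun m A e z) \<in> borel_measurable (env \<Otimes>\<^sub>M path_space)"
proof -
  have "(\<lambda>p. indicator A (snd p) * (\<lambda>(e, y). harmonic (\<lambda>i. \<mu> (e i)) y) (fst p, snd p m)) \<in> borel_measurable (env \<Otimes>\<^sub>M path_space)"
    by measurable
  then show ?thesis by (simp add: cylinder_fun_def split_beta')
qed

lemma measurable_cylinder_paths:
  assumes [measurable]: "A \<in> sets path_space"
  shows "(\<lambda>e. killed_paths (\<lambda>i. \<mu> (e i)) m (cylinder_fun m A (\<lambda>i. e (m + i)))) \<in> borel_measurable env"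
proof (rule measurable_killed_paths_env)
  have "(\<lambda>p. (\<lambda>(e, z). cylinder_fun m A e z) (\<lambda>i. fst p (m + i), snd p)) \<in> borel_measurable (env \<Otimes>\<^sub>M path_space)"
    using measurable_cylinder_fun[OF assms] by measurable
  then show "(\<lambda>(e, z). cylinder_fun m A (\<lambda>i. e (m + i)) z) \<in> borel_measurable (env \<Otimes>\<^sub>M path_space)"
    by (simp add: split_beta')
qed

lemma cylinder_weight_shifted:
  assumes "good \<omega>" "A \<in> sets path_space" "depends_upto m A"
  shows "V \<omega> 0 0 * emeasure (Q\<xi> \<omega>) A =
    killed_paths (\<lambda>i. \<mu> (environment \<omega> i)) m (cylinder_fun m A (\<lambda>i. environment \<omega> (m + i)))"
  using cylinder_weight[OF assms] by (simp add: cylinder_fun_def[abs_def] V_def)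

text \<open>
  The kernel \<open>Q\<close> is known only through a property of each of its values, so measurability in the
  environment has to be derived, and holds up to a null set. This suffices: nonnegative integrals do not
  see null sets.
\<close>

definition has_version :: "('w \<Rightarrow> ennreal) \<Rightarrow> bool" where
  "has_version f \<longleftrightarrow> (\<exists>g\<in>borel_measurable M. AE \<omega> in M. f \<omega> = g \<omega>)"

lemma good_Q:
  assumes "good \<omega>"
  shows "prob_space (Q\<xi> \<omega>)" "sets (Q\<xi> \<omega>) = sets path_space" "space (Q\<xi> \<omega>) = UNIV"
proof -
  show "prob_space (Q\<xi> \<omega>)" and s: "sets (Q\<xi> \<omega>) = sets path_space"
    using assms by (auto simp: good_def markov_chain_law_def)
  show "space (Q\<xi> \<omega>) = UNIV" using sets_eq_imp_space_eq[OF s] by simp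
qed

text \<open>
  On cylinders \<open>cylinder_weight\<close> gives an explicit version; the class of sets that have one is a
  Dynkin system.
\<close>

lemma has_version_Q:
  assumes "A \<in> sets path_space"
  shows "has_version (\<lambda>\<omega>. emeasure (Q\<xi> \<omega>) A)"
proof -
  let ?G = "prod_algebra UNIV (\<lambda>_::nat. borel :: real measure)"
  have G: "?G \<subseteq> Pow UNIV" by auto
  have sets: "sets path_space = sigma_sets UNIV ?G" using sets_PiM[of UNIV "\<lambda>_::nat. borel :: real measure"] by simp
  show ?thesis using Int_stable_prod_algebra G assms[unfolded sets]
  proof (induction rule: sigma_sets_induct_disjoint)
    case (basic A)
    then obtain J X where J: "finite J" "\<And>i. i \<in> J \<Longrightarrow> X i \<in> sets borel" and A: "A = prod_emb UNIV (\<lambda>_. borel) J (Pi\<^sub>E J X)"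
      by (auto elim!: prod_algebraE)
    \<comment> \<open>the insertion of \<open>0\<close> covers the empty index set\<close>
    define m where "m = Max (insert 0 J)"
    have "z \<in> A \<longleftrightarrow> (\<forall>i\<in>J. z i \<in> X i)" for z
      unfolding A by (auto simp: prod_emb_def PiE_iff restrict_def extensional_def)
    moreover have "i \<le> m" if "i \<in> J" for i unfolding m_def using J that by (intro Max_ge) auto
    ultimately have dep: "depends_upto m A" unfolding depends_upto_def by auto
    have As [measurable]: "A \<in> sets path_space" unfolding sets using basic by (rule sigma_sets.Basic)
    let ?g = "\<lambda>\<omega>. killed_paths (\<lambda>i. \<mu> (environment \<omega> i)) m (cylinder_fun m A (\<lambda>i. environment \<omega> (m + i))) / V \<omega> 0 0"
    have "?g \<in> borel_measurable M"
      using measurable_compose[OF environment_measurable measurable_cylinder_paths[OF As, of m]] measurable_V0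
      by (intro borel_measurable_divide_ennreal)
    moreover have "AE \<omega> in M. emeasure (Q\<xi> \<omega>) A = ?g \<omega>"
      using AE_good
    proof eventually_elim
      case (elim \<omega>)
      then have "V \<omega> 0 0 \<noteq> 0" "V \<omega> 0 0 \<noteq> \<infinity>"
        using good_V[OF elim, of 0 0] by auto
      then show ?case
        unfolding cylinder_weight_shifted[OF elim As dep, symmetric]
        by (metis ennreal_mult_divide_eq infinity_ennreal_def mult.commute)
    qed
    ultimately show ?case unfolding has_version_def by - (rule bexI[of _ ?g], assumption+)
  next
    case empty
    show ?case unfolding has_version_def by (intro bexI[of _ "\<lambda>_. 0"]) auto
  next
    case (compl A)
    then obtain g where [measurable]: "g \<in> borel_measurable M" and g: "AE \<omega> in M. emeasure (Q\<xi> \<omega>) A = g \<omega>"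
      unfolding has_version_def by blast
    have "AE \<omega> in M. emeasure (Q\<xi> \<omega>) (UNIV - A) = 1 - g \<omega>"
      using g AE_good
    proof eventually_elim
      case (elim \<omega>)
      interpret prob_space "Q\<xi> \<omega>" by (rule good_Q(1)[OF elim(2)])
      have "emeasure (Q\<xi> \<omega>) (space (Q\<xi> \<omega>) - A) = emeasure (Q\<xi> \<omega>) (space (Q\<xi> \<omega>)) - emeasure (Q\<xi> \<omega>) A"
        using compl(1) good_Q(2)[OF elim(2)] by (intro emeasure_compl) (simp_all add: sets)
      then show ?case using elim good_Q(3)[OF elim(2)] emeasure_space_1 by simp
    qed
    then show ?case unfolding has_version_def by (intro bexI[of _ "\<lambda>\<omega>. 1 - g \<omega>"]) auto
  next
    case (union A)
    then have "\<forall>i. \<exists>g. g \<in> borel_measurable M \<and> (AE \<omega> in M. emeasure (Q\<xi> \<omega>) (A i) = g \<omega>)"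
      unfolding has_version_def by blast
    then obtain g where g: "\<And>i. g i \<in> borel_measurable M" "\<And>i. AE \<omega> in M. emeasure (Q\<xi> \<omega>) (A i) = g i \<omega>"
      by metis
    have "AE \<omega> in M. \<forall>i. emeasure (Q\<xi> \<omega>) (A i) = g i \<omega>" using g(2) by (simp add: AE_all_countable)
    then have "AE \<omega> in M. emeasure (Q\<xi> \<omega>) (\<Union>i. A i) = (\<Sum>i. g i \<omega>)"
      using AE_good
    proof eventually_elim
      case (elim \<omega>)
      have "(\<Sum>i. emeasure (Q\<xi> \<omega>) (A i)) = emeasure (Q\<xi> \<omega>) (\<Union>i. A i)"
        using union good_Q(2)[OF elim(2)] by (intro suminf_emeasure) (auto simp: sets)
      then show ?case using elim(1) by simp
    qed
    then show ?case unfolding has_version_def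
      using g(1) by (intro bexI[of _ "\<lambda>\<omega>. \<Sum>i. g i \<omega>"]) auto
  qed
qed

abbreviation T :: "(nat \<Rightarrow> real) measure" where "T \<equiv> tilted_law M \<xi> L Q"

lemma sets_T: "sets T = sets path_space"
  unfolding tilted_law_def using sets.sigma_sets_eq[of path_space] by simp

lemma tilt_weight:
  "(\<integral>\<^sup>+\<omega>. ennreal (harmonic_U L (\<lambda>n. \<xi> n \<omega>) 0) / mean_U M \<xi> L * emeasure (Q\<xi> \<omega>) A \<partial>M) =
   (\<integral>\<^sup>+\<omega>. V \<omega> 0 0 / W.h 0 * emeasure (Q\<xi> \<omega>) A \<partial>M)"
  unfolding mean_U_eq
  by (rule nn_integral_cong_AE, use AE_good in eventually_elim) (simp add: ennreal_harmonic_U)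

text \<open>
  Countable additivity of the tilted set function, obtained by passing to measurable versions under
  the integral.
\<close>

lemma emeasure_T:
  assumes "A \<in> sets path_space"
  shows "emeasure T A = (\<integral>\<^sup>+\<omega>. V \<omega> 0 0 / W.h 0 * emeasure (Q\<xi> \<omega>) A \<partial>M)"
  unfolding tilted_law_def tilt_weight
proof (rule emeasure_measure_of_sigma)
  show "sigma_algebra (space path_space) (sets path_space)" by (rule sets.sigma_algebra_axioms)
  show "positive (sets path_space) (\<lambda>A. \<integral>\<^sup>+\<omega>. V \<omega> 0 0 / W.h 0 * emeasure (Q\<xi> \<omega>) A \<partial>M)"
    by (simp add: positive_def)
  show "countably_additive (sets path_space) (\<lambda>A. \<integral>\<^sup>+\<omega>. V \<omega> 0 0 / W.h 0 * emeasure (Q\<xi> \<omega>) A \<partial>M)"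
  proof (rule countably_additiveI)
    fix A :: "nat \<Rightarrow> (nat \<Rightarrow> real) set" assume A: "range A \<subseteq> sets path_space" "disjoint_family A"
    have "\<exists>g. g \<in> borel_measurable M \<and> (AE \<omega> in M. emeasure (Q\<xi> \<omega>) (A i) = g \<omega>)" for i
      using has_version_Q[of "A i"] A(1) unfolding has_version_def by blast
    then obtain g where g: "\<And>i. g i \<in> borel_measurable M" "\<And>i. AE \<omega> in M. emeasure (Q\<xi> \<omega>) (A i) = g i \<omega>"
      by metis
    note [measurable] = g(1) measurable_V0
    have "(\<Sum>i. \<integral>\<^sup>+\<omega>. V \<omega> 0 0 / W.h 0 * emeasure (Q\<xi> \<omega>) (A i) \<partial>M) =
        (\<Sum>i. \<integral>\<^sup>+\<omega>. V \<omega> 0 0 / W.h 0 * g i \<omega> \<partial>M)"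
    proof (intro suminf_cong nn_integral_cong_AE)
      fix i
      show "AE \<omega> in M. V \<omega> 0 0 / W.h 0 * emeasure (Q\<xi> \<omega>) (A i) = V \<omega> 0 0 / W.h 0 * g i \<omega>"
        using g(2)[of i] by eventually_elim simp
    qed
    also have "\<dots> = (\<integral>\<^sup>+\<omega>. (\<Sum>i. V \<omega> 0 0 / W.h 0 * g i \<omega>) \<partial>M)"
      by (rule nn_integral_suminf[symmetric]) measurable
    also have "\<dots> = (\<integral>\<^sup>+\<omega>. V \<omega> 0 0 / W.h 0 * emeasure (Q\<xi> \<omega>) (\<Union>i. A i) \<partial>M)"
    proof (rule nn_integral_cong_AE)
      have "AE \<omega> in M. \<forall>i. emeasure (Q\<xi> \<omega>) (A i) = g i \<omega>" using g(2) by (simp add: AE_all_countable)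
      then show "AE \<omega> in M. (\<Sum>i. V \<omega> 0 0 / W.h 0 * g i \<omega>) = V \<omega> 0 0 / W.h 0 * emeasure (Q\<xi> \<omega>) (\<Union>i. A i)"
        using AE_good
      proof eventually_elim
        case (elim \<omega>)
        have "(\<Sum>i. emeasure (Q\<xi> \<omega>) (A i)) = emeasure (Q\<xi> \<omega>) (\<Union>i. A i)"
          using A good_Q(2)[OF elim(2)] by (intro suminf_emeasure) auto
        then show ?case using elim(1) by simp
      qed
    qed
    finally show "(\<Sum>i. \<integral>\<^sup>+\<omega>. V \<omega> 0 0 / W.h 0 * emeasure (Q\<xi> \<omega>) (A i) \<partial>M) =
        (\<integral>\<^sup>+\<omega>. V \<omega> 0 0 / W.h 0 * emeasure (Q\<xi> \<omega>) (\<Union>i. A i) \<partial>M)" .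
  qed
qed fact

lemma h0: "W.h 0 \<noteq> 0" "W.h 0 \<noteq> \<infinity>" "W.h 0 \<noteq> top"
  using W.h_0_pos W.h_0_finite by auto

lemma h0_cancel: "W.h 0 * (a / W.h 0 * b) = a * b"
proof -
  have "W.h 0 * (a / W.h 0 * b) = (a * W.h 0 / W.h 0) * b"
    by (simp add: ennreal_times_divide mult.assoc[symmetric] mult.commute)
  then show ?thesis using h0 by (simp add: ennreal_mult_divide_eq)
qed

text \<open>
  The tilted law of the conditioned chain is the Doob transform of the annealed walk. The factor
  \<open>U(\<theta>\<^sup>m\<xi>, z m)\<close> depends on the environment from time \<open>m\<close> on and is independent of the first
  \<open>m\<close> steps, hence averages to \<open>h (z m)\<close>.
\<close>

sublocale htransformed_walk mean_law T
proof (intro htransformed_walk.intro htransformed_walk_axioms.intro)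
  show "centred_walk mean_law" by (rule centred_walk_mean_law)
  have "emeasure T (space T) = (\<integral>\<^sup>+\<omega>. V \<omega> 0 0 / W.h 0 * emeasure (Q\<xi> \<omega>) UNIV \<partial>M)"
    using emeasure_T[of UNIV] sets_eq_imp_space_eq[OF sets_T] by simp
  also have "\<dots> = (\<integral>\<^sup>+\<omega>. V \<omega> 0 0 / W.h 0 \<partial>M)"
    using prob_space.emeasure_space_1[OF good_Q(1)] good_Q(3)
    by (intro nn_integral_cong_AE, use AE_good in eventually_elim) auto
  also have "\<dots> = 1"
    using h0 W.h_0_finite by (subst nn_integral_divide) (auto simp: measurable_V0 nn_integral_V0 ennreal_divide_self)
  finally show "prob_space T" by (rule prob_spaceI)
  show "sets T = sets path_space" by (rule sets_T)
  fix m and A :: "(nat \<Rightarrow> real) set"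
  assume A [measurable]: "A \<in> sets path_space" and dep: "depends_upto m A"
  from has_version_Q[OF A] obtain g where g [measurable]: "g \<in> borel_measurable M"
    and ae: "AE \<omega> in M. emeasure (Q\<xi> \<omega>) A = g \<omega>" unfolding has_version_def by blast
  note [measurable] = measurable_V0
  have "W.h 0 * emeasure T A = W.h 0 * (\<integral>\<^sup>+\<omega>. V \<omega> 0 0 / W.h 0 * g \<omega> \<partial>M)"
    unfolding emeasure_T[OF A]
    by (intro arg_cong2[where f = "(*)"] refl nn_integral_cong_AE, rule eventually_mono[OF ae]) simp
  also have "\<dots> = (\<integral>\<^sup>+\<omega>. V \<omega> 0 0 * g \<omega> \<partial>M)"
    by (subst nn_integral_cmult[symmetric]) (auto simp: h0_cancel)
  also have "\<dots> = (\<integral>\<^sup>+\<omega>. killed_paths (\<lambda>i. \<mu> (environment \<omega> i)) m (cylinder_fun m A (\<lambda>i. environment \<omega> (m + i))) \<partial>M)"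
  proof (rule nn_integral_cong_AE, use ae AE_good in eventually_elim)
    fix \<omega> assume "emeasure (Q\<xi> \<omega>) A = g \<omega>" "good \<omega>"
    then show "V \<omega> 0 0 * g \<omega> = killed_paths (\<lambda>i. \<mu> (environment \<omega> i)) m (cylinder_fun m A (\<lambda>i. environment \<omega> (m + i)))"
      using cylinder_weight_shifted[OF _ A dep] by metis
  qed
  also have "\<dots> = (\<integral>\<^sup>+e. killed_paths (\<lambda>i. \<mu> (e i)) m (cylinder_fun m A (\<lambda>i. e (m + i))) \<partial>env)"
    by (rule nn_integral_environment) (rule measurable_cylinder_paths[OF A])
  also have "\<dots> = killed_paths (\<lambda>_. mean_law) m (\<lambda>z. \<integral>\<^sup>+e. cylinder_fun m A e z \<partial>env)"
    by (rule nn_integral_killed_paths) (rule measurable_cylinder_fun[OF A])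
  also have "\<dots> = killed_paths (\<lambda>_. mean_law) m (\<lambda>z. indicator A z * W.h (z m))"
  proof (rule killed_paths_cong)
    fix z :: "nat \<Rightarrow> real" assume z: "\<And>i. 0 \<le> z i"
    show "(\<integral>\<^sup>+e. cylinder_fun m A e z \<partial>env) = indicator A z * W.h (z m)"
      using z by (simp add: cylinder_fun_def nn_integral_cmult nn_integral_harmonic)
  qed
  also have "\<dots> = (\<integral>\<^sup>+X. indicator {X. stays m X} X * (indicator A (cutoff m (psum X)) * W.h (cutoff m (psum X) m)) \<partial>W.steps)"
    by (rule W.killed_paths_walk) measurable
  also have "\<dots> = (\<integral>\<^sup>+X. indicator {X. stays m X} X * indicator A (psum X) * W.h (psum X m) \<partial>W.steps)"
  proof (rule nn_integral_cong)
    fix X :: "nat \<Rightarrow> real"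
    have "cutoff m (psum X) \<in> A \<longleftrightarrow> psum X \<in> A"
      by (rule depends_upto_iff[OF dep]) (simp add: cutoff_def)
    then show "indicator {X. stays m X} X * (indicator A (cutoff m (psum X)) * W.h (cutoff m (psum X) m)) =
        indicator {X. stays m X} X * indicator A (psum X) * W.h (psum X m)"
      by (simp add: indicator_def cutoff_def)
  qed
  finally show "W.h 0 * emeasure T A = \<dots>" .
qed

lemma mean_step_law_eq: "mean_step_law M (\<lambda>\<omega>. L (\<xi> (Suc n) \<omega>)) = mean_law"
proof -
  have "mean_step_law M (\<lambda>\<omega>. L (\<xi> (Suc n) \<omega>)) = measure_of UNIV (sets borel) (emeasure mean_law)"
    unfolding mean_step_law_def
  proof (rule measure_of_eq)
    fix B :: "real set" assume "B \<in> sigma_sets UNIV (sets borel)"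
    then have B [measurable]: "B \<in> sets borel" using sets.sigma_sets_eq[of "borel :: real measure"] by simp
    have m: "(\<lambda>e. emeasure (\<mu> e) B) \<in> borel_measurable E"
      using measurable_prob_algebraD[OF \<mu>_measurable] by (rule measurable_compose) measurable
    have "(\<integral>\<^sup>+\<omega>. emeasure (step_law (L (\<xi> (Suc n) \<omega>))) B \<partial>M) = (\<integral>\<^sup>+\<omega>. emeasure (\<mu> (\<xi> (Suc n) \<omega>)) B \<partial>M)"
      by (rule nn_integral_cong_AE, use AE_step_law in eventually_elim) simp
    also have "\<dots> = (\<integral>\<^sup>+e. emeasure (\<mu> e) B \<partial>P)" by (rule nn_integral_P[OF m, symmetric])
    also have "\<dots> = (\<integral>\<^sup>+e. \<integral>\<^sup>+x. indicator B x \<partial>\<mu> e \<partial>P)"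
      using centredD(3)[OF \<mu>_centred] by simp
    also have "\<dots> = emeasure mean_law B" by (subst nn_integral_mean_law[symmetric]) auto
    finally show "(\<integral>\<^sup>+\<omega>. emeasure (step_law (L (\<xi> (Suc n) \<omega>))) B \<partial>M) = emeasure mean_law B" .
  qed simp
  also have "\<dots> = mean_law"
    using measure_of_of_measure[of mean_law] by simp
  finally show ?thesis .
qed

lemma annealed_walk_eq: "annealed_walk M \<xi> L = distr W.steps path_space psum"
proof -
  have "real_law mean_law" using W.centred centredD by auto
  then have "annealed_walk M \<xi> L = distr W.steps path_space (\<lambda>X n. 0 + psum X n)"
    unfolding annealed_walk_def
    by (subst random_walk_law_eq) (simp_all add: mean_step_law_eq)
  then show ?thesis by simp
qed

end

section \<open>The law of the path up to the first future minimum\<close>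

lemma measurable_countable_arg:
  assumes "\<And>k. (\<lambda>w. g k w) \<in> path_space \<rightarrow>\<^sub>M N"
  shows "(\<lambda>p. g (fst p) (snd p)) \<in> (count_space (UNIV :: nat set) \<Otimes>\<^sub>M path_space) \<rightarrow>\<^sub>M N"
  by (rule measurable_compose_countable[where f = "\<lambda>k p. g k (snd p)" and g = fst])
    (auto intro: measurable_compose[OF measurable_snd assms])

text \<open>
  At \<open>k = 0\<close> the restriction is to the empty set, so the function there is constant and measurable
  whatever \<open>f 0\<close> is. This covers the arbitrary value of \<^const>\<open>the_enat\<close> at infinity.
\<close>

lemma measurable_restricted_arg:
  fixes f :: "nat \<Rightarrow> (nat \<Rightarrow> real) \<Rightarrow> 'b :: topological_space"
  assumes "\<forall>k\<ge>1. f k \<in> borel_measurable (PiM {1..k} (\<lambda>_. borel))"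
  shows "(\<lambda>p. f (fst p) (restrict (snd p) {1..fst p})) \<in> borel_measurable (count_space UNIV \<Otimes>\<^sub>M path_space)"
proof (rule measurable_countable_arg)
  fix k
  show "(\<lambda>w. f k (restrict w {1..k})) \<in> borel_measurable path_space"
  proof (cases "k = 0")
    case False
    have "(\<lambda>w. restrict w {1..k}) \<in> path_space \<rightarrow>\<^sub>M PiM {1..k} (\<lambda>_. borel)"
      by (rule measurable_restrict_subset) simp
    then show ?thesis using assms False by (intro measurable_compose[OF _ assms[rule_format, of k]]) auto
  qed (simp add: restrict_def)
qed

theorem proposition2p6:
  fixes M :: "'w measure" and E :: "'e measure" and \<xi> :: "nat \<Rightarrow> 'w \<Rightarrow> 'e"
    and L :: "'e \<Rightarrow> real measure measure"
    and Q :: "(nat \<Rightarrow> 'e) \<Rightarrow> (nat \<Rightarrow> real) measure"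
  defines "\<nu> \<equiv> \<lambda>z. the_enat (future_min_time z)"
    and "\<Gamma>\<^sub>1 \<equiv> \<lambda>S. the_enat (weak_ladder_epoch S)"
  assumes "prob_space M"
    and "prob_space.indep_vars M (\<lambda>_. E) \<xi> {1..}"
    and "\<And>n. n \<ge> 1 \<Longrightarrow> distr M E (\<xi> n) = distr M E (\<xi> 1)"
    and "L \<in> E \<rightarrow>\<^sub>M prob_algebra configuration_space"
    and "assumption_A1 M (\<lambda>\<omega>. L (\<xi> 1 \<omega>))"
    and "assumption_A2 M (\<lambda>\<omega>. L (\<xi> 1 \<omega>))"
    and "assumption_A3 M (\<lambda>\<omega>. L (\<xi> 1 \<omega>))"
    and "AE \<omega> in M. markov_chain_law (conditioned_kernel L (\<lambda>n. \<xi> n \<omega>)) 0 (Q (\<lambda>n. \<xi> n \<omega>))"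
  shows "(AE z in tilted_law M \<xi> L Q. future_min_time z < \<infinity>) \<and>
    (AE S in annealed_walk M \<xi> L. weak_ladder_epoch S < \<infinity>) \<and>
    distr (tilted_law M \<xi> L Q) borel (\<lambda>z. z (\<nu> z)) =
      distr (annealed_walk M \<xi> L) borel (\<lambda>S. S (\<Gamma>\<^sub>1 S)) \<and>
    (\<forall>f :: nat \<Rightarrow> (nat \<Rightarrow> real) \<Rightarrow> ennreal.
      (\<forall>k\<ge>1. f k \<in> borel_measurable (PiM {1..k} (\<lambda>_. borel))) \<longrightarrow>
      (\<integral>\<^sup>+z. f (\<nu> z) (\<lambda>i\<in>{1..\<nu> z}. z i) \<partial>(tilted_law M \<xi> L Q)) =
      (\<integral>\<^sup>+S. f (\<Gamma>\<^sub>1 S) (\<lambda>i\<in>{1..\<Gamma>\<^sub>1 S}. S (\<Gamma>\<^sub>1 S) - S (\<Gamma>\<^sub>1 S - i)) \<partial>(annealed_walk M \<xi> L))) \<and>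
    (\<forall>f :: nat \<Rightarrow> (nat \<Rightarrow> real) \<Rightarrow> real.
      (\<forall>k\<ge>1. f k \<in> borel_measurable (PiM {1..k} (\<lambda>_. borel))) \<longrightarrow>
      (integrable (tilted_law M \<xi> L Q) (\<lambda>z. f (\<nu> z) (\<lambda>i\<in>{1..\<nu> z}. z i)) \<longleftrightarrow>
       integrable (annealed_walk M \<xi> L)
         (\<lambda>S. f (\<Gamma>\<^sub>1 S) (\<lambda>i\<in>{1..\<Gamma>\<^sub>1 S}. S (\<Gamma>\<^sub>1 S) - S (\<Gamma>\<^sub>1 S - i)))) \<and>
      (\<integral>z. f (\<nu> z) (\<lambda>i\<in>{1..\<nu> z}. z i) \<partial>(tilted_law M \<xi> L Q)) =
      (\<integral>S. f (\<Gamma>\<^sub>1 S) (\<lambda>i\<in>{1..\<Gamma>\<^sub>1 S}. S (\<Gamma>\<^sub>1 S) - S (\<Gamma>\<^sub>1 S - i)) \<partial>(annealed_walk M \<xi> L)))"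
proof -
  interpret M: prob_space M by fact
  interpret walk_environment M E \<xi> L Q
    by (intro walk_environment.intro walk_environment_axioms.intro) (fact assms)+
  let ?A = "annealed_walk M \<xi> L" and ?D = "count_space (UNIV :: nat set) \<Otimes>\<^sub>M path_space"
  have sets_A [measurable_cong, simp]: "sets ?A = sets path_space" by (simp add: annealed_walk_eq)
  have law: "distr T ?D future_pair = distr ?A ?D ladder_pair"
    unfolding annealed_walk_eq by (rule pair_law)
  have fp: "future_pair \<in> T \<rightarrow>\<^sub>M ?D" and lp: "ladder_pair \<in> ?A \<rightarrow>\<^sub>M ?D" by measurable
  have fst_eq: "fst (future_pair z) = \<nu> z" "fst (ladder_pair z) = \<Gamma>\<^sub>1 z" for z
    by (simp_all add: future_pair_def ladder_pair_def \<nu>_def \<Gamma>\<^sub>1_def Let_def)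
  have restr: "restrict (snd (future_pair z)) {1..\<nu> z} = (\<lambda>i\<in>{1..\<nu> z}. z i)"
    "restrict (snd (ladder_pair z)) {1..\<Gamma>\<^sub>1 z} = (\<lambda>i\<in>{1..\<Gamma>\<^sub>1 z}. z (\<Gamma>\<^sub>1 z) - z (\<Gamma>\<^sub>1 z - i))" for z
    by (auto simp: future_pair_def ladder_pair_def \<nu>_def \<Gamma>\<^sub>1_def Let_def trunc_def reversed_def)
  have ae1: "AE z in T. future_min_time z < \<infinity>" by (rule AE_future_min_time_finite)
  have ae2: "AE S in ?A. weak_ladder_epoch S < \<infinity>"
  proof -
    have s: "{S \<in> space path_space. weak_ladder_epoch S < \<infinity>} \<in> sets path_space" by measurable
    have p: "psum \<in> W.steps \<rightarrow>\<^sub>M path_space" by measurable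
    show ?thesis
      unfolding annealed_walk_eq AE_distr_iff[OF p s] by (rule W.AE_weak_ladder_epoch_finite)
  qed
  have "distr T borel (\<lambda>z. z (\<nu> z)) = distr ?A borel (\<lambda>S. S (\<Gamma>\<^sub>1 S))"
  proof -
    have m: "(\<lambda>p. snd p (fst p)) \<in> borel_measurable ?D"
      by (rule measurable_countable_arg) measurable
    have "distr T borel (\<lambda>z. z (\<nu> z)) = distr T borel (\<lambda>z. snd (future_pair z) (fst (future_pair z)))"
    proof (rule distr_cong_AE)
      show "AE z in T. z (\<nu> z) = snd (future_pair z) (fst (future_pair z))"
        using ae1
      proof eventually_elim
        case (elim z)
        then obtain k where "future_min_time z = enat k" by (auto simp: finite_time_iff)
        then show ?case using future_min_time_eq_iff[of z k] by (simp add: future_pair_def \<nu>_def trunc_def)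
      qed
      show "(\<lambda>z. z (\<nu> z)) \<in> T \<rightarrow>\<^sub>M borel"
        unfolding \<nu>_def by (rule measurable_compose_countable[where f = "\<lambda>k z. z k"]) measurable
    qed (use measurable_compose[OF fp m] in auto)
    also have "\<dots> = distr (distr T ?D future_pair) borel (\<lambda>p. snd p (fst p))"
      by (subst distr_distr[OF m fp]) (simp add: comp_def)
    also have "\<dots> = distr ?A borel (\<lambda>S. snd (ladder_pair S) (fst (ladder_pair S)))"
      unfolding law by (subst distr_distr[OF m lp]) (simp add: comp_def)
    also have "\<dots> = distr ?A borel (\<lambda>S. S (\<Gamma>\<^sub>1 S))"
    proof (rule distr_cong_AE)
      have "{S. S 0 = (0 :: real)} \<in> sets path_space" by (rule path_setI) measurable
      then have "AE S in ?A. S 0 = 0" unfolding annealed_walk_eq by (subst AE_distr_iff) auto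
      then show "AE S in ?A. snd (ladder_pair S) (fst (ladder_pair S)) = S (\<Gamma>\<^sub>1 S)"
        using ae2
      proof eventually_elim
        case (elim S)
        then obtain k where "weak_ladder_epoch S = enat k" by (auto simp: finite_time_iff)
        then show ?case using weak_ladder_epoch_eq_iff[of S k] elim(1)
          by (simp add: ladder_pair_def \<Gamma>\<^sub>1_def trunc_def reversed_def)
      qed
      show "(\<lambda>S. S (\<Gamma>\<^sub>1 S)) \<in> ?A \<rightarrow>\<^sub>M borel"
        unfolding \<Gamma>\<^sub>1_def by (rule measurable_compose_countable[where f = "\<lambda>k z. z k"]) measurable
    qed (use measurable_compose[OF lp m] in auto)
    finally show ?thesis .
  qed
  moreover have "(\<integral>\<^sup>+z. f (\<nu> z) (\<lambda>i\<in>{1..\<nu> z}. z i) \<partial>T) =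
      (\<integral>\<^sup>+S. f (\<Gamma>\<^sub>1 S) (\<lambda>i\<in>{1..\<Gamma>\<^sub>1 S}. S (\<Gamma>\<^sub>1 S) - S (\<Gamma>\<^sub>1 S - i)) \<partial>?A)"
    if f: "\<forall>k\<ge>1. f k \<in> borel_measurable (PiM {1..k} (\<lambda>_. borel))" for f :: "nat \<Rightarrow> (nat \<Rightarrow> real) \<Rightarrow> ennreal"
  proof -
    let ?F = "\<lambda>p. f (fst p) (restrict (snd p) {1..fst p})"
    have "(\<integral>\<^sup>+p. ?F p \<partial>distr T ?D future_pair) = (\<integral>\<^sup>+z. ?F (future_pair z) \<partial>T)"
      using measurable_restricted_arg[OF f] by (intro nn_integral_distr[OF fp]) simp
    moreover have "(\<integral>\<^sup>+p. ?F p \<partial>distr ?A ?D ladder_pair) = (\<integral>\<^sup>+S. ?F (ladder_pair S) \<partial>?A)"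
      using measurable_restricted_arg[OF f] by (intro nn_integral_distr[OF lp]) simp
    ultimately show ?thesis unfolding law fst_eq restr by simp
  qed
  moreover have "(integrable T (\<lambda>z. f (\<nu> z) (\<lambda>i\<in>{1..\<nu> z}. z i)) \<longleftrightarrow>
       integrable ?A (\<lambda>S. f (\<Gamma>\<^sub>1 S) (\<lambda>i\<in>{1..\<Gamma>\<^sub>1 S}. S (\<Gamma>\<^sub>1 S) - S (\<Gamma>\<^sub>1 S - i)))) \<and>
      (\<integral>z. f (\<nu> z) (\<lambda>i\<in>{1..\<nu> z}. z i) \<partial>T) =
      (\<integral>S. f (\<Gamma>\<^sub>1 S) (\<lambda>i\<in>{1..\<Gamma>\<^sub>1 S}. S (\<Gamma>\<^sub>1 S) - S (\<Gamma>\<^sub>1 S - i)) \<partial>?A)"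
    if f: "\<forall>k\<ge>1. f k \<in> borel_measurable (PiM {1..k} (\<lambda>_. borel))" for f :: "nat \<Rightarrow> (nat \<Rightarrow> real) \<Rightarrow> real"
    using integrable_distr_eq[OF fp measurable_restricted_arg[OF f]]
      integrable_distr_eq[OF lp measurable_restricted_arg[OF f]]
      integral_distr[OF fp measurable_restricted_arg[OF f]]
      integral_distr[OF lp measurable_restricted_arg[OF f]]
    unfolding law fst_eq restr by simp
  ultimately show ?thesis using ae1 ae2 by blast
qed

end
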